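(* Let $T>0$, let $\Omega\subset\mathbb{R}^N$ be a (sufficiently smooth) bounded domain, $\Omega_T=(0,T)\times\Omega$, and let $(k,l)\in\mathcal{PC}$. Let $u_0\in L_2(\Omega)$, $f\in L_2(\Omega_T)$, $u\in L_2(\Omega_T)$ and $k\ast u\in C([0,T];L_2(\Omega))$ such that $(k\ast u)|_{t=0}=0$. Assume that one of the following conditions is satisfied. (D) $w\in L_2((0,T);\mathring{H}^1_2(\Omega))$, $w\ge0$, and for all $\psi\in\mathring{H}^1_2(\Omega)$ with $\psi\ge0$ and all $n\in\mathbb{N}$, $$\int_\Omega\Big(\psi\,\partial_t\big(k_n\ast[u-u_0]\big)+(h_n\ast\nabla w)\cdot\nabla\psi\Big)\,dx\le\int_\Omega(h_n\ast f)\,\psi\,dx\quad\text{for a.a. }t\in(0,T).\qquad(\star)$$ (N) $w\in L_2((0,T);H^1_2(\Omega))$, $w\ge0$, and $(\star)$ holds for all $\psi\in H^1_2(\Omega)$ with $\psi\ge0$ and all $n\in\mathbb{N}$. Then $$\int_0^T\!\!\int_\Omega w\,u\,dx\,dt+\frac12\int_0^T\!\!\int_\Omega\big[k(T-t)+k(t)\big]\,|l\overset{T}{\ast}\nabla w|^2\,dx\,dt\le\int_0^T\!\!\int_\Omega\big(u_0+l\ast f\big)\,w\,dx\,dt.$$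
   Context: Condition $\mathcal{PC}$: $(k,l)\in\mathcal{PC}$ means that $k\in L_{1,loc}([0,\infty))$ is nonnegative and nonincreasing and $l\in L_{1,loc}([0,\infty))$ satisfies $k\ast l=1$ on $(0,\infty)$ (such $l$ is automatically nonnegative). Convolutions in time: $(k\ast v)(t)=\int_0^t k(t-\tau)v(\tau)\,d\tau$ and $(l\overset{T}{\ast}g)(t)=\int_t^T l(\tau-t)g(\tau)\,d\tau$ for $t\in(0,T)$. In $k_n\ast[u-u_0]$ the function $u_0=u_0(x)$ is regarded as constant in time. Regularized kernels: for $n\in\mathbb{N}$, $h_n\in L_{1,loc}([0,\infty))$ is the unique solution of $h_n(t)+n(h_n\ast l)(t)=n\,l(t)$, $t>0$, and $k_n=k\ast h_n$. Known facts: $h_n\ge0$, $k_n$ is nonnegative, nonincreasing and locally absolutely continuous on $[0,\infty)$ with locally integrable derivative; $h_n\ast g\to g$ in $L_p((0,T))$ as $n\to\infty$ for $g\in L_p((0,T))$, $1\le p<\infty$. Spaces: $H^1_2(\Omega)=W^{1,2}(\Omega)$ and $\mathring{H}^1_2(\Omega)$ is the closure of $C_0^\infty(\Omega)$ in $H^1_2(\Omega)$. The inequality $(\star)$ is the time-regularized weak formulation of $\partial_t(k\ast[u-u_0])-\Delta w\le f$. *)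

theory Defs
  imports "HOL-Analysis.Analysis"
begin

text \<open>
  Elements of the Lebesgue spaces are represented by Borel functions. Every class contains such a
  representative, and everything below depends on the values almost everywhere only.
  A function on \<open>\<Omega>\<^sub>T = (0,T) \<times> \<Omega>\<close> is written in curried form \<open>u t x\<close>.
\<close>

definition L2_on :: "'a::euclidean_space set \<Rightarrow> ('a \<Rightarrow> 'b::euclidean_space) \<Rightarrow> bool" where
  "L2_on A f \<longleftrightarrow>
     set_borel_measurable lborel A f \<and> set_integrable lborel A (\<lambda>x. (norm (f x))\<^sup>2)"

definition L1_loc :: "(real \<Rightarrow> real) \<Rightarrow> bool" where
  "L1_loc k \<longleftrightarrow> (\<forall>S\<ge>0. set_integrable lborel {0..S} k)"

definition conv :: "(real \<Rightarrow> real) \<Rightarrow> (real \<Rightarrow> 'b::euclidean_space) \<Rightarrow> real \<Rightarrow> 'b" where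
  "conv k v t = (LINT s:{0<..<t}|lborel. k (t - s) *\<^sub>R v s)"

definition bconv :: "real \<Rightarrow> (real \<Rightarrow> real) \<Rightarrow> (real \<Rightarrow> 'b::euclidean_space) \<Rightarrow> real \<Rightarrow> 'b" where
  "bconv T l g t = (LINT s:{t<..<T}|lborel. l (s - t) *\<^sub>R g s)"

text \<open>
  Monotonicity is required on \<open>(0,\<infinity>)\<close> only: \<open>k\<close> may be singular at \<open>0\<close>, so the value at \<open>0\<close> carries
  no meaning. A convolution of locally integrable functions is defined almost everywhere.
\<close>

definition PC :: "(real \<Rightarrow> real) \<Rightarrow> (real \<Rightarrow> real) \<Rightarrow> bool" where
  "PC k l \<longleftrightarrow>
     L1_loc k \<and> (\<forall>t>0. 0 \<le> k t) \<and> antimono_on {0<..} k \<and>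
     L1_loc l \<and> (AE t in lborel. 0 < t \<longrightarrow> conv k l t = 1)"

definition resolvent_kernel :: "(real \<Rightarrow> real) \<Rightarrow> nat \<Rightarrow> (real \<Rightarrow> real) \<Rightarrow> bool" where
  "resolvent_kernel l n h \<longleftrightarrow>
     L1_loc h \<and> (AE t in lborel. 0 < t \<longrightarrow> h t + real n * conv h l t = real n * l t)"

text \<open>
  Functions of class \<open>C\<^sup>m\<close> on the whole space, by recursion over the partial derivatives.
\<close>

primrec C_k :: "nat \<Rightarrow> ('a::euclidean_space \<Rightarrow> real) \<Rightarrow> bool" where
  "C_k 0 f \<longleftrightarrow> continuous_on UNIV f"
| "C_k (Suc m) f \<longleftrightarrow>
     (\<forall>x. f differentiable at x) \<and> (\<forall>i\<in>Basis. C_k m (\<lambda>x. frechet_derivative f (at x) i))"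

definition test_function :: "'a::euclidean_space set \<Rightarrow> ('a \<Rightarrow> real) \<Rightarrow> bool" where
  "test_function \<Omega> \<phi> \<longleftrightarrow>
     (\<forall>m. C_k m \<phi>) \<and> compact (closure {x. \<phi> x \<noteq> 0}) \<and> closure {x. \<phi> x \<noteq> 0} \<subseteq> \<Omega>"

definition grad :: "('a::euclidean_space \<Rightarrow> real) \<Rightarrow> 'a \<Rightarrow> 'a" where
  "grad \<phi> x = (\<Sum>i\<in>Basis. frechet_derivative \<phi> (at x) i *\<^sub>R i)"

text \<open>
  Weak gradients form a relation (unique up to null sets), in the style of \<open>has_derivative\<close>.
\<close>

definition weak_gradient ::
    "'a::euclidean_space set \<Rightarrow> ('a \<Rightarrow> real) \<Rightarrow> ('a \<Rightarrow> 'a) \<Rightarrow> bool" where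
  "weak_gradient \<Omega> v g \<longleftrightarrow> L2_on \<Omega> g \<and>
     (\<forall>\<phi>. test_function \<Omega> \<phi> \<longrightarrow>
        (LINT x:\<Omega>|lborel. v x *\<^sub>R grad \<phi> x) = - (LINT x:\<Omega>|lborel. \<phi> x *\<^sub>R g x))"

definition H1 :: "'a::euclidean_space set \<Rightarrow> ('a \<Rightarrow> real) set" where
  "H1 \<Omega> = {v. L2_on \<Omega> v \<and> (\<exists>g. weak_gradient \<Omega> v g)}"

definition H10 :: "'a::euclidean_space set \<Rightarrow> ('a \<Rightarrow> real) set" where
  "H10 \<Omega> = {v \<in> H1 \<Omega>. \<exists>g \<phi>. weak_gradient \<Omega> v g \<and> (\<forall>j::nat. test_function \<Omega> (\<phi> j)) \<and>
      (\<lambda>j. LINT x:\<Omega>|lborel. (\<phi> j x - v x)\<^sup>2) \<longlonglongrightarrow> 0 \<and>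
      (\<lambda>j. LINT x:\<Omega>|lborel. (norm (grad (\<phi> j) x - g x))\<^sup>2) \<longlonglongrightarrow> 0}"

text \<open>
  \<open>w \<in> L\<^sub>2((0,T);V)\<close> with spatial gradient \<open>Dw\<close>, for \<open>V = H1 \<Omega>\<close> or \<open>V = H10 \<Omega>\<close>. The map
  \<open>v \<mapsto> (v, \<nabla>v)\<close> embeds \<open>V\<close> isometrically as a closed subspace of a power of \<open>L\<^sub>2(\<Omega>)\<close>, and
  \<open>L\<^sub>2((0,T);L\<^sub>2(\<Omega>))\<close> is identified with \<open>L\<^sub>2(\<Omega>\<^sub>T)\<close> as usual.
\<close>

definition L2_Sobolev ::
    "real \<Rightarrow> 'a::euclidean_space set \<Rightarrow> ('a \<Rightarrow> real) set \<Rightarrow>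
      (real \<Rightarrow> 'a \<Rightarrow> real) \<Rightarrow> (real \<Rightarrow> 'a \<Rightarrow> 'a) \<Rightarrow> bool" where
  "L2_Sobolev T \<Omega> V w Dw \<longleftrightarrow>
     L2_on ({0<..<T} \<times> \<Omega>) (\<lambda>(t, x). w t x) \<and> L2_on ({0<..<T} \<times> \<Omega>) (\<lambda>(t, x). Dw t x) \<and>
     (AE t in lborel. t \<in> {0<..<T} \<longrightarrow> w t \<in> V \<and> weak_gradient \<Omega> (w t) (Dw t))"

text \<open>
  \<open>D \<in> L\<^sub>2((0,T);L\<^sub>2(\<Omega>))\<close> is the weak derivative of \<open>v\<close> as an \<open>L\<^sub>2(\<Omega>)\<close>-valued function of time:
  the defining identity of Bochner integrals holds almost everywhere in \<open>\<Omega>\<close>.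
\<close>

definition weak_time_derivative ::
    "real \<Rightarrow> 'a::euclidean_space set \<Rightarrow> (real \<Rightarrow> 'a \<Rightarrow> real) \<Rightarrow> (real \<Rightarrow> 'a \<Rightarrow> real) \<Rightarrow> bool" where
  "weak_time_derivative T \<Omega> v D \<longleftrightarrow> L2_on ({0<..<T} \<times> \<Omega>) (\<lambda>(t, x). D t x) \<and>
     (\<forall>\<eta>. test_function {0<..<T} \<eta> \<longrightarrow>
        (AE x in lborel. x \<in> \<Omega> \<longrightarrow>
           (LINT t:{0<..<T}|lborel. deriv \<eta> t * v t x) =
           - (LINT t:{0<..<T}|lborel. \<eta> t * D t x)))"

text \<open>
  \<open>c\<close> is the representative of \<open>v\<close> in \<open>C([0,T];L\<^sub>2(\<Omega>))\<close>; the values of \<open>v\<close> at individual times,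
  such as \<open>t = 0\<close>, are to be read off from \<open>c\<close>.
\<close>

definition continuous_L2_rep ::
    "real \<Rightarrow> 'a::euclidean_space set \<Rightarrow> (real \<Rightarrow> 'a \<Rightarrow> real) \<Rightarrow> (real \<Rightarrow> 'a \<Rightarrow> real) \<Rightarrow> bool" where
  "continuous_L2_rep T \<Omega> v c \<longleftrightarrow>
     (\<forall>t\<in>{0..T}. L2_on \<Omega> (c t)) \<and>
     (\<forall>t\<in>{0..T}. ((\<lambda>s. LINT x:\<Omega>|lborel. (c s x - c t x)\<^sup>2) \<longlongrightarrow> 0) (at t within {0..T})) \<and>
     (AE t in lborel. t \<in> {0<..<T} \<longrightarrow> (AE x in lborel. x \<in> \<Omega> \<longrightarrow> c t x = v t x))"

text \<open>
  The inequality \<open>(\<star>)\<close> for all nonnegative \<open>\<psi> \<in> V\<close> and all \<open>n \<ge> 1\<close>, with \<open>k\<^sub>n = k * h\<^sub>n\<close>. Here \<open>g\<close> and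
  \<open>D\<close> range over the representatives of \<open>\<nabla>\<psi>\<close> and of \<open>\<partial>\<^sub>t(k\<^sub>n * [u - u\<^sub>0])\<close>. The exceptional null set of
  times may depend on \<open>\<psi>\<close> and \<open>n\<close>.
\<close>

definition regularized_ineq ::
    "real \<Rightarrow> 'a::euclidean_space set \<Rightarrow> ('a \<Rightarrow> real) set \<Rightarrow> (real \<Rightarrow> real) \<Rightarrow> (nat \<Rightarrow> real \<Rightarrow> real) \<Rightarrow>
      (real \<Rightarrow> 'a \<Rightarrow> real) \<Rightarrow> ('a \<Rightarrow> real) \<Rightarrow> (real \<Rightarrow> 'a \<Rightarrow> 'a) \<Rightarrow> (real \<Rightarrow> 'a \<Rightarrow> real) \<Rightarrow> bool" where
  "regularized_ineq T \<Omega> V k h u u0 Dw f \<longleftrightarrow>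
     (\<forall>\<psi>\<in>V. \<forall>n\<ge>1. \<forall>g D.
        (AE x in lborel. x \<in> \<Omega> \<longrightarrow> 0 \<le> \<psi> x) \<longrightarrow>
        weak_gradient \<Omega> \<psi> g \<longrightarrow>
        weak_time_derivative T \<Omega> (\<lambda>t x. conv (conv k (h n)) (\<lambda>s. u s x - u0 x) t) D \<longrightarrow>
        (AE t in lborel. t \<in> {0<..<T} \<longrightarrow>
           (LINT x:\<Omega>|lborel. \<psi> x * D t x + conv (h n) (\<lambda>s. Dw s x) t \<bullet> g x)
           \<le> (LINT x:\<Omega>|lborel. conv (h n) (\<lambda>s. f s x) t * \<psi> x)))"

text \<open>
  Lipschitz regularity, the weakest class usually meant by a sufficiently smooth boundary: near each
  boundary point \<open>\<Omega>\<close> is the subgraph, in some direction \<open>e\<close>, of a Lipschitz function of the component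
  orthogonal to \<open>e\<close>.
\<close>

definition lipschitz_boundary :: "'a::euclidean_space set \<Rightarrow> bool" where
  "lipschitz_boundary \<Omega> \<longleftrightarrow>
     (\<forall>p\<in>frontier \<Omega>. \<exists>e \<gamma> L U. norm e = 1 \<and> open U \<and> p \<in> U \<and>
        L-lipschitz_on {y. y \<bullet> e = 0} (\<gamma> :: 'a \<Rightarrow> real) \<and>
        \<Omega> \<inter> U = {x \<in> U. x \<bullet> e < \<gamma> (x - (x \<bullet> e) *\<^sub>R e)})"

end

theory Submission
  imports Defs
begin

text \<open>
  Write \<open>v = u - u\<^sub>0\<close>. Formally the inequality says \<open>\<partial>\<^sub>t (k * v) - \<Delta> w \<le> f\<close>, and \<open>l * \<partial>\<^sub>t (k * v) = v\<close>.
  Convolution of the inequality with \<open>l\<close> and multiplication by \<open>w \<ge> 0\<close> give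
  \<open>\<integral>\<integral> w v + \<integral>\<integral> \<nabla>w \<bullet> (l * \<nabla>w) \<le> \<integral>\<integral> (l * f) w\<close>. What remains is the coercivity estimate
  \<open>\<integral> g \<bullet> (l * g) \<ge> 1/2 \<integral> [k (T - t) + k t] \<bar>l * g\<bar>\<^sup>2\<close> for functions \<open>g\<close> of time, applied to \<open>g = \<nabla>w\<close> with
  time reversed, for almost every \<open>x\<close>.

  No test function that depends on time is needed for the first step. For almost every \<open>s\<close> the function
  \<open>\<psi> = w s\<close> is admissible. The inequality for this \<open>\<psi>\<close> holds at almost every time \<open>t\<close>. It is multiplied
  by \<open>l (s - t) \<ge> 0\<close> and integrated over \<open>t\<close> and \<open>s\<close> (\<open>tested_inequality\<close>). All regularized quantities
  are explicit: the resolvent equation and \<open>k * l = 1\<close> give \<open>k\<^sub>n = n (1 - 1 * h\<^sub>n)\<close>. Hence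
  \<open>\<partial>\<^sub>t (k\<^sub>n * v) = n (v - h\<^sub>n * v)\<close>, and convolution with \<open>l\<close> turns this into \<open>h\<^sub>n * v\<close>. Moreover
  \<open>l * h\<^sub>n = l - h\<^sub>n / n\<close>. So only \<open>\<integral>\<integral> w (h\<^sub>n * v)\<close> requires a limit theorem; it converges because the
  \<open>h\<^sub>n\<close> form an approximate identity (\<open>conv_defect_tendsto\<close>).

  The coercivity estimate rests on an elementary inequality for a bounded nonincreasing kernel
  \<open>a = A - \<integral>\<^sub>0\<^sup>t b\<close> with \<open>b \<ge> 0\<close>: the derivative of \<open>a * y\<close> is \<open>A y - b * y\<close>, and \<open>2 y t \<bullet> y s \<le> \<bar>y t\<bar>\<^sup>2 + \<bar>y s\<bar>\<^sup>2\<close>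
  bounds its pairing with \<open>y\<close> from below by \<open>1/2 \<integral> [a t + a (T - t)] \<bar>y\<bar>\<^sup>2\<close> (\<open>dissipation_inequality\<close>).
  With \<open>a = k\<^sub>n\<close> and \<open>y = l * g\<close> the derivative is \<open>h\<^sub>n * g\<close>, and Fatou's lemma yields the estimate for \<open>k\<close>
  (\<open>kernel_energy_inequality\<close>).

  The signs of \<open>h\<^sub>n\<close> and \<open>l\<close> are consequences of the monotonicity of \<open>k\<close>. The same elementary
  inequality, for averages of \<open>k\<close> and applied to negative parts, is a maximum principle
  (\<open>negative_part_energy\<close>). It shows that the primitive of \<open>h\<^sub>n\<close> is nondecreasing, hence \<open>h\<^sub>n \<ge> 0\<close>. Then
  \<open>l = h\<^sub>n / n + h\<^sub>n * l\<close> forces \<open>l \<ge> 0\<close> (\<open>kernel_nonneg_of_resolvent\<close>).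
\<close>

section \<open>Convolution on a bounded time interval\<close>

text \<open>  A convolution at a time in \<open>(0,T)\<close> depends on the values of its factors in \<open>(0,T)\<close> only. Hence
  all functions of time are cut off to \<open>(0,T)\<close>. With the cut-off convolution \<open>tconv\<close> below, the
  integrable functions supported in \<open>(0,T)\<close> form a commutative algebra, which acts on the square
  integrable functions supported in \<open>(0,T)\<close>.\<close>

definition L1_supp :: "real \<Rightarrow> (real \<Rightarrow> 'b::euclidean_space) \<Rightarrow> bool" where
  "L1_supp T v \<longleftrightarrow> integrable lborel v \<and> (\<forall>t. t \<notin> {0<..<T} \<longrightarrow> v t = 0)"

definition L2_supp :: "real \<Rightarrow> (real \<Rightarrow> 'b::euclidean_space) \<Rightarrow> bool" where
  "L2_supp T v \<longleftrightarrow> v \<in> borel_measurable borel \<and> integrable lborel (\<lambda>t. (norm (v t))\<^sup>2) \<and>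
     (\<forall>t. t \<notin> {0<..<T} \<longrightarrow> v t = 0)"

definition tconv :: "real \<Rightarrow> (real \<Rightarrow> real) \<Rightarrow> (real \<Rightarrow> 'b::euclidean_space) \<Rightarrow> real \<Rightarrow> 'b" where
  "tconv T p v t = indicator {0<..<T} t *\<^sub>R (LINT s|lborel. p (t - s) *\<^sub>R v s)"

text \<open>  On \<open>(0,T)\<close> this is the constant kernel \<open>1\<close>, so that \<open>tconv T (unit_step T) v\<close> is the primitive of
  \<open>v\<close> that vanishes at \<open>0\<close>.\<close>

abbreviation unit_step :: "real \<Rightarrow> real \<Rightarrow> real" where
  "unit_step T \<equiv> indicator {0<..<T}"

text \<open>  No integrability is assumed: for \<open>c \<noteq> 0\<close> both integrals exist or both have the default value \<open>0\<close>.\<close>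

lemma integral_scaleR_vector:
  fixes c :: "'b::euclidean_space"
  shows "(LINT x|M. f x *\<^sub>R c) = (LINT x|M. f x) *\<^sub>R c"
proof (cases "c = 0")
  case False
  then show ?thesis
    by (intro integral_bounded_linear'[where T = "\<lambda>y. y *\<^sub>R c" and T' = "\<lambda>y. (y \<bullet> c) / (c \<bullet> c)"]
        bounded_linear_scaleR_left bounded_linear_divide bounded_linear_inner_left_comp
        bounded_linear_compose[OF bounded_linear_divide bounded_linear_inner_left]) simp
qed simp

text \<open>  Translation invariance and Tonelli. The map \<open>c\<close> makes the lemma usable for the iterated
  convolutions in the proof of associativity, where \<open>z\<close> is a pair of times.\<close>

lemma integrable_kernel_pair:
  fixes p :: "real \<Rightarrow> real" and G :: "'c::euclidean_space \<Rightarrow> 'b::euclidean_space"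
  assumes p: "integrable lborel p" and G: "integrable lborel G"
    and c [measurable]: "c \<in> borel_measurable borel"
  shows "integrable (lborel \<Otimes>\<^sub>M lborel) (\<lambda>(t, z). p (t - c z) *\<^sub>R G z)"
    and "(LINT z|lborel. LINT t|lborel. \<bar>p (t - c z)\<bar> * norm (G z)) =
      (LINT t|lborel. \<bar>p t\<bar>) * (LINT z|lborel. norm (G z))"
proof -
  have [measurable]: "p \<in> borel_measurable borel" "G \<in> borel_measurable borel"
    using p G by auto
  have i: "(LINT t|lborel. \<bar>p (t - a)\<bar>) = (LINT t|lborel. \<bar>p t\<bar>)" for a
    using lborel_integral_real_affine[of 1 "\<lambda>t. \<bar>p t\<bar>" "-a"] by simp
  have ip: "integrable lborel (\<lambda>t. p (t - a))" for a
    using lborel_integrable_real_affine[OF p, of 1 "-a"] by simp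
  have "integrable (lborel \<Otimes>\<^sub>M lborel) (\<lambda>(z, t). p (t - c z) *\<^sub>R G z)"
  proof (rule lborel_pair.Fubini_integrable)
    show "integrable lborel (\<lambda>z. LINT t|lborel. norm (case (z, t) of (z, t) \<Rightarrow> p (t - c z) *\<^sub>R G z))"
      using G by (simp add: i)
    show "AE z in lborel. integrable lborel (\<lambda>t. case (z, t) of (z, t) \<Rightarrow> p (t - c z) *\<^sub>R G z)"
      using ip by auto
  qed measurable
  from lborel_pair.integrable_product_swap[OF this]
  show "integrable (lborel \<Otimes>\<^sub>M lborel) (\<lambda>(t, z). p (t - c z) *\<^sub>R G z)" by simp
  show "(LINT z|lborel. LINT t|lborel. \<bar>p (t - c z)\<bar> * norm (G z)) =
      (LINT t|lborel. \<bar>p t\<bar>) * (LINT z|lborel. norm (G z))"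
    by (simp add: i)
qed

lemma L1_suppD:
  assumes "L1_supp T v"
  shows "integrable lborel v" "v \<in> borel_measurable borel" "t \<notin> {0<..<T} \<Longrightarrow> v t = 0"
  using assms unfolding L1_supp_def by auto

lemma L1_supp_unit_step: "L1_supp T (unit_step T)"
  unfolding L1_supp_def by (auto intro!: integrable_real_indicator emeasure_bounded_finite)

lemma L1_supp_diff: "L1_supp T v \<Longrightarrow> L1_supp T w \<Longrightarrow> L1_supp T (\<lambda>t. v t - w t)"
  unfolding L1_supp_def by auto

lemma L1_supp_mult: "L1_supp T v \<Longrightarrow> L1_supp T (\<lambda>t. c * v t :: real)"
  unfolding L1_supp_def by auto

lemma L1_supp_truncate:
  assumes "integrable lborel v"
  shows "L1_supp T (\<lambda>t. unit_step T t *\<^sub>R v t)"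
  using assms integrable_mult_indicator[of "{0<..<T}" lborel v]
  unfolding L1_supp_def by auto

lemma AE_integrable_conv:
  fixes v :: "real \<Rightarrow> 'b::euclidean_space"
  assumes "integrable lborel p" "integrable lborel v"
  shows "AE t in lborel. integrable lborel (\<lambda>s. p (t - s) *\<^sub>R v s)"
  using lborel_pair.AE_integrable_fst[OF integrable_kernel_pair(1)[OF assms, of "\<lambda>s. s"]] by simp

lemma L1_supp_tconv:
  fixes v :: "real \<Rightarrow> 'b::euclidean_space"
  assumes "integrable lborel p" "integrable lborel v"
  shows "L1_supp T (tconv T p v)"
proof -
  have "integrable lborel (\<lambda>t. LINT s|lborel. p (t - s) *\<^sub>R v s)"
    using lborel_pair.integrable_fst[OF integrable_kernel_pair(1)[OF assms, of "\<lambda>s. s"]] by simp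
  from L1_supp_truncate[OF this] show ?thesis
    unfolding tconv_def[abs_def] .
qed

lemma tconv_cong_AE:
  assumes "AE t in lborel. p t = p' t" "AE t in lborel. v t = v' t"
    and [measurable]: "p \<in> borel_measurable borel" "p' \<in> borel_measurable borel"
    "v \<in> borel_measurable borel" "v' \<in> borel_measurable borel"
  shows "tconv T p v t = tconv T p' v' t"
proof -
  have "AE s in lborel. p (t - s) = p' (t - s)"
    using AE_borel_affine[of "-1" "\<lambda>s. p s = p' s" t] assms(1) by simp
  with assms(2) have "AE s in lborel. p (t - s) *\<^sub>R v s = p' (t - s) *\<^sub>R v' s"
    by eventually_elim simp
  then have "(LINT s|lborel. p (t - s) *\<^sub>R v s) = (LINT s|lborel. p' (t - s) *\<^sub>R v' s)"
    by (intro integral_cong_AE) auto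
  then show ?thesis unfolding tconv_def by simp
qed

lemma tconv_commute: "tconv T p q t = tconv T q (p :: real \<Rightarrow> real) t"
proof -
  have "(LINT s|lborel. p (t - s) * q s) = (LINT s|lborel. q (t - s) * p s)"
    using lborel_integral_real_affine[of "-1" "\<lambda>s. p (t - s) * q s" t] by (simp add: mult.commute)
  then show ?thesis unfolding tconv_def by simp
qed

lemma tconv_scaleR_left: "tconv T (\<lambda>t. c * p t) v t = c *\<^sub>R tconv T p v t"
  unfolding tconv_def by (simp flip: scaleR_scaleR) (simp add: scaleR_left_commute)

lemma tconv_scaleR_right: "tconv T p (\<lambda>t. c *\<^sub>R v t) t = c *\<^sub>R tconv T p v t"
proof -
  have "(\<lambda>s. p (t - s) *\<^sub>R c *\<^sub>R v s) = (\<lambda>s. c *\<^sub>R p (t - s) *\<^sub>R v s)"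
    by (simp add: mult.commute)
  then show ?thesis unfolding tconv_def integral_scaleR_right[symmetric]
    by (simp only: integral_scaleR_right scaleR_left_commute[of c])
qed

lemma tconv_diff_left:
  fixes v :: "real \<Rightarrow> 'b::euclidean_space"
  assumes "integrable lborel p" "integrable lborel q" "integrable lborel v"
  shows "AE t in lborel. tconv T (\<lambda>t. p t - q t) v t = tconv T p v t - tconv T q v t"
  using AE_integrable_conv[OF assms(1,3)] AE_integrable_conv[OF assms(2,3)]
  by eventually_elim (simp add: tconv_def scaleR_left_diff_distrib scaleR_right_diff_distrib)

lemma tconv_diff_right:
  fixes v :: "real \<Rightarrow> 'b::euclidean_space"
  assumes "integrable lborel p" "integrable lborel v" "integrable lborel w"
  shows "AE t in lborel. tconv T p (\<lambda>t. v t - w t) t = tconv T p v t - tconv T p w t"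
  using AE_integrable_conv[OF assms(1,2)] AE_integrable_conv[OF assms(1,3)]
  by eventually_elim (simp add: tconv_def scaleR_right_diff_distrib)

text \<open>  Fubini for the triple integrand. The inner cut-offs do no harm: for \<open>t < T\<close> and factors that vanish
  at nonpositive times, only intermediate times in \<open>(0,t)\<close> contribute.\<close>

lemma tconv_assoc_at:
  fixes p q :: "real \<Rightarrow> real" and v :: "real \<Rightarrow> 'b::euclidean_space"
  assumes p: "L1_supp T p" and q: "L1_supp T q" and v: "L1_supp T v"
    and i: "integrable lborel (\<lambda>(s, r). p (t - s) *\<^sub>R (q (s - r) *\<^sub>R v r))"
  shows "tconv T p (tconv T q v) t = tconv T (tconv T p q) v t"
proof (cases "t \<in> {0<..<T}")
  case True
  have i': "integrable (lborel \<Otimes>\<^sub>M lborel) (\<lambda>(s, r). p (t - s) *\<^sub>R (q (s - r) *\<^sub>R v r))"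
    using i by (simp add: lborel_prod)
  have 1: "p (t - s) *\<^sub>R tconv T q v s = (LINT r|lborel. p (t - s) *\<^sub>R (q (s - r) *\<^sub>R v r))" for s
  proof (cases "s \<in> {0<..<T}")
    case True
    then show ?thesis unfolding integral_scaleR_right by (simp add: tconv_def)
  next
    case False
    have "p (t - s) *\<^sub>R (q (s - r) *\<^sub>R v r) = 0" for r
    proof (cases "s \<le> 0")
      case True
      then show ?thesis
        using L1_suppD(3)[OF q, of "s - r"] L1_suppD(3)[OF v, of r] by (cases "r > 0") auto
    next
      case nle: False
      then show ?thesis
        using False \<open>t \<in> {0<..<T}\<close> L1_suppD(3)[OF p, of "t - s"] by auto
    qed
    then show ?thesis using False by (simp add: tconv_def del: scaleR_eq_0_iff)
  qed
  have 2: "tconv T p q (t - r) *\<^sub>R v r = (LINT s|lborel. p (t - s) *\<^sub>R (q (s - r) *\<^sub>R v r))" for r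
  proof (cases "r \<in> {0<..<T}")
    case rT: True
    have "(LINT s|lborel. p (t - s) *\<^sub>R (q (s - r) *\<^sub>R v r)) = (LINT s|lborel. p (t - s) * q (s - r)) *\<^sub>R v r"
      by (simp add: integral_scaleR_vector)
    also have "(LINT s|lborel. p (t - s) * q (s - r)) = (LINT s|lborel. p (t - r - s) * q s)"
      using lborel_integral_real_affine[of 1 "\<lambda>s. p (t - s) * q (s - r)" r]
      by (simp add: algebra_simps)
    also have "\<dots> = tconv T p q (t - r)"
    proof (cases "t - r > 0")
      case True
      then show ?thesis using rT \<open>t \<in> {0<..<T}\<close> by (simp add: tconv_def)
    next
      case False
      then have "p (t - r - s) * q s = 0" for s
        using L1_suppD(3)[OF p, of "t - r - s"] L1_suppD(3)[OF q, of s] by (cases "s > 0") auto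
      then have "(LINT s|lborel. p (t - r - s) * q s) = (LINT s|(lborel :: real measure). 0)"
        by (intro Bochner_Integration.integral_cong refl)
      then show ?thesis using False by (simp add: tconv_def)
    qed
    finally show ?thesis by simp
  next
    case False
    then show ?thesis using L1_suppD(3)[OF v, of r] by simp
  qed
  have "tconv T p (tconv T q v) t = (LINT s|lborel. LINT r|lborel. p (t - s) *\<^sub>R (q (s - r) *\<^sub>R v r))"
    using True by (simp add: tconv_def[of T p] 1)
  also have "\<dots> = (LINT r|lborel. LINT s|lborel. p (t - s) *\<^sub>R (q (s - r) *\<^sub>R v r))"
    by (rule lborel_pair.Fubini_integral[OF i', symmetric])
  also have "\<dots> = tconv T (tconv T p q) v t"
    using True by (simp add: tconv_def[of T "tconv T p q"] 2)
  finally show ?thesis .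
qed (simp add: tconv_def)

lemma tconv_assoc:
  fixes v :: "real \<Rightarrow> 'b::euclidean_space"
  assumes p: "L1_supp T p" and q: "L1_supp T q" and v: "L1_supp T v"
  shows "AE t in lborel. tconv T p (tconv T q v) t = tconv T (tconv T p q) v t"
proof -
  have "integrable (lborel \<Otimes>\<^sub>M lborel) (\<lambda>(s, r). q (s - r) *\<^sub>R v r)"
    using integrable_kernel_pair(1)[of q v "\<lambda>r. r"] L1_suppD[OF q] L1_suppD[OF v] by simp
  then have "integrable lborel (\<lambda>(s, r). q (s - r) *\<^sub>R v r)"
    by (simp add: lborel_prod)
  from integrable_kernel_pair(1)[OF L1_suppD(1)[OF p] this, of fst]
  have "integrable (lborel \<Otimes>\<^sub>M lborel)
      (\<lambda>(t, z). p (t - fst z) *\<^sub>R (case z of (s, r) \<Rightarrow> q (s - r) *\<^sub>R v r))"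
    by (simp add: borel_measurable_continuous_onI continuous_on_fst)
  from lborel_pair.AE_integrable_fst[OF this]
  have "AE t in lborel. integrable lborel (\<lambda>(s, r). p (t - s) *\<^sub>R (q (s - r) *\<^sub>R v r))"
    by (simp add: case_prod_unfold)
  then show ?thesis
    by eventually_elim (rule tconv_assoc_at[OF assms])
qed

text \<open>  With a bounded left factor the triple integrand is integrable for every \<open>t\<close>, not only for almost
  every one. This gives pointwise statements about primitives.\<close>

lemma tconv_assoc_bounded:
  fixes v :: "real \<Rightarrow> 'b::euclidean_space"
  assumes p: "L1_supp T p" and q: "L1_supp T q" and v: "L1_supp T v"
    and bound: "\<And>t. \<bar>p t\<bar> \<le> M"
  shows "tconv T p (tconv T q v) t = tconv T (tconv T p q) v t"
proof (rule tconv_assoc_at[OF p q v])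
  have [measurable]: "p \<in> borel_measurable borel" "q \<in> borel_measurable borel" "v \<in> borel_measurable borel"
    using L1_suppD(2)[OF p] L1_suppD(2)[OF q] L1_suppD(2)[OF v] by auto
  have "integrable (lborel \<Otimes>\<^sub>M lborel) (\<lambda>(s, r). q (s - r) *\<^sub>R v r)"
    using integrable_kernel_pair(1)[of q v "\<lambda>r. r"] L1_suppD[OF q] L1_suppD[OF v] by simp
  then have "integrable (lborel \<Otimes>\<^sub>M lborel) (\<lambda>z. M *\<^sub>R (case z of (s, r) \<Rightarrow> q (s - r) *\<^sub>R v r))"
    by simp
  then have "integrable (lborel \<Otimes>\<^sub>M lborel) (\<lambda>(s, r). p (t - s) *\<^sub>R (q (s - r) *\<^sub>R v r))"
  proof (rule Bochner_Integration.integrable_bound)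
    show "AE z in lborel \<Otimes>\<^sub>M lborel. norm (case z of (s, r) \<Rightarrow> p (t - s) *\<^sub>R (q (s - r) *\<^sub>R v r))
        \<le> norm (M *\<^sub>R (case z of (s, r) \<Rightarrow> q (s - r) *\<^sub>R v r))"
      using order_trans[OF bound abs_ge_self]
      by (auto intro!: AE_I2 mult_right_mono simp: abs_mult simp flip: mult.assoc)
  qed measurable
  then show "integrable lborel (\<lambda>(s, r). p (t - s) *\<^sub>R (q (s - r) *\<^sub>R v r))"
    by (simp add: lborel_prod)
qed

section \<open>Square integrable functions and the dissipation inequality\<close>

lemma L2_suppD:
  assumes "L2_supp T v"
  shows "v \<in> borel_measurable borel" "integrable lborel (\<lambda>t. (norm (v t))\<^sup>2)"
    "t \<notin> {0<..<T} \<Longrightarrow> v t = 0"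
  using assms unfolding L2_supp_def by auto

lemma L2_supp_imp_L1_supp:
  assumes v: "L2_supp T v"
  shows "L1_supp T v"
proof -
  have [measurable]: "v \<in> borel_measurable borel" using L2_suppD(1)[OF v] .
  have "integrable lborel (\<lambda>t. (unit_step T t + (norm (v t))\<^sup>2) / 2)"
    using L2_suppD(2)[OF v] L1_suppD(1)[OF L1_supp_unit_step] by auto
  then have "integrable lborel v"
  proof (rule Bochner_Integration.integrable_bound)
    have "norm (v t) \<le> norm ((unit_step T t + (norm (v t))\<^sup>2) / 2)" for t
      using sum_squares_bound[of 1 "norm (v t)"] L2_suppD(3)[OF v, of t]
      by (cases "t \<in> {0<..<T}") (auto simp: power2_eq_square)
    then show "AE t in lborel. norm (v t) \<le> norm ((unit_step T t + (norm (v t))\<^sup>2) / 2)" by simp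
  qed simp
  then show ?thesis using L2_suppD(3)[OF v] unfolding L1_supp_def by auto
qed

lemma L2_supp_bounded:
  fixes v :: "real \<Rightarrow> 'b::euclidean_space"
  assumes v: "L1_supp T v" and bound: "\<And>t. norm (v t) \<le> M"
  shows "L2_supp T v"
proof -
  have [measurable]: "v \<in> borel_measurable borel" using L1_suppD(2)[OF v] .
  have "integrable lborel (\<lambda>t. M * norm (v t))"
    using L1_suppD(1)[OF v] by auto
  then have "integrable lborel (\<lambda>t. (norm (v t))\<^sup>2)"
  proof (rule Bochner_Integration.integrable_bound)
    show "AE t in lborel. norm ((norm (v t))\<^sup>2) \<le> norm (M * norm (v t))"
      using order_trans[OF bound abs_ge_self]
      by (auto simp: power2_eq_square abs_mult intro!: mult_right_mono)
  qed measurable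
  then show ?thesis using L1_suppD(2,3)[OF v] unfolding L2_supp_def by auto
qed

lemma L2_supp_scaleR: "L2_supp T v \<Longrightarrow> L2_supp T (\<lambda>t. c *\<^sub>R v t)"
  unfolding L2_supp_def by (auto simp: power_mult_distrib)

lemma L2_supp_add:
  fixes v :: "real \<Rightarrow> 'b::euclidean_space"
  assumes v: "L2_supp T v" and w: "L2_supp T w"
  shows "L2_supp T (\<lambda>t. v t + w t)"
proof -
  have [measurable]: "v \<in> borel_measurable borel" "w \<in> borel_measurable borel"
    using L2_suppD(1)[OF v] L2_suppD(1)[OF w] .
  have "integrable lborel (\<lambda>t. 2 * (norm (v t))\<^sup>2 + 2 * (norm (w t))\<^sup>2)"
    using L2_suppD(2)[OF v] L2_suppD(2)[OF w] by auto
  then have "integrable lborel (\<lambda>t. (norm (v t + w t))\<^sup>2)"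
  proof (rule Bochner_Integration.integrable_bound)
    have "(norm (v t + w t))\<^sup>2 \<le> 2 * (norm (v t))\<^sup>2 + 2 * (norm (w t))\<^sup>2" for t
    proof -
      have "(norm (v t + w t))\<^sup>2 + (norm (v t - w t))\<^sup>2 = 2 * (norm (v t))\<^sup>2 + 2 * (norm (w t))\<^sup>2"
        by (simp add: power2_norm_eq_inner algebra_simps inner_commute)
      then show ?thesis using zero_le_power2[of "norm (v t - w t)"] by linarith
    qed
    then show "AE t in lborel. norm ((norm (v t + w t))\<^sup>2) \<le> norm (2 * (norm (v t))\<^sup>2 + 2 * (norm (w t))\<^sup>2)"
      by auto
  qed measurable
  then show ?thesis using L2_suppD(3)[OF v] L2_suppD(3)[OF w] unfolding L2_supp_def by auto
qed

lemma L2_supp_diff: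
  assumes v: "L2_supp T v" and w: "L2_supp T w"
  shows "L2_supp T (\<lambda>t. v t - w t)"
  using L2_supp_add[OF v L2_supp_scaleR[OF w, of "-1"]] by simp

text \<open>  Young's convolution inequality in \<open>L\<^sub>2\<close>, first pointwise: this is the Cauchy-Schwarz inequality for
  the measure \<open>\<bar>p (t - s)\<bar> ds\<close>. The summand \<open>1\<close> keeps the constant positive when \<open>p = 0\<close>.\<close>

lemma tconv_square_le:
  fixes v :: "real \<Rightarrow> 'b::euclidean_space"
  assumes p: "integrable lborel p" and v: "L2_supp T v"
  shows "AE t in lborel. (norm (tconv T p v t))\<^sup>2 \<le>
    ((LINT s|lborel. \<bar>p s\<bar>) + 1) * (LINT s|lborel. \<bar>p (t - s)\<bar> * (norm (v s))\<^sup>2)"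
proof -
  define M where "M = (LINT s|lborel. \<bar>p s\<bar>) + 1"
  have M: "M > 0" unfolding M_def by (simp add: add_nonneg_pos)
  have ip: "integrable lborel (\<lambda>s. p (t - s))" for t
    using lborel_integrable_real_affine[OF p, of "-1" t] by simp
  have eq: "(LINT s|lborel. \<bar>p (t - s)\<bar>) = M - 1" for t
    using lborel_integral_real_affine[of "-1" "\<lambda>s. \<bar>p s\<bar>" t] unfolding M_def by simp
  have "AE t in lborel. integrable lborel (\<lambda>s. \<bar>p (t - s)\<bar> *\<^sub>R (norm (v s))\<^sup>2)"
    using AE_integrable_conv[of "\<lambda>t. \<bar>p t\<bar>" "\<lambda>s. (norm (v s))\<^sup>2"] p L2_suppD(2)[OF v] by simp
  moreover have "AE t in lborel. integrable lborel (\<lambda>s. p (t - s) *\<^sub>R v s)"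
    using AE_integrable_conv p L1_suppD(1)[OF L2_supp_imp_L1_supp[OF v]] by blast
  ultimately show ?thesis
  proof eventually_elim
    case (elim t)
    define X where "X = norm (LINT s|lborel. p (t - s) *\<^sub>R v s)"
    define Y where "Y = (LINT s|lborel. \<bar>p (t - s)\<bar> * (norm (v s))\<^sup>2)"
    have Y: "Y \<ge> 0" unfolding Y_def by simp
    have XY: "X\<^sup>2 \<le> M * Y"
    proof (cases "X = 0")
      case False
      then have X: "X > 0" unfolding X_def by simp
      \<comment> \<open>With this weight, Young's inequality \<open>2ab \<le> ca\<^sup>2 + b\<^sup>2/c\<close> becomes Cauchy-Schwarz.\<close>
      define c where "c = X / M"
      have c: "c > 0" using X M unfolding c_def by simp
      have "X \<le> (LINT s|lborel. norm (p (t - s) *\<^sub>R v s))"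
        unfolding X_def by (rule integral_norm_bound)
      also have "\<dots> \<le> (LINT s|lborel. (c * \<bar>p (t - s)\<bar> + \<bar>p (t - s)\<bar> * (norm (v s))\<^sup>2 / c) / 2)"
      proof (rule integral_mono)
        fix s
        have "norm (v s) \<le> (c + (norm (v s))\<^sup>2 / c) / 2"
          using sum_squares_bound[of c "norm (v s)"] c by (simp add: field_simps power2_eq_square)
        then have "\<bar>p (t - s)\<bar> * norm (v s) \<le> \<bar>p (t - s)\<bar> * ((c + (norm (v s))\<^sup>2 / c) / 2)"
          by (intro mult_left_mono) auto
        then show "norm (p (t - s) *\<^sub>R v s) \<le> (c * \<bar>p (t - s)\<bar> + \<bar>p (t - s)\<bar> * (norm (v s))\<^sup>2 / c) / 2"
          by (simp add: algebra_simps add_divide_distrib)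
      qed (use elim ip[of t] integrable_norm[OF elim(2)] in auto)
      also have "\<dots> = (c * (M - 1) + Y / c) / 2"
        using elim ip eq unfolding Y_def by simp
      also have "\<dots> \<le> (c * M + Y / c) / 2" using c by simp
      finally have "X \<le> (c * M + Y / c) / 2" .
      then have "X \<le> Y / c" using M unfolding c_def by (simp add: field_simps)
      then show ?thesis using X M unfolding c_def by (simp add: field_simps power2_eq_square)
    qed (use M Y in auto)
    show ?case
    proof (cases "t \<in> {0<..<T}")
      case True
      then show ?thesis using XY unfolding X_def Y_def M_def by (simp add: tconv_def)
    qed (use M Y in \<open>auto simp: tconv_def M_def Y_def\<close>)
  qed
qed

lemma tconv_L2:
  fixes v :: "real \<Rightarrow> 'b::euclidean_space"
  assumes p: "integrable lborel p" and v: "L2_supp T v"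
  shows "L2_supp T (tconv T p v)"
    and "(LINT t|lborel. (norm (tconv T p v t))\<^sup>2) \<le>
      ((LINT s|lborel. \<bar>p s\<bar>) + 1) * (LINT s|lborel. \<bar>p s\<bar>) * (LINT s|lborel. (norm (v s))\<^sup>2)"
proof -
  define M where "M = (LINT s|lborel. \<bar>p s\<bar>) + 1"
  have M: "M > 0" unfolding M_def by (simp add: add_nonneg_pos)
  have v1: "L1_supp T v" using L2_supp_imp_L1_supp[OF v] .
  note c1 = L1_supp_tconv[OF p L1_suppD(1)[OF v1], of T]
  have [measurable]: "tconv T p v \<in> borel_measurable borel" using L1_suppD(2)[OF c1] .
  let ?g = "\<lambda>t. LINT s|lborel. \<bar>p (t - s)\<bar> * (norm (v s))\<^sup>2"
  have i: "integrable (lborel \<Otimes>\<^sub>M lborel) (\<lambda>(t, s). \<bar>p (t - s)\<bar> *\<^sub>R (norm (v s))\<^sup>2)"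
    using integrable_kernel_pair(1)[of "\<lambda>t. \<bar>p t\<bar>" "\<lambda>s. (norm (v s))\<^sup>2" "\<lambda>s. s"] p L2_suppD(2)[OF v] by simp
  have g: "integrable lborel ?g"
    using lborel_pair.integrable_fst[OF i] by simp
  have "(LINT t|lborel. ?g t) = (LINT s|lborel. LINT t|lborel. \<bar>p (t - s)\<bar> * (norm (v s))\<^sup>2)"
    using lborel_pair.Fubini_integral[OF i] by simp
  also have "\<dots> = (M - 1) * (LINT s|lborel. (norm (v s))\<^sup>2)"
    using integrable_kernel_pair(2)[of "\<lambda>t. \<bar>p t\<bar>" "\<lambda>s. (norm (v s))\<^sup>2" "\<lambda>s. s"] p L2_suppD(2)[OF v]
    unfolding M_def by simp
  finally have gi: "(LINT t|lborel. ?g t) = (M - 1) * (LINT s|lborel. (norm (v s))\<^sup>2)" .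
  have ae: "AE t in lborel. (norm (tconv T p v t))\<^sup>2 \<le> M * ?g t"
    using tconv_square_le[OF p v] unfolding M_def .
  have "integrable lborel (\<lambda>t. M * ?g t)" using g by simp
  then have int: "integrable lborel (\<lambda>t. (norm (tconv T p v t))\<^sup>2)"
  proof (rule Bochner_Integration.integrable_bound)
    show "AE t in lborel. norm ((norm (tconv T p v t))\<^sup>2) \<le> norm (M * ?g t)"
      using ae by eventually_elim auto
  qed measurable
  show "L2_supp T (tconv T p v)"
    using int L1_suppD(3)[OF c1] unfolding L2_supp_def by simp
  have "(LINT t|lborel. (norm (tconv T p v t))\<^sup>2) \<le> (LINT t|lborel. M * ?g t)"
    using int g ae by (intro integral_mono_AE) auto
  also have "\<dots> = M * (M - 1) * (LINT s|lborel. (norm (v s))\<^sup>2)" using gi by simp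
  finally show "(LINT t|lborel. (norm (tconv T p v t))\<^sup>2) \<le>
      ((LINT s|lborel. \<bar>p s\<bar>) + 1) * (LINT s|lborel. \<bar>p s\<bar>) * (LINT s|lborel. (norm (v s))\<^sup>2)"
    unfolding M_def by simp
qed

lemma integrable_kernel_weight:
  fixes g :: "real \<Rightarrow> real"
  assumes p: "integrable lborel p" and g: "integrable lborel g"
  shows "integrable (lborel \<Otimes>\<^sub>M lborel) (\<lambda>(t, s). p (t - s) * g s)"
    and "integrable (lborel \<Otimes>\<^sub>M lborel) (\<lambda>(t, s). p (t - s) * g t)"
proof -
  show "integrable (lborel \<Otimes>\<^sub>M lborel) (\<lambda>(t, s). p (t - s) * g s)"
    using integrable_kernel_pair(1)[OF p g, of "\<lambda>s. s"] by simp
  have "integrable lborel (\<lambda>t. p (- t))"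
    using lborel_integrable_real_affine[OF p, of "-1" 0] by simp
  from integrable_kernel_pair(1)[OF this g, of "\<lambda>s. s"]
  have "integrable (lborel \<Otimes>\<^sub>M lborel) (\<lambda>(s, t). p (t - s) * g t)" by simp
  from lborel_pair.integrable_product_swap[OF this]
  show "integrable (lborel \<Otimes>\<^sub>M lborel) (\<lambda>(t, s). p (t - s) * g t)" by simp
qed

lemma inner_le_half_squares: "\<bar>x \<bullet> y\<bar> \<le> ((norm x)\<^sup>2 + (norm (y :: 'b::real_inner))\<^sup>2) / 2"
  using Cauchy_Schwarz_ineq2[of x y] sum_squares_bound[of "norm x" "norm y"] by simp

text \<open>  The bilinear form \<open>(\<phi>, v) \<mapsto> \<integral> \<phi> \<bullet> (p * v)\<close> is a double integral with the absolutely integrable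
  majorant \<open>\<bar>p (t - s)\<bar> (\<bar>\<phi> t\<bar>\<^sup>2 + \<bar>v s\<bar>\<^sup>2) / 2\<close>.\<close>

lemma tconv_pairing:
  fixes \<phi> v :: "real \<Rightarrow> 'b::euclidean_space"
  assumes p: "integrable lborel p" and \<phi>: "L2_supp T \<phi>" and v: "L2_supp T v"
  shows "integrable (lborel \<Otimes>\<^sub>M lborel) (\<lambda>(t, s). p (t - s) * (\<phi> t \<bullet> v s))"
    and "integrable lborel (\<lambda>t. \<phi> t \<bullet> tconv T p v t)"
    and "(LINT t|lborel. \<phi> t \<bullet> tconv T p v t) = (LINT t|lborel. LINT s|lborel. p (t - s) * (\<phi> t \<bullet> v s))"
    and "(LINT t|lborel. LINT s|lborel. \<bar>p (t - s) * (\<phi> t \<bullet> v s)\<bar>) \<le> (LINT s|lborel. \<bar>p s\<bar>) *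
      ((LINT s|lborel. (norm (\<phi> s))\<^sup>2) + (LINT s|lborel. (norm (v s))\<^sup>2)) / 2"
    and "\<bar>LINT t|lborel. \<phi> t \<bullet> tconv T p v t\<bar> \<le> (LINT s|lborel. \<bar>p s\<bar>) *
      ((LINT s|lborel. (norm (\<phi> s))\<^sup>2) + (LINT s|lborel. (norm (v s))\<^sup>2)) / 2"
proof -
  have [measurable]: "p \<in> borel_measurable borel" "\<phi> \<in> borel_measurable borel" "v \<in> borel_measurable borel"
    using p L2_suppD(1)[OF \<phi>] L2_suppD(1)[OF v] by auto
  have p': "integrable lborel (\<lambda>t. \<bar>p t\<bar>)" using p by simp
  note iv = integrable_kernel_weight(1)[OF p' L2_suppD(2)[OF v]]
  note i\<phi> = integrable_kernel_weight(2)[OF p' L2_suppD(2)[OF \<phi>]]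
  let ?d = "\<lambda>t s. (\<bar>p (t - s)\<bar> * (norm (v s))\<^sup>2 + \<bar>p (t - s)\<bar> * (norm (\<phi> t))\<^sup>2) / 2"
  have d: "integrable (lborel \<Otimes>\<^sub>M lborel) (\<lambda>(t, s). ?d t s)"
    using Bochner_Integration.integrable_add[OF iv i\<phi>] by (simp add: case_prod_unfold)
  have le: "\<bar>p (t - s) * (\<phi> t \<bullet> v s)\<bar> \<le> ?d t s" for t s
    using mult_left_mono[OF inner_le_half_squares[of "\<phi> t" "v s"], of "\<bar>p (t - s)\<bar>"]
    by (simp add: abs_mult algebra_simps add_divide_distrib)
  show i: "integrable (lborel \<Otimes>\<^sub>M lborel) (\<lambda>(t, s). p (t - s) * (\<phi> t \<bullet> v s))"
  proof (rule Bochner_Integration.integrable_bound[OF d])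
    show "AE z in lborel \<Otimes>\<^sub>M lborel. norm (case z of (t, s) \<Rightarrow> p (t - s) * (\<phi> t \<bullet> v s))
        \<le> norm (case z of (t, s) \<Rightarrow> ?d t s)"
      using order_trans[OF le abs_ge_self] by (auto intro!: AE_I2)
  qed measurable
  note v1 = L1_suppD(1)[OF L2_supp_imp_L1_supp[OF v]]
  have ae: "AE t in lborel. \<phi> t \<bullet> tconv T p v t = (LINT s|lborel. p (t - s) * (\<phi> t \<bullet> v s))"
    using AE_integrable_conv[OF p v1]
  proof eventually_elim
    case (elim t)
    have "\<phi> t \<bullet> tconv T p v t = \<phi> t \<bullet> (LINT s|lborel. p (t - s) *\<^sub>R v s)"
      using L2_suppD(3)[OF \<phi>, of t] unfolding tconv_def by (cases "t \<in> {0<..<T}") auto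
    also have "\<dots> = (LINT s|lborel. \<phi> t \<bullet> (p (t - s) *\<^sub>R v s))"
      using elim by (simp del: inner_scaleR_right)
    finally show ?case by simp
  qed
  have [measurable]: "tconv T p v \<in> borel_measurable borel"
    using L1_suppD(2)[OF L1_supp_tconv[OF p v1]] .
  show "integrable lborel (\<lambda>t. \<phi> t \<bullet> tconv T p v t)"
    by (rule integrable_cong_AE_imp[OF lborel_pair.integrable_fst[OF i]])
      (use ae in \<open>auto elim: AE_mp\<close>)
  show eq: "(LINT t|lborel. \<phi> t \<bullet> tconv T p v t) = (LINT t|lborel. LINT s|lborel. p (t - s) * (\<phi> t \<bullet> v s))"
    by (rule integral_cong_AE) (use ae in auto)
  have i': "integrable (lborel \<Otimes>\<^sub>M lborel) (\<lambda>(t, s). \<bar>p (t - s) * (\<phi> t \<bullet> v s)\<bar>)"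
    using integrable_norm[OF i] by (simp add: case_prod_unfold)
  have 1: "(LINT z|(lborel \<Otimes>\<^sub>M lborel). (case z of (t, s) \<Rightarrow> \<bar>p (t - s)\<bar> * (norm (v s))\<^sup>2)) =
      (LINT s|lborel. \<bar>p s\<bar>) * (LINT s|lborel. (norm (v s))\<^sup>2)"
    using lborel_pair.integral_snd[OF iv]
      integrable_kernel_pair(2)[OF p L2_suppD(2)[OF v], of "\<lambda>s. s"] by simp
  have sh: "(LINT s|lborel. \<bar>p (t - s)\<bar>) = (LINT s|lborel. \<bar>p s\<bar>)" for t
    using lborel_integral_real_affine[of "-1" "\<lambda>s. \<bar>p s\<bar>" t] by simp
  have 2: "(LINT z|(lborel \<Otimes>\<^sub>M lborel). (case z of (t, s) \<Rightarrow> \<bar>p (t - s)\<bar> * (norm (\<phi> t))\<^sup>2)) =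
      (LINT s|lborel. \<bar>p s\<bar>) * (LINT s|lborel. (norm (\<phi> s))\<^sup>2)"
    using lborel_pair.integral_fst[OF i\<phi>] by (simp add: sh)
  have "(LINT t|lborel. LINT s|lborel. \<bar>p (t - s) * (\<phi> t \<bullet> v s)\<bar>) =
      (LINT z|(lborel \<Otimes>\<^sub>M lborel). (case z of (t, s) \<Rightarrow> \<bar>p (t - s) * (\<phi> t \<bullet> v s)\<bar>))"
    by (rule lborel_pair.integral_fst[OF i'])
  also have "\<dots> \<le> (LINT z|(lborel \<Otimes>\<^sub>M lborel). (case z of (t, s) \<Rightarrow> ?d t s))"
    using le by (intro integral_mono i' d) auto
  also have "\<dots> = ((LINT z|(lborel \<Otimes>\<^sub>M lborel). (case z of (t, s) \<Rightarrow> \<bar>p (t - s)\<bar> * (norm (v s))\<^sup>2)) +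
      (LINT z|(lborel \<Otimes>\<^sub>M lborel). (case z of (t, s) \<Rightarrow> \<bar>p (t - s)\<bar> * (norm (\<phi> t))\<^sup>2))) / 2"
    using Bochner_Integration.integral_add[OF iv i\<phi>] by (simp add: case_prod_unfold)
  also have "\<dots> = (LINT s|lborel. \<bar>p s\<bar>) *
      ((LINT s|lborel. (norm (\<phi> s))\<^sup>2) + (LINT s|lborel. (norm (v s))\<^sup>2)) / 2"
    unfolding 1 2 by (simp add: algebra_simps)
  finally show b: "(LINT t|lborel. LINT s|lborel. \<bar>p (t - s) * (\<phi> t \<bullet> v s)\<bar>) \<le> (LINT s|lborel. \<bar>p s\<bar>) *
      ((LINT s|lborel. (norm (\<phi> s))\<^sup>2) + (LINT s|lborel. (norm (v s))\<^sup>2)) / 2" .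
  have "\<bar>LINT t|lborel. \<phi> t \<bullet> tconv T p v t\<bar> \<le> (LINT t|lborel. \<bar>LINT s|lborel. p (t - s) * (\<phi> t \<bullet> v s)\<bar>)"
    unfolding eq by (rule integral_abs_bound)
  also have "\<dots> \<le> (LINT t|lborel. LINT s|lborel. \<bar>p (t - s) * (\<phi> t \<bullet> v s)\<bar>)"
    using lborel_pair.integrable_fst[OF i'] lborel_pair.integrable_fst[OF i]
    by (intro integral_mono) auto
  also note b
  finally show "\<bar>LINT t|lborel. \<phi> t \<bullet> tconv T p v t\<bar> \<le> (LINT s|lborel. \<bar>p s\<bar>) *
      ((LINT s|lborel. (norm (\<phi> s))\<^sup>2) + (LINT s|lborel. (norm (v s))\<^sup>2)) / 2" .
qed

lemma tconv_bound:
  fixes v :: "real \<Rightarrow> 'b::euclidean_space"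
  assumes v: "integrable lborel v" and p [measurable]: "p \<in> borel_measurable borel"
    and bound: "\<And>t. \<bar>p t\<bar> \<le> C"
  shows "norm (tconv T p v t) \<le> C * (LINT s|lborel. norm (v s))"
proof -
  have [measurable]: "v \<in> borel_measurable borel" using v by auto
  have C: "C \<ge> 0" using bound[of 0] by linarith
  have "norm (LINT s|lborel. p (t - s) *\<^sub>R v s) \<le> (LINT s|lborel. norm (p (t - s) *\<^sub>R v s))"
    by (rule integral_norm_bound)
  also have "\<dots> \<le> (LINT s|lborel. C * norm (v s))"
    using v C bound by (intro integral_mono') (auto intro!: mult_right_mono)
  finally have *: "norm (LINT s|lborel. p (t - s) *\<^sub>R v s) \<le> C * (LINT s|lborel. norm (v s))" by simp
  then show ?thesis using C by (cases "t \<in> {0<..<T}") (auto simp: tconv_def)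
qed

lemma tconv_unit_step_bound:
  fixes v :: "real \<Rightarrow> 'b::euclidean_space"
  assumes "integrable lborel v"
  shows "norm (tconv T (unit_step T) v t) \<le> (LINT s|lborel. norm (v s))"
  using tconv_bound[OF assms, of "unit_step T" 1 T t] by simp

text \<open>  Estimate \<open>v t \<bullet> v s \<le> (\<bar>v t\<bar>\<^sup>2 + \<bar>v s\<bar>\<^sup>2) / 2\<close> under the double integral over \<open>0 < s < t < T\<close>. Integrating
  \<open>b (t - s)\<close> over \<open>s\<close> gives the primitive of \<open>b\<close> at \<open>t\<close>, integrating it over \<open>t\<close> gives the
  primitive at \<open>T - s\<close>.\<close>

lemma quadratic_form_le:
  fixes v :: "real \<Rightarrow> 'b::euclidean_space"
  assumes b: "L1_supp T b" and pos: "\<And>t. 0 \<le> b t" and v: "L2_supp T v"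
  shows "(LINT t|lborel. v t \<bullet> tconv T b v t) \<le>
    (LINT t|lborel. (tconv T (unit_step T) b t + tconv T (unit_step T) b (T - t)) * (norm (v t))\<^sup>2) / 2"
proof -
  have [measurable]: "b \<in> borel_measurable borel" "v \<in> borel_measurable borel"
    using L1_suppD(2)[OF b] L2_suppD(1)[OF v] by auto
  define B where "B = tconv T (unit_step T) b"
  have [measurable]: "B \<in> borel_measurable borel"
    using L1_suppD(2)[OF L1_supp_tconv[OF L1_suppD(1)[OF L1_supp_unit_step] L1_suppD(1)[OF b]]]
    unfolding B_def .
  have Bb: "\<bar>B t\<bar> \<le> (LINT s|lborel. \<bar>b s\<bar>)" for t
    using tconv_unit_step_bound[OF L1_suppD(1)[OF b], of T t] unfolding B_def by simp
  note i1 = integrable_kernel_weight(2)[OF L1_suppD(1)[OF b] L2_suppD(2)[OF v]]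
  note i2 = integrable_kernel_weight(1)[OF L1_suppD(1)[OF b] L2_suppD(2)[OF v]]
  let ?f1 = "\<lambda>t s. unit_step T s * (b (t - s) * (norm (v t))\<^sup>2)"
  let ?f2 = "\<lambda>t s. unit_step T t * (b (t - s) * (norm (v s))\<^sup>2)"
  have j1: "integrable (lborel \<Otimes>\<^sub>M lborel) (\<lambda>(t, s). ?f1 t s)"
    by (rule Bochner_Integration.integrable_bound[OF i1]) (auto intro!: AE_I2 split: split_indicator)
  have j2: "integrable (lborel \<Otimes>\<^sub>M lborel) (\<lambda>(t, s). ?f2 t s)"
    by (rule Bochner_Integration.integrable_bound[OF i2]) (auto intro!: AE_I2 split: split_indicator)
  note j = tconv_pairing[OF L1_suppD(1)[OF b] v v]
  have vB: "(LINT s|lborel. ?f1 t s) = B t * (norm (v t))\<^sup>2" for t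
  proof (cases "t \<in> {0<..<T}")
    case True
    have "(LINT s|lborel. ?f1 t s) = (LINT s|lborel. b (t - s) * unit_step T s) * (norm (v t))\<^sup>2"
      by (simp add: mult_ac flip: integral_mult_right_zero)
    also have "(LINT s|lborel. b (t - s) * unit_step T s) = tconv T b (unit_step T) t"
      using True by (simp add: tconv_def)
    finally show ?thesis unfolding B_def by (simp add: tconv_commute[of T b])
  qed (simp add: L2_suppD(3)[OF v])
  have vB': "(LINT t|lborel. ?f2 t s) = B (T - s) * (norm (v s))\<^sup>2" for s
  proof (cases "s \<in> {0<..<T}")
    case True
    have "(LINT t|lborel. ?f2 t s) = (LINT t|lborel. unit_step T t * b (t - s)) * (norm (v s))\<^sup>2"
      by (simp add: mult_ac flip: integral_mult_right_zero)
    also have "(LINT t|lborel. unit_step T t * b (t - s)) = (LINT r|lborel. unit_step T (s + r) * b r)"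
      using lborel_integral_real_affine[of 1 "\<lambda>t. unit_step T t * b (t - s)" s] by simp
    also have "\<dots> = (LINT r|lborel. unit_step T (T - s - r) * b r)"
      by (intro Bochner_Integration.integral_cong) (auto split: split_indicator)
    also have "\<dots> = B (T - s)"
      using True by (simp add: tconv_def B_def)
    finally show ?thesis .
  qed (simp add: L2_suppD(3)[OF v])
  have int1: "integrable lborel (\<lambda>t. B t * (norm (v t))\<^sup>2)"
    using lborel_pair.integrable_fst[OF j1] unfolding vB .
  have int2: "integrable lborel (\<lambda>t. B (T - t) * (norm (v t))\<^sup>2)"
    using lborel_pair.integrable_snd[OF j2] unfolding vB' .
  have sum: "(LINT z|(lborel \<Otimes>\<^sub>M lborel). (case z of (t, s) \<Rightarrow> ?f1 t s)) +
      (LINT z|(lborel \<Otimes>\<^sub>M lborel). (case z of (t, s) \<Rightarrow> ?f2 t s)) =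
      (LINT t|lborel. (B t + B (T - t)) * (norm (v t))\<^sup>2)"
    using lborel_pair.integral_fst[OF j1] lborel_pair.integral_snd[OF j2] int1 int2
    unfolding vB vB' by (simp add: distrib_right)
  have "(LINT t|lborel. v t \<bullet> tconv T b v t) =
      (LINT z|(lborel \<Otimes>\<^sub>M lborel). (case z of (t, s) \<Rightarrow> b (t - s) * (v t \<bullet> v s)))"
    unfolding j(3) by (rule lborel_pair.integral_fst[OF j(1)])
  also have "\<dots> \<le> (LINT z|(lborel \<Otimes>\<^sub>M lborel). ((case z of (t, s) \<Rightarrow> ?f1 t s) + (case z of (t, s) \<Rightarrow> ?f2 t s)) / 2)"
  proof (rule integral_mono[OF j(1)])
    fix z :: "real \<times> real"
    obtain t s where z: "z = (t, s)" by (cases z)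
    have "b (t - s) * (v t \<bullet> v s) \<le> (?f1 t s + ?f2 t s) / 2"
    proof (cases "t \<in> {0<..<T} \<and> s \<in> {0<..<T}")
      case True
      have "v t \<bullet> v s \<le> ((norm (v t))\<^sup>2 + (norm (v s))\<^sup>2) / 2"
        using inner_le_half_squares[of "v t" "v s"] by linarith
      from mult_left_mono[OF this pos[of "t - s"]] True show ?thesis
        by (simp add: algebra_simps add_divide_distrib)
    next
      case False
      then have "v t \<bullet> v s = 0" using L2_suppD(3)[OF v] by auto
      then show ?thesis using pos by auto
    qed
    then show "(case z of (t, s) \<Rightarrow> b (t - s) * (v t \<bullet> v s)) \<le>
        ((case z of (t, s) \<Rightarrow> ?f1 t s) + (case z of (t, s) \<Rightarrow> ?f2 t s)) / 2"
      unfolding z by simp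
  qed (use j1 j2 in auto)
  also have "\<dots> = (LINT t|lborel. (B t + B (T - t)) * (norm (v t))\<^sup>2) / 2"
    using j1 j2 sum by simp
  finally show ?thesis unfolding B_def .
qed

text \<open>  The fundamental inequality for nonincreasing kernels in integrated form. If \<open>a\<close> is the kernel
  \<open>A - \<integral>\<^sub>0\<^sup>t b\<close>, then formally \<open>A v - b * v\<close> is the time derivative of \<open>a * v\<close>, and \<open>b = - a'\<close> is
  nonnegative because \<open>a\<close> is nonincreasing.\<close>

lemma dissipation_inequality:
  fixes v :: "real \<Rightarrow> 'b::euclidean_space"
  assumes b: "L1_supp T b" and pos: "\<And>t. 0 \<le> b t" and v: "L2_supp T v"
    and a: "\<And>t. t \<in> {0<..<T} \<Longrightarrow> a t = A - tconv T (unit_step T) b t"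
  shows "integrable lborel (\<lambda>t. (a t + a (T - t)) * (norm (v t))\<^sup>2)"
    and "(LINT t|lborel. (a t + a (T - t)) * (norm (v t))\<^sup>2) / 2 \<le>
    (LINT t|lborel. v t \<bullet> (A *\<^sub>R v t - tconv T b v t))"
proof -
  have [measurable]: "v \<in> borel_measurable borel" using L2_suppD(1)[OF v] by auto
  define B where "B = tconv T (unit_step T) b"
  have [measurable]: "B \<in> borel_measurable borel"
    using L1_suppD(2)[OF L1_supp_tconv[OF L1_suppD(1)[OF L1_supp_unit_step] L1_suppD(1)[OF b]]]
    unfolding B_def .
  have Bb: "\<bar>B t\<bar> \<le> (LINT s|lborel. \<bar>b s\<bar>)" for t
    using tconv_unit_step_bound[OF L1_suppD(1)[OF b], of T t] unfolding B_def by simp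
  note j = tconv_pairing(2)[OF L1_suppD(1)[OF b] v v]
  have i2: "integrable lborel (\<lambda>t. (2 * (LINT s|lborel. \<bar>b s\<bar>)) * (norm (v t))\<^sup>2)"
    using L2_suppD(2)[OF v] by simp
  have iB: "integrable lborel (\<lambda>t. (B t + B (T - t)) * (norm (v t))\<^sup>2)"
  proof (rule Bochner_Integration.integrable_bound[OF i2])
    have "\<bar>B t + B (T - t)\<bar> \<le> \<bar>2 * (LINT s|lborel. \<bar>b s\<bar>)\<bar>" for t
      using Bb[of t] Bb[of "T - t"] by linarith
    then show "AE t in lborel. norm ((B t + B (T - t)) * (norm (v t))\<^sup>2) \<le>
        norm (2 * (LINT s|lborel. \<bar>b s\<bar>) * (norm (v t))\<^sup>2)"
      unfolding norm_mult by (auto intro!: mult_right_mono simp del: abs_mult)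
  qed measurable
  have eq: "(a t + a (T - t)) * (norm (v t))\<^sup>2 =
      2 * A * (norm (v t))\<^sup>2 - (B t + B (T - t)) * (norm (v t))\<^sup>2" for t
    using a[of t] a[of "T - t"] L2_suppD(3)[OF v, of t] unfolding B_def
    by (cases "t \<in> {0<..<T}") (auto, simp add: field_simps)
  show "integrable lborel (\<lambda>t. (a t + a (T - t)) * (norm (v t))\<^sup>2)"
    unfolding eq using iB L2_suppD(2)[OF v] by simp
  have "(LINT t|lborel. (a t + a (T - t)) * (norm (v t))\<^sup>2) =
      2 * A * (LINT t|lborel. (norm (v t))\<^sup>2) - (LINT t|lborel. (B t + B (T - t)) * (norm (v t))\<^sup>2)"
    unfolding eq using iB L2_suppD(2)[OF v] by simp
  moreover have "(LINT t|lborel. v t \<bullet> (A *\<^sub>R v t - tconv T b v t)) =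
      A * (LINT t|lborel. (norm (v t))\<^sup>2) - (LINT t|lborel. v t \<bullet> tconv T b v t)"
    using j L2_suppD(2)[OF v] by (simp add: inner_diff_right power2_norm_eq_inner)
  ultimately show "(LINT t|lborel. (a t + a (T - t)) * (norm (v t))\<^sup>2) / 2 \<le>
    (LINT t|lborel. v t \<bullet> (A *\<^sub>R v t - tconv T b v t))"
    using quadratic_form_le[OF b pos v] unfolding B_def by simp
qed

section \<open>Nonincreasing kernels and negative parts\<close>

lemma integrable_inner_bounded:
  fixes g :: "'a \<Rightarrow> 'b::euclidean_space"
  assumes g: "integrable M g" and [measurable]: "\<phi> \<in> borel_measurable M"
    and bound: "\<And>t. norm (\<phi> t) \<le> C"
  shows "integrable M (\<lambda>t. \<phi> t \<bullet> g t)"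
    and "\<bar>LINT t|M. \<phi> t \<bullet> g t\<bar> \<le> C * (LINT t|M. norm (g t))"
proof -
  have [measurable]: "g \<in> borel_measurable M" using g by auto
  have le: "\<bar>\<phi> t \<bullet> g t\<bar> \<le> C * norm (g t)" for t
    using Cauchy_Schwarz_ineq2[of "\<phi> t" "g t"] mult_right_mono[OF bound[of t] norm_ge_zero[of "g t"]]
    by linarith
  show i: "integrable M (\<lambda>t. \<phi> t \<bullet> g t)"
  proof (rule Bochner_Integration.integrable_bound)
    show "integrable M (\<lambda>t. C * norm (g t))" using g by auto
    show "AE t in M. norm (\<phi> t \<bullet> g t) \<le> norm (C * norm (g t))"
      using order_trans[OF le abs_ge_self] by auto
  qed measurable
  have "\<bar>LINT t|M. \<phi> t \<bullet> g t\<bar> \<le> (LINT t|M. \<bar>\<phi> t \<bullet> g t\<bar>)" by (rule integral_abs_bound)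
  also have "\<dots> \<le> (LINT t|M. C * norm (g t))"
    using i g le by (intro integral_mono) auto
  finally show "\<bar>LINT t|M. \<phi> t \<bullet> g t\<bar> \<le> C * (LINT t|M. norm (g t))" by simp
qed

lemma tconv_L1_norm_le:
  fixes v :: "real \<Rightarrow> 'b::euclidean_space"
  assumes p: "integrable lborel p" and v: "integrable lborel v"
  shows "(LINT t|lborel. norm (tconv T p v t)) \<le> (LINT t|lborel. \<bar>p t\<bar>) * (LINT t|lborel. norm (v t))"
proof -
  note i = integrable_kernel_pair(1)[OF p v, of "\<lambda>s. s", simplified]
  have i': "integrable (lborel \<Otimes>\<^sub>M lborel) (\<lambda>(t, s). \<bar>p (t - s)\<bar> * norm (v s))"
    using integrable_norm[OF i] by (simp add: case_prod_unfold)
  have "(LINT t|lborel. norm (tconv T p v t)) \<le> (LINT t|lborel. LINT s|lborel. \<bar>p (t - s)\<bar> * norm (v s))"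
  proof (rule integral_mono)
    show "integrable lborel (\<lambda>t. norm (tconv T p v t))"
      using L1_suppD(1)[OF L1_supp_tconv[OF p v]] by simp
    show "integrable lborel (\<lambda>t. LINT s|lborel. \<bar>p (t - s)\<bar> * norm (v s))"
      using lborel_pair.integrable_fst[OF i'] .
    fix t
    have "norm (tconv T p v t) \<le> norm (LINT s|lborel. p (t - s) *\<^sub>R v s)"
      by (auto simp: tconv_def split: split_indicator)
    also have "\<dots> \<le> (LINT s|lborel. norm (p (t - s) *\<^sub>R v s))"
      by (rule integral_norm_bound)
    finally show "norm (tconv T p v t) \<le> (LINT s|lborel. \<bar>p (t - s)\<bar> * norm (v s))" by simp
  qed
  also have "\<dots> = (LINT s|lborel. LINT t|lborel. \<bar>p (t - s)\<bar> * norm (v s))"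
    using lborel_pair.Fubini_integral[OF i'] by simp
  also have "\<dots> = (LINT t|lborel. \<bar>p t\<bar>) * (LINT t|lborel. norm (v t))"
    using integrable_kernel_pair(2)[OF p v, of "\<lambda>s. s"] by simp
  finally show ?thesis .
qed

lemma tconv_shift:
  fixes v :: "real \<Rightarrow> 'b::euclidean_space"
  assumes p: "L1_supp T p" and v: "L1_supp T v" and "0 < d"
  shows "tconv T p (\<lambda>t. unit_step T t *\<^sub>R v (t - d)) t = unit_step T t *\<^sub>R tconv T p v (t - d)"
proof (cases "t \<in> {0<..<T}")
  case True
  have "(LINT s|lborel. p (t - s) *\<^sub>R unit_step T s *\<^sub>R v (s - d)) = (LINT s|lborel. p (t - s) *\<^sub>R v (s - d))"
  proof (intro Bochner_Integration.integral_cong refl)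
    fix s
    show "p (t - s) *\<^sub>R unit_step T s *\<^sub>R v (s - d) = p (t - s) *\<^sub>R v (s - d)"
      using True L1_suppD(3)[OF p, of "t - s"] L1_suppD(3)[OF v, of "s - d"] \<open>0 < d\<close>
      by (cases "s \<le> 0"; cases "s \<ge> T") auto
  qed
  also have "\<dots> = (LINT s|lborel. p (t - d - s) *\<^sub>R v s)"
    using lborel_integral_real_affine[of 1 "\<lambda>s. p (t - s) *\<^sub>R v (s - d)" d]
    by (simp add: algebra_simps)
  also have "\<dots> = tconv T p v (t - d)"
  proof (cases "t - d > 0")
    case True
    then show ?thesis using \<open>t \<in> {0<..<T}\<close> \<open>0 < d\<close> by (simp add: tconv_def)
  next
    case False
    then have "p (t - d - s) *\<^sub>R v s = 0" for s
      using L1_suppD(3)[OF p, of "t - d - s"] L1_suppD(3)[OF v, of s] by (cases "s > 0") auto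
    then have "(LINT s|lborel. p (t - d - s) *\<^sub>R v s) = (LINT s|(lborel :: real measure). 0)"
      by (intro Bochner_Integration.integral_cong refl)
    then show ?thesis using False by (simp add: tconv_def)
  qed
  finally show ?thesis using True by (simp add: tconv_def)
qed (simp add: tconv_def)

lemma tconv_unit_step_eq:
  fixes v :: "real \<Rightarrow> 'b::euclidean_space"
  assumes v: "L1_supp T v" and t: "t \<in> {0<..<T}"
  shows "tconv T (unit_step T) v t = (LINT s|lborel. indicator {0<..<t} s *\<^sub>R v s)"
proof -
  have "unit_step T (t - s) *\<^sub>R v s = indicator {0<..<t} s *\<^sub>R v s" for s
    using t L1_suppD(3)[OF v, of s] by (cases "s > 0") (auto split: split_indicator)
  then have "(LINT s|lborel. unit_step T (t - s) *\<^sub>R v s) = (LINT s|lborel. indicator {0<..<t} s *\<^sub>R v s)"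
    by (intro Bochner_Integration.integral_cong refl)
  then show ?thesis using t by (simp add: tconv_def)
qed

text \<open>  A nonnegative nonincreasing kernel on \<open>(0,T)\<close> remains one on \<open>(0,\<infinity>)\<close> when it is extended by \<open>0\<close>.
  It may be unbounded at \<open>0\<close>.\<close>

locale monotone_kernel =
  fixes T :: real and k :: "real \<Rightarrow> real"
  assumes T_pos: "0 < T" and k_L1: "L1_supp T k" and k_nonneg: "0 \<le> k t"
    and k_antimono: "0 < s \<Longrightarrow> s \<le> t \<Longrightarrow> k t \<le> k s"
begin

lemma k_measurable [measurable]: "k \<in> borel_measurable borel"
  using L1_suppD(2)[OF k_L1] .

lemma countable_discontinuities: "countable {t \<in> {0<..}. \<not> isCont k t}"
proof -
  have "mono_on {0<..} (\<lambda>t. - k t)"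
    by (auto simp: mono_on_def intro!: k_antimono)
  then have "countable {t \<in> {0<..}. \<not> isCont (\<lambda>t. - k t) t}"
    by (intro mono_on_ctble_discont_open) auto
  moreover have "isCont (\<lambda>t. - k t) t \<longleftrightarrow> isCont k t" for t
    using isCont_minus[of t k] isCont_minus[of t "\<lambda>t. - k t"] by auto
  ultimately show ?thesis by simp
qed

lemma k_continuous_AE: "AE t in lborel. t \<in> {0<..} \<longrightarrow> isCont k t"
  by (intro AE_I'[of "{t \<in> {0<..}. \<not> isCont k t}"] countable_imp_null_set_lborel
      countable_discontinuities) auto

lemma k_continuous_reflected_AE: "AE t in lborel. t < T \<longrightarrow> isCont k (T - t)"
proof (intro AE_I'[of "(\<lambda>t. T - t) ` {t \<in> {0<..}. \<not> isCont k t}"] countable_imp_null_set_lborel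
      countable_image countable_discontinuities subsetI)
  fix t assume "t \<in> {t \<in> space lborel. \<not> (t < T \<longrightarrow> isCont k (T - t))}"
  then show "t \<in> (\<lambda>t. T - t) ` {t \<in> {0<..}. \<not> isCont k t}"
    by (intro image_eqI[of _ _ "T - t"]) auto
qed

text \<open>  The averages of \<open>k\<close> over \<open>(t, t + e)\<close> are bounded kernels with the absolutely continuous form that
  the dissipation inequality asks for. They increase to \<open>k\<close> almost everywhere as \<open>e\<close> decreases to
  \<open>0\<close>, since a monotone function has only countably many discontinuities.\<close>

definition steklov :: "real \<Rightarrow> real \<Rightarrow> real" where
  "steklov e t = unit_step T t * ((LINT s|lborel. indicator {t<..<t + e} s * k s) / e)"

lemma integrable_window: "integrable lborel (\<lambda>s. indicator {a<..<b} s * k s)"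
  using integrable_mult_indicator[of "{a<..<b}" lborel k] L1_suppD(1)[OF k_L1] by simp

lemma integral_window_bounds:
  assumes "0 < a" "a < b"
  shows "(b - a) * k b \<le> (LINT s|lborel. indicator {a<..<b} s * k s)"
    and "(LINT s|lborel. indicator {a<..<b} s * k s) \<le> (b - a) * k a"
proof -
  have c: "integrable lborel (\<lambda>s. indicator {a<..<b} s * c)"
    "(LINT s|lborel. indicator {a<..<b} s * c) = (b - a) * c" for c :: real
    using assms by (auto intro!: integrable_real_indicator)
  have "(LINT s|lborel. indicator {a<..<b} s * k b) \<le> (LINT s|lborel. indicator {a<..<b} s * k s)"
    using assms by (intro integral_mono c integrable_window) (auto intro!: k_antimono split: split_indicator)
  then show "(b - a) * k b \<le> (LINT s|lborel. indicator {a<..<b} s * k s)" unfolding c .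
  have "(LINT s|lborel. indicator {a<..<b} s * k s) \<le> (LINT s|lborel. indicator {a<..<b} s * k a)"
    using assms by (intro integral_mono c integrable_window) (auto intro!: k_antimono split: split_indicator)
  then show "(LINT s|lborel. indicator {a<..<b} s * k s) \<le> (b - a) * k a" unfolding c .
qed

lemma steklov_bounds:
  assumes "0 < e" "t \<in> {0<..<T}"
  shows "k (t + e) \<le> steklov e t" "steklov e t \<le> k t"
  using integral_window_bounds[of t "t + e"] assms by (auto simp: steklov_def field_simps)

lemma steklov_nonneg: "0 < e \<Longrightarrow> 0 \<le> steklov e t"
  unfolding steklov_def using k_nonneg by auto

lemma steklov_eq:
  assumes e: "0 < e" and t: "t \<in> {0<..<T}"
  defines "b \<equiv> \<lambda>t. unit_step T t * ((k t - k (t + e)) / e)"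
  shows "steklov e t = (LINT s|lborel. indicator {0<..<e} s * k s) / e - tconv T (unit_step T) b t"
proof -
  have ik: "integrable lborel (\<lambda>s. k (s + e))"
    using lborel_integrable_real_affine[OF L1_suppD(1)[OF k_L1], of 1 e] by (simp add: add.commute)
  have ib: "integrable lborel (\<lambda>s. (k s - k (s + e)) / e)"
    using ik L1_suppD(1)[OF k_L1] by simp
  have b: "L1_supp T b"
    using L1_supp_truncate[OF ib, of T] unfolding b_def by simp
  have "tconv T (unit_step T) b t = (LINT s|lborel. indicator {0<..<t} s * ((k s - k (s + e)) / e))"
    unfolding tconv_unit_step_eq[OF b t] using t
    by (intro Bochner_Integration.integral_cong refl) (auto simp: b_def split: split_indicator)
  also have "\<dots> = (LINT s|lborel. (indicator {0<..<t} s * k s - indicator {0<..<t} s * k (s + e)) / e)"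
    by (simp add: algebra_simps diff_divide_distrib)
  also have "\<dots> = ((LINT s|lborel. indicator {0<..<t} s * k s) - (LINT s|lborel. indicator {0<..<t} s * k (s + e))) / e"
    using integrable_window integrable_mult_indicator[OF _ ik, of "{0<..<t}"] by simp
  also have "(LINT s|lborel. indicator {0<..<t} s * k (s + e)) = (LINT s|lborel. indicator {0<..<t} (s - e) * k s)"
    using lborel_integral_real_affine[of 1 "\<lambda>s. indicator {0<..<t} (s - e) * k s" e] by (simp add: add.commute)
  also have "\<dots> = (LINT s|lborel. indicator {e<..<t + e} s * k s)"
    by (intro Bochner_Integration.integral_cong refl) (auto split: split_indicator)
  finally have B: "tconv T (unit_step T) b t =
    ((LINT s|lborel. indicator {0<..<t} s * k s) - (LINT s|lborel. indicator {e<..<t + e} s * k s)) / e" .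
  \<comment> \<open>The windows telescope, whether or not \<open>e < t\<close>; only the two points \<open>t\<close> and \<open>e\<close> differ.\<close>
  have "(LINT s|lborel. indicator {t<..<t + e} s * k s) = (LINT s|lborel. indicator {0<..<e} s * k s -
    (indicator {0<..<t} s * k s - indicator {e<..<t + e} s * k s))"
  proof (rule integral_cong_AE)
    have "AE s in lborel. s \<noteq> t \<and> s \<noteq> e" using AE_lborel_singleton[of t] AE_lborel_singleton[of e] by auto
    then show "AE s in lborel. indicator {t<..<t + e} s * k s = indicator {0<..<e} s * k s -
        (indicator {0<..<t} s * k s - indicator {e<..<t + e} s * k s)"
      by eventually_elim (use e t in \<open>auto split: split_indicator\<close>)
  qed measurable
  also have "\<dots> = (LINT s|lborel. indicator {0<..<e} s * k s) -
    ((LINT s|lborel. indicator {0<..<t} s * k s) - (LINT s|lborel. indicator {e<..<t + e} s * k s))"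
    using integrable_window by simp
  finally show ?thesis unfolding steklov_def B using e t by (simp add: field_simps)
qed

lemma steklov_measurable [measurable]: "steklov e \<in> borel_measurable borel"
proof -
  have eq: "steklov e t = unit_step T t * ((LINT s|lborel. indicator {0<..<e} (s - t) * k s) / e)" for t
    unfolding steklov_def by (auto intro!: Bochner_Integration.integral_cong split: split_indicator)
  show ?thesis unfolding eq[abs_def] by measurable
qed

lemma steklov_L1: "0 < e \<Longrightarrow> L1_supp T (steklov e)"
proof -
  assume e: "0 < e"
  have "integrable lborel (steklov e)"
  proof (rule Bochner_Integration.integrable_bound[OF L1_suppD(1)[OF k_L1]])
    show "AE t in lborel. norm (steklov e t) \<le> norm (k t)"
    proof (rule AE_I2)
      fix t
      show "norm (steklov e t) \<le> norm (k t)"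
        using steklov_bounds[OF e, of t] steklov_nonneg[OF e, of t]
        by (cases "t \<in> {0<..<T}") (auto simp: steklov_def[of e t])
    qed
  qed measurable
  then show ?thesis unfolding L1_supp_def steklov_def by auto
qed

lemma steklov_tendsto: "(\<lambda>j. LINT t|lborel. \<bar>k t - steklov (1 / Suc j) t\<bar>) \<longlonglongrightarrow> 0"
proof -
  have "(\<lambda>j. LINT t|lborel. \<bar>k t - steklov (1 / Suc j) t\<bar>) \<longlonglongrightarrow> (LINT t|(lborel::real measure). 0)"
  proof (rule integral_dominated_convergence)
    show "integrable lborel k" using L1_suppD(1)[OF k_L1] .
    show "AE t in lborel. (\<lambda>j. \<bar>k t - steklov (1 / Suc j) t\<bar>) \<longlonglongrightarrow> 0"
      using k_continuous_AE
    proof eventually_elim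
      case (elim t)
      show ?case
      proof (cases "t \<in> {0<..<T}")
        case True
        then have cont: "isCont k t" using elim by auto
        have "(\<lambda>j. t + 1 / real (Suc j)) \<longlonglongrightarrow> t + 0"
          by (intro tendsto_add tendsto_const lim_const_over_n[THEN LIMSEQ_Suc])
        from isCont_tendsto_compose[OF cont, OF this[simplified]]
        have "(\<lambda>j. k (t + 1 / real (Suc j))) \<longlonglongrightarrow> k t" by simp
        then have "(\<lambda>j. steklov (1 / Suc j) t) \<longlonglongrightarrow> k t"
          by (rule tendsto_sandwich[rotated 2, OF _ tendsto_const])
            (use steklov_bounds[OF _ True] in auto)
        from tendsto_diff[OF tendsto_const[of "k t"] this] show ?thesis
          by (simp add: tendsto_rabs_zero_iff)
      qed (use L1_suppD(3)[OF k_L1] in \<open>simp add: steklov_def\<close>)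
    qed
    show "AE t in lborel. norm \<bar>k t - steklov (1 / Suc j) t\<bar> \<le> k t" for j
    proof (rule AE_I2)
      fix t
      show "norm \<bar>k t - steklov (1 / Suc j) t\<bar> \<le> k t"
        using steklov_bounds[of "1 / Suc j" t] steklov_nonneg[of "1 / Suc j" t] k_nonneg[of t]
        by (cases "t \<in> {0<..<T}") (auto simp: steklov_def[of _ t])
    qed
  qed measurable
  then show ?thesis by simp
qed

text \<open>  Let \<open>v\<close> be the negative part \<open>min W 0\<close> of the primitive \<open>W\<close> of \<open>w\<close>. With
  \<open>a = steklov e = A - \<integral>\<^sub>0\<^sup>t b\<close> one has \<open>a * w = A W - b * W\<close>. Multiplied by \<open>v \<le> 0\<close>, this only decreases
  when \<open>W\<close> is replaced by \<open>v\<close>, because \<open>W v = v\<^sup>2\<close> and \<open>b * W \<ge> b * v\<close>. What remains is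
  nonnegative by the dissipation inequality.\<close>

lemma negative_part_energy_steklov:
  fixes w :: "real \<Rightarrow> real"
  assumes w: "L1_supp T w" and e: "0 < e"
  defines "W \<equiv> tconv T (unit_step T) w"
  shows "0 \<le> (LINT t|lborel. tconv T (steklov e) w t * min (W t) 0)"
proof -
  define b where "b t = unit_step T t * ((k t - k (t + e)) / e)" for t
  define A where "A = (LINT s|lborel. indicator {0<..<e} s * k s) / e"
  define v where "v t = min (W t) 0" for t
  have ik: "integrable lborel (\<lambda>s. k (s + e))"
    using lborel_integrable_real_affine[OF L1_suppD(1)[OF k_L1], of 1 e] by (simp add: add.commute)
  have ib: "integrable lborel (\<lambda>s. (k s - k (s + e)) / e)"
    using ik L1_suppD(1)[OF k_L1] by simp
  have b: "L1_supp T b"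
    using L1_supp_truncate[OF ib, of T] unfolding b_def[abs_def] by simp
  have b_pos: "0 \<le> b t" for t
    using e k_antimono[of t "t + e"] by (auto simp: b_def split: split_indicator)
  have W: "L1_supp T W"
    unfolding W_def by (intro L1_supp_tconv L1_suppD(1)[OF w] L1_suppD(1)[OF L1_supp_unit_step])
  have [measurable]: "W \<in> borel_measurable borel" using L1_suppD(2)[OF W] .
  have Wb: "\<bar>W t\<bar> \<le> (LINT s|lborel. \<bar>w s\<bar>)" for t
    using tconv_unit_step_bound[OF L1_suppD(1)[OF w], of T t] unfolding W_def by simp
  have vW: "\<bar>v t\<bar> \<le> \<bar>W t\<bar>" for t unfolding v_def by auto
  have v1: "L1_supp T v"
  proof -
    have "integrable lborel v"
      by (rule Bochner_Integration.integrable_bound[OF L1_suppD(1)[OF W]])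
        (use vW in \<open>auto simp: v_def[abs_def]\<close>)
    then show ?thesis using L1_suppD(3)[OF W] unfolding L1_supp_def v_def by auto
  qed
  have [measurable]: "v \<in> borel_measurable borel" using L1_suppD(2)[OF v1] .
  have vb: "norm (v t) \<le> (LINT s|lborel. \<bar>w s\<bar>)" for t
    using order_trans[OF vW Wb] by simp
  have v2: "L2_supp T v" by (rule L2_supp_bounded[OF v1 vb])
  have st: "steklov e t = A * unit_step T t - tconv T (unit_step T) b t" for t
    using steklov_eq[OF e, of t]
    by (cases "t \<in> {0<..<T}") (auto simp: A_def b_def[abs_def] steklov_def tconv_def)
  let ?B = "tconv T (unit_step T) b"
  have BL: "L1_supp T ?B"
    by (intro L1_supp_tconv L1_suppD(1)[OF b] L1_suppD(1)[OF L1_supp_unit_step])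
  have ae1: "AE t in lborel. tconv T (steklov e) w t = A * W t - tconv T ?B w t"
    using tconv_diff_left[of "\<lambda>t. A * unit_step T t" ?B w T] L1_suppD(1)[OF BL] L1_suppD(1)[OF w]
      L1_suppD(1)[OF L1_supp_mult[OF L1_supp_unit_step, of T A]]
    unfolding st[abs_def] tconv_scaleR_left W_def by simp
  have Bc: "?B = tconv T b (unit_step T)"
    by (rule ext) (rule tconv_commute)
  have ae2: "AE t in lborel. tconv T ?B w t = tconv T b W t"
    using tconv_assoc[OF b L1_supp_unit_step w] unfolding Bc W_def by (auto elim: AE_mp)
  have bW: "AE t in lborel. integrable lborel (\<lambda>s. b (t - s) *\<^sub>R W s)"
    "AE t in lborel. integrable lborel (\<lambda>s. b (t - s) *\<^sub>R v s)"
    using AE_integrable_conv[OF L1_suppD(1)[OF b] L1_suppD(1)[OF W]]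
      AE_integrable_conv[OF L1_suppD(1)[OF b] L1_suppD(1)[OF v1]] by auto
  have ae3: "AE t in lborel. tconv T b v t \<le> tconv T b W t"
    using bW
  proof eventually_elim
    case (elim t)
    then have "(LINT s|lborel. b (t - s) *\<^sub>R v s) \<le> (LINT s|lborel. b (t - s) *\<^sub>R W s)"
      by (intro integral_mono) (auto intro!: mult_left_mono b_pos simp: v_def)
    then show ?case by (simp add: tconv_def mult_left_mono)
  qed
  have iv: "integrable lborel (\<lambda>t. v t * (A * v t - tconv T b v t))"
    using integrable_inner_bounded(1)[of lborel "\<lambda>t. A * v t - tconv T b v t" v, OF _ _ vb]
      L1_suppD(1)[OF v1] L1_suppD(1)[OF L1_supp_tconv[OF L1_suppD(1)[OF b] L1_suppD(1)[OF v1], of T]]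
    by simp
  have ist: "integrable lborel (\<lambda>t. tconv T (steklov e) w t * v t)"
    using integrable_inner_bounded(1)[of lborel "tconv T (steklov e) w" v, OF _ _ vb]
      L1_suppD(1)[OF L1_supp_tconv[OF L1_suppD(1)[OF steklov_L1[OF e]] L1_suppD(1)[OF w], of T]]
    by (simp add: mult.commute)
  have "0 \<le> (LINT t|lborel. (steklov e t + steklov e (T - t)) * (norm (v t))\<^sup>2) / 2"
    using steklov_nonneg[OF e] by simp
  also have "\<dots> \<le> (LINT t|lborel. v t * (A * v t - tconv T b v t))"
    using dissipation_inequality(2)[OF b b_pos v2, of "steklov e" A] st by simp
  also have "\<dots> \<le> (LINT t|lborel. tconv T (steklov e) w t * v t)"
  proof (rule integral_mono_AE[OF iv ist])
    show "AE t in lborel. v t * (A * v t - tconv T b v t) \<le> tconv T (steklov e) w t * v t"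
      using ae1 ae2 ae3
    proof eventually_elim
      case (elim t)
      have "A * (v t * v t) = A * (W t * v t)" unfolding v_def by (auto simp: min_def)
      moreover have "v t * tconv T b W t \<le> v t * tconv T b v t"
        using elim by (intro mult_left_mono_neg) (auto simp: v_def)
      moreover have "tconv T (steklov e) w t * v t = A * (W t * v t) - v t * tconv T b W t"
        unfolding elim(1,2) by (simp add: algebra_simps)
      moreover have "v t * (A * v t - tconv T b v t) = A * (v t * v t) - v t * tconv T b v t"
        by (simp add: algebra_simps)
      ultimately show ?case by linarith
    qed
  qed
  finally show ?thesis unfolding v_def .
qed

text \<open>  A maximum principle in integrated form: formally \<open>k * w\<close> is the derivative of \<open>k * W\<close>. The averaged
  kernels converge to \<open>k\<close> in \<open>L\<^sub>1\<close>, and \<open>min W 0\<close> is bounded.\<close>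

lemma negative_part_energy:
  fixes w :: "real \<Rightarrow> real"
  assumes w: "L1_supp T w"
  defines "W \<equiv> tconv T (unit_step T) w"
  shows "integrable lborel (\<lambda>t. tconv T k w t * min (W t) 0)"
    and "0 \<le> (LINT t|lborel. tconv T k w t * min (W t) 0)"
proof -
  define C where "C = (LINT s|lborel. \<bar>w s\<bar>)"
  have [measurable]: "W \<in> borel_measurable borel"
    unfolding W_def using L1_suppD(2)[OF L1_supp_tconv[OF L1_suppD(1)[OF L1_supp_unit_step] L1_suppD(1)[OF w]]] .
  have vb: "norm (min (W t) 0) \<le> C" for t
    using tconv_unit_step_bound[OF L1_suppD(1)[OF w], of T t] unfolding W_def C_def by auto
  note ik = L1_suppD(1)[OF L1_supp_tconv[OF L1_suppD(1)[OF k_L1] L1_suppD(1)[OF w], of T]]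
  show i: "integrable lborel (\<lambda>t. tconv T k w t * min (W t) 0)"
    using integrable_inner_bounded(1)[where \<phi> = "\<lambda>t. min (W t) 0", OF ik _ vb] by (simp add: mult.commute)
  define J where "J e = (LINT t|lborel. tconv T (steklov e) w t * min (W t) 0)" for e
  define J0 where "J0 = (LINT t|lborel. tconv T k w t * min (W t) 0)"
  have le: "\<bar>J0 - J e\<bar> \<le> C * ((LINT t|lborel. \<bar>k t - steklov e t\<bar>) * C)" if e: "0 < e" for e
  proof -
    have ij: "integrable lborel (\<lambda>t. tconv T (steklov e) w t * min (W t) 0)"
      using integrable_inner_bounded(1)[where \<phi> = "\<lambda>t. min (W t) 0", OF L1_suppD(1)[OF L1_supp_tconv[OF L1_suppD(1)[OF steklov_L1[OF e]] L1_suppD(1)[OF w], of T]] _ vb]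
      by (simp add: mult.commute)
    have d: "L1_supp T (\<lambda>t. k t - steklov e t)" by (intro L1_supp_diff k_L1 steklov_L1 e)
    note ic = L1_suppD(1)[OF L1_supp_tconv[OF L1_suppD(1)[OF d] L1_suppD(1)[OF w], of T]]
    have [measurable]: "tconv T k w \<in> borel_measurable borel" "tconv T (steklov e) w \<in> borel_measurable borel"
      "tconv T (\<lambda>t. k t - steklov e t) w \<in> borel_measurable borel"
      using ik ij L1_suppD(1)[OF L1_supp_tconv[OF L1_suppD(1)[OF steklov_L1[OF e]] L1_suppD(1)[OF w], of T]] ic by auto
    have "J0 - J e = (LINT t|lborel. tconv T k w t * min (W t) 0 - tconv T (steklov e) w t * min (W t) 0)"
      unfolding J0_def J_def using i ij by simp
    also have "\<dots> = (LINT t|lborel. min (W t) 0 \<bullet> tconv T (\<lambda>t. k t - steklov e t) w t)"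
    proof (rule integral_cong_AE)
      show "AE t in lborel. tconv T k w t * min (W t) 0 - tconv T (steklov e) w t * min (W t) 0 =
        min (W t) 0 \<bullet> tconv T (\<lambda>t. k t - steklov e t) w t"
        using tconv_diff_left[OF L1_suppD(1)[OF k_L1] L1_suppD(1)[OF steklov_L1[OF e]] L1_suppD(1)[OF w], of T]
        by eventually_elim (simp add: right_diff_distrib mult.commute)
    qed measurable
    finally have "\<bar>J0 - J e\<bar> \<le> C * (LINT t|lborel. norm (tconv T (\<lambda>t. k t - steklov e t) w t))"
      using integrable_inner_bounded(2)[OF ic _ vb] by simp
    also have "\<dots> \<le> C * ((LINT t|lborel. \<bar>k t - steklov e t\<bar>) * C)"
      using tconv_L1_norm_le[OF L1_suppD(1)[OF d] L1_suppD(1)[OF w], of T]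
      unfolding C_def by (intro mult_left_mono) auto
    finally show ?thesis .
  qed
  have "(\<lambda>j. J (1 / Suc j) - J0) \<longlonglongrightarrow> 0"
  proof (rule Lim_null_comparison)
    show "\<forall>\<^sub>F j in sequentially. norm (J (1 / Suc j) - J0) \<le> C * ((LINT t|lborel. \<bar>k t - steklov (1 / Suc j) t\<bar>) * C)"
      using le by (auto simp: abs_minus_commute)
    show "(\<lambda>j. C * ((LINT t|lborel. \<bar>k t - steklov (1 / Suc j) t\<bar>) * C)) \<longlonglongrightarrow> 0"
      using tendsto_mult[OF tendsto_const[of C] tendsto_mult[OF steklov_tendsto tendsto_const[of C]]] by simp
  qed
  then have "(\<lambda>j. J (1 / Suc j)) \<longlonglongrightarrow> J0" by (simp add: LIM_zero_iff)
  then show "0 \<le> (LINT t|lborel. tconv T k w t * min (W t) 0)"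
    unfolding J0_def[symmetric]
    by (rule LIMSEQ_le_const) (use negative_part_energy_steklov[OF w] in \<open>auto simp: J_def W_def\<close>)
qed

end

section \<open>Approximate identities\<close>

definition approximate_identity :: "real \<Rightarrow> (nat \<Rightarrow> real \<Rightarrow> real) \<Rightarrow> bool" where
  "approximate_identity T \<rho> \<longleftrightarrow>
     (\<forall>j. L1_supp T (\<rho> j) \<and> (\<forall>t. 0 \<le> \<rho> j t) \<and> (LINT s|lborel. \<rho> j s) \<le> 1) \<and>
     (\<forall>t\<in>{0<..<T}. (\<lambda>j. tconv T (unit_step T) (\<rho> j) t) \<longlonglongrightarrow> 1)"

lemma approximate_identityD:
  assumes "approximate_identity T \<rho>"
  shows "L1_supp T (\<rho> j)" "0 \<le> \<rho> j t" "(LINT s|lborel. \<bar>\<rho> j s\<bar>) \<le> 1"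
    "t \<in> {0<..<T} \<Longrightarrow> (\<lambda>j. LINT s|lborel. indicator {0<..<t} s * \<rho> j s) \<longlonglongrightarrow> 1"
  using assms unfolding approximate_identity_def by (auto simp: tconv_unit_step_eq)

lemma approximate_identity_box:
  assumes "0 < T"
  shows "approximate_identity T (\<lambda>j s. indicator {0<..<T / Suc j} s / (T / Suc j))"
  unfolding approximate_identity_def
proof (intro conjI allI ballI)
  fix j :: nat
  define d where "d = T / Suc j"
  have d: "0 < d" "d \<le> T" using assms by (auto simp: d_def field_simps)
  have i: "integrable lborel (\<lambda>s. indicator {0<..<d} s / d :: real)"
    using d by (auto intro!: integrable_real_indicator)
  have L: "L1_supp T (\<lambda>s. indicator {0<..<d} s / d)"
    using i d unfolding L1_supp_def by (auto split: split_indicator)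
  show "L1_supp T (\<lambda>s. indicator {0<..<T / Suc j} s / (T / Suc j))" using L unfolding d_def .
  show "0 \<le> indicator {0<..<T / Suc j} t / (T / Suc j)" for t using assms by simp
  have "(LINT s|lborel. indicator {0<..<d} s / d :: real) = 1" using d by simp
  then show "(LINT s|lborel. indicator {0<..<T / Suc j} s / (T / Suc j)) \<le> 1" unfolding d_def by simp
next
  fix t assume t: "t \<in> {0<..<T}"
  have "\<forall>\<^sub>F j in sequentially. T / Suc j < t"
    by (rule order_tendstoD[OF LIMSEQ_Suc[OF lim_const_over_n]]) (use t in auto)
  then have "\<forall>\<^sub>F j in sequentially. tconv T (unit_step T) (\<lambda>s. indicator {0<..<T / Suc j} s / (T / Suc j)) t = 1"
  proof eventually_elim
    case (elim j)
    define d where "d = T / Suc j"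
    have d: "0 < d" "d < t" using assms elim by (auto simp: d_def field_simps)
    have i: "integrable lborel (\<lambda>s. indicator {0<..<d} s / d :: real)"
      using d by (auto intro!: integrable_real_indicator)
    have L: "L1_supp T (\<lambda>s. indicator {0<..<d} s / d)"
      using i d t unfolding L1_supp_def by (auto split: split_indicator)
    have "tconv T (unit_step T) (\<lambda>s. indicator {0<..<d} s / d) t = (LINT s|lborel. indicator {0<..<d} s / d)"
      unfolding tconv_unit_step_eq[OF L t] using d
      by (intro Bochner_Integration.integral_cong) (auto split: split_indicator)
    also have "\<dots> = 1" using d by simp
    finally show ?case unfolding d_def .
  qed
  then show "(\<lambda>j. tconv T (unit_step T) (\<lambda>s. indicator {0<..<T / Suc j} s / (T / Suc j)) t) \<longlonglongrightarrow> 1"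
    by (rule tendsto_eventually)
qed

text \<open>  The cut-off at \<open>0\<close> of the continuous function \<open>g\<close> is harmless at \<open>t > 0\<close>: the kernels concentrate at
  \<open>0\<close>, so only values of \<open>g\<close> close to \<open>t\<close> count in the limit.\<close>

lemma tconv_tendsto_continuous:
  fixes g :: "real \<Rightarrow> 'b::euclidean_space"
  assumes \<rho>: "approximate_identity T \<rho>" and cont: "continuous_on UNIV g"
    and bound: "\<And>t. norm (g t) \<le> M" and t: "t \<in> {0<..<T}"
  shows "(\<lambda>j. tconv T (\<rho> j) (\<lambda>t. unit_step T t *\<^sub>R g t) t) \<longlonglongrightarrow> g t"
proof -
  note \<rho>L = approximate_identityD(1)[OF \<rho>] and \<rho>0 = approximate_identityD(2)[OF \<rho>]
    and \<rho>1 = approximate_identityD(3)[OF \<rho>]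
  have [measurable]: "g \<in> borel_measurable borel" using cont by (rule borel_measurable_continuous_onI)
  have [measurable]: "\<rho> j \<in> borel_measurable borel" for j using L1_suppD(2)[OF \<rho>L] .
  have i\<rho>: "integrable lborel (\<rho> j)" for j using L1_suppD(1)[OF \<rho>L] .
  have M: "0 \<le> M" using order_trans[OF norm_ge_zero bound] .
  define P where "P s j = (LINT r|lborel. indicator {0<..<s} r * \<rho> j r)" for s j
  have iP: "integrable lborel (\<lambda>r. indicator {0<..<s} r * \<rho> j r)" for s j
    using integrable_mult_indicator[OF _ i\<rho>, of "{0<..<s}" j] by simp
  have P1: "(\<lambda>j. P s j) \<longlonglongrightarrow> 1" if "s \<in> {0<..<T}" for s
    using approximate_identityD(4)[OF \<rho> that] unfolding P_def .
  have eq: "tconv T (\<rho> j) (\<lambda>t. unit_step T t *\<^sub>R g t) t =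
      (LINT s|lborel. (indicator {0<..<t} s * \<rho> j s) *\<^sub>R g (t - s))" for j
  proof -
    have "tconv T (\<rho> j) (\<lambda>t. unit_step T t *\<^sub>R g t) t = (LINT s|lborel. \<rho> j s *\<^sub>R unit_step T (t - s) *\<^sub>R g (t - s))"
      using t lborel_integral_real_affine[of "-1" "\<lambda>s. \<rho> j (t - s) *\<^sub>R unit_step T s *\<^sub>R g s" t]
      by (simp add: tconv_def)
    also have "\<dots> = (LINT s|lborel. (indicator {0<..<t} s * \<rho> j s) *\<^sub>R g (t - s))"
    proof (intro Bochner_Integration.integral_cong refl)
      fix s
      show "\<rho> j s *\<^sub>R unit_step T (t - s) *\<^sub>R g (t - s) = (indicator {0<..<t} s * \<rho> j s) *\<^sub>R g (t - s)"
        using L1_suppD(3)[OF \<rho>L[of j], of s] t by (cases "s > 0") (auto split: split_indicator)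
    qed
    finally show ?thesis .
  qed
  have ig: "integrable lborel (\<lambda>s. (indicator {0<..<t} s * \<rho> j s) *\<^sub>R g (t - s))" for j
  proof (rule Bochner_Integration.integrable_bound)
    show "integrable lborel (\<lambda>s. M * \<rho> j s)" using i\<rho> by simp
    show "AE s in lborel. norm ((indicator {0<..<t} s * \<rho> j s) *\<^sub>R g (t - s)) \<le> norm (M * \<rho> j s)"
      using M \<rho>0 mult_left_mono[OF bound \<rho>0]
      by (auto intro!: AE_I2 simp: abs_mult mult.commute[of M] split: split_indicator)
  qed measurable
  have conv: "(\<lambda>j. tconv T (\<rho> j) (\<lambda>t. unit_step T t *\<^sub>R g t) t - P t j *\<^sub>R g t) \<longlonglongrightarrow> 0"
  proof (rule LIMSEQ_I)
    fix e :: real assume e: "0 < e"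
    have "isCont g t" using cont by (simp add: continuous_on_eq_continuous_at)
    then obtain d0 where d0: "0 < d0" "\<And>s. dist s t < d0 \<Longrightarrow> dist (g s) (g t) < e / 2"
      using e unfolding continuous_at_eps_delta by (metis half_gt_zero)
    define d where "d = min d0 t / 2"
    have d: "0 < d" "d < d0" "d < t" "d \<in> {0<..<T}" using d0 t unfolding d_def by auto
    have "(\<lambda>j. P t j - P d j) \<longlonglongrightarrow> 1 - 1" using P1[OF t] P1[OF d(4)] by (rule tendsto_diff)
    then have lim: "(\<lambda>j. 2 * M * (P t j - P d j)) \<longlonglongrightarrow> 2 * M * 0"
      by (intro tendsto_mult tendsto_const) simp
    have "\<forall>\<^sub>F j in sequentially. 2 * M * (P t j - P d j) < e / 2"
      by (rule order_tendstoD(2)[OF lim]) (use e in simp)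
    then have "\<forall>\<^sub>F j in sequentially. norm (tconv T (\<rho> j) (\<lambda>t. unit_step T t *\<^sub>R g t) t - P t j *\<^sub>R g t) < e"
    proof eventually_elim
      case (elim j)
      have "norm (tconv T (\<rho> j) (\<lambda>t. unit_step T t *\<^sub>R g t) t - P t j *\<^sub>R g t) =
          norm (LINT s|lborel. (indicator {0<..<t} s * \<rho> j s) *\<^sub>R (g (t - s) - g t))"
        unfolding eq P_def using ig[of j] iP[of t j] by (simp add: scaleR_right_diff_distrib)
      also have "\<dots> \<le> (LINT s|lborel. norm ((indicator {0<..<t} s * \<rho> j s) *\<^sub>R (g (t - s) - g t)))"
        by (rule integral_norm_bound)
      also have "\<dots> \<le> (LINT s|lborel. e / 2 * \<rho> j s + 2 * M * (indicator {0<..<t} s * \<rho> j s - indicator {0<..<d} s * \<rho> j s))"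
      proof (rule integral_mono')
        show "integrable lborel (\<lambda>s. e / 2 * \<rho> j s + 2 * M * (indicator {0<..<t} s * \<rho> j s - indicator {0<..<d} s * \<rho> j s))"
          using i\<rho> iP by simp
        fix s
        have r: "norm ((indicator {0<..<t} s * \<rho> j s) *\<^sub>R (g (t - s) - g t)) =
            indicator {0<..<t} s * \<rho> j s * norm (g (t - s) - g t)"
          using \<rho>0 by (simp add: abs_mult)
        have n2: "norm (g (t - s) - g t) \<le> 2 * M"
          using norm_triangle_ineq4[of "g (t - s)" "g t"] bound[of "t - s"] bound[of t] by linarith
        show "0 \<le> e / 2 * \<rho> j s + 2 * M * (indicator {0<..<t} s * \<rho> j s - indicator {0<..<d} s * \<rho> j s)"
          using e M \<rho>0[of j s] d by (auto split: split_indicator)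
        show "norm ((indicator {0<..<t} s * \<rho> j s) *\<^sub>R (g (t - s) - g t)) \<le>
            e / 2 * \<rho> j s + 2 * M * (indicator {0<..<t} s * \<rho> j s - indicator {0<..<d} s * \<rho> j s)"
        proof (cases "s \<in> {0<..<t}")
          case True
          show ?thesis
          proof (cases "s < d")
            case True
            then have "norm (g (t - s) - g t) \<le> e / 2"
              using d0(2)[of "t - s"] \<open>s \<in> _\<close> d by (simp add: dist_norm)
            from mult_left_mono[OF this \<rho>0[of j s]] show ?thesis
              unfolding r using True \<open>s \<in> _\<close> d by (simp add: mult.commute)
          next
            case False
            from mult_left_mono[OF n2 \<rho>0[of j s]] show ?thesis
              unfolding r using False \<open>s \<in> _\<close> e \<rho>0[of j s]
              by (simp add: mult.commute add_increasing)
          qed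
        next
          case False
          then show ?thesis using e M \<rho>0[of j s] d by (auto split: split_indicator)
        qed
      qed
      also have "\<dots> = e / 2 * (LINT s|lborel. \<rho> j s) + 2 * M * (P t j - P d j)"
        unfolding P_def using i\<rho> iP by simp
      also have "\<dots> \<le> e / 2 * 1 + 2 * M * (P t j - P d j)"
        using \<rho>1[of j] \<rho>0 e by (intro add_right_mono mult_left_mono) auto
      also have "\<dots> < e" using elim by simp
      finally show ?case .
    qed
    then show "\<exists>n0. \<forall>j\<ge>n0. norm (tconv T (\<rho> j) (\<lambda>t. unit_step T t *\<^sub>R g t) t - P t j *\<^sub>R g t - 0) < e"
      by (simp add: eventually_sequentially)
  qed
  have "(\<lambda>j. P t j *\<^sub>R g t) \<longlonglongrightarrow> 1 *\<^sub>R g t" by (intro tendsto_scaleR P1[OF t] tendsto_const)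
  from tendsto_add[OF conv this] show ?thesis by simp
qed

text \<open>  Weak convergence of \<open>p * v\<close> to \<open>v\<close> means that this quantity tends to \<open>0\<close> for each test
  function \<open>\<phi>\<close>.\<close>

definition conv_defect where
  "conv_defect T p \<phi> v = (LINT t|lborel. \<phi> t \<bullet> tconv T p v t) - (LINT t|lborel. \<phi> t \<bullet> v t)"

lemma conv_defect_bounded_le:
  fixes \<phi> v w :: "real \<Rightarrow> 'b::euclidean_space"
  assumes p: "integrable lborel p" and p1: "(LINT t|lborel. \<bar>p t\<bar>) \<le> 1"
    and v: "integrable lborel v" and w: "integrable lborel w"
    and [measurable]: "\<phi> \<in> borel_measurable borel" and bound: "\<And>t. norm (\<phi> t) \<le> C"
  shows "\<bar>conv_defect T p \<phi> v - conv_defect T p \<phi> w\<bar> \<le> 2 * C * (LINT t|lborel. norm (v t - w t))"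
proof -
  have C: "0 \<le> C" using order_trans[OF norm_ge_zero bound] .
  have d: "integrable lborel (\<lambda>t. v t - w t)" using v w by simp
  note cv = L1_suppD(1)[OF L1_supp_tconv[OF p v, of T]] L1_suppD(1)[OF L1_supp_tconv[OF p w, of T]]
    L1_suppD(1)[OF L1_supp_tconv[OF p d, of T]]
  have [measurable]: "tconv T p v \<in> borel_measurable borel" "tconv T p w \<in> borel_measurable borel"
    "tconv T p (\<lambda>t. v t - w t) \<in> borel_measurable borel" using cv by auto
  note b = integrable_inner_bounded[where \<phi> = \<phi> and M = lborel, OF _ _ bound]
  have "(LINT t|lborel. \<phi> t \<bullet> tconv T p v t) - (LINT t|lborel. \<phi> t \<bullet> tconv T p w t) =
      (LINT t|lborel. \<phi> t \<bullet> tconv T p v t - \<phi> t \<bullet> tconv T p w t)"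
    using b(1)[OF cv(1)] b(1)[OF cv(2)] by simp
  also have "\<dots> = (LINT t|lborel. \<phi> t \<bullet> tconv T p (\<lambda>t. v t - w t) t)"
  proof (rule integral_cong_AE)
    show "AE t in lborel. \<phi> t \<bullet> tconv T p v t - \<phi> t \<bullet> tconv T p w t = \<phi> t \<bullet> tconv T p (\<lambda>t. v t - w t) t"
      using tconv_diff_right[OF p v w, of T] by eventually_elim (simp add: inner_diff_right)
  qed measurable
  finally have 1: "\<bar>(LINT t|lborel. \<phi> t \<bullet> tconv T p v t) - (LINT t|lborel. \<phi> t \<bullet> tconv T p w t)\<bar> \<le>
      C * (LINT t|lborel. norm (tconv T p (\<lambda>t. v t - w t) t))"
    using b(2)[OF cv(3)] by simp
  have "(LINT t|lborel. norm (tconv T p (\<lambda>t. v t - w t) t)) \<le> (LINT t|lborel. \<bar>p t\<bar>) * (LINT t|lborel. norm (v t - w t))"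
    by (rule tconv_L1_norm_le[OF p d])
  also have "\<dots> \<le> 1 * (LINT t|lborel. norm (v t - w t))"
    using p1 by (intro mult_right_mono) auto
  finally have "C * (LINT t|lborel. norm (tconv T p (\<lambda>t. v t - w t) t)) \<le> C * (LINT t|lborel. norm (v t - w t))"
    using C by (intro mult_left_mono) auto
  moreover have "(LINT t|lborel. \<phi> t \<bullet> v t) - (LINT t|lborel. \<phi> t \<bullet> w t) = (LINT t|lborel. \<phi> t \<bullet> (v t - w t))"
    using b(1)[OF v] b(1)[OF w] by (simp add: inner_diff_right)
  then have "\<bar>(LINT t|lborel. \<phi> t \<bullet> v t) - (LINT t|lborel. \<phi> t \<bullet> w t)\<bar> \<le> C * (LINT t|lborel. norm (v t - w t))"
    using b(2)[OF d] by simp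
  ultimately show ?thesis using 1 unfolding conv_defect_def by linarith
qed

text \<open>  The exchange of limits behind every density argument in this section.\<close>

lemma tendsto_zero_approximation:
  fixes X :: "nat \<Rightarrow> real" and Y :: "nat \<Rightarrow> nat \<Rightarrow> real"
  assumes Y: "\<And>i. (\<lambda>j. Y i j) \<longlonglongrightarrow> 0" and \<epsilon>: "\<epsilon> \<longlonglongrightarrow> 0"
    and le: "\<And>i j. \<bar>X j - Y i j\<bar> \<le> \<epsilon> i"
  shows "X \<longlonglongrightarrow> 0"
proof (rule LIMSEQ_I)
  fix e :: real assume e: "0 < e"
  have "\<forall>\<^sub>F i in sequentially. \<epsilon> i < e / 2" using order_tendstoD(2)[OF \<epsilon>, of "e / 2"] e by simp
  then obtain i where i: "\<epsilon> i < e / 2" by (auto simp: eventually_sequentially)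
  obtain N where N: "\<And>j. j \<ge> N \<Longrightarrow> \<bar>Y i j\<bar> < e / 2"
    using LIMSEQ_D[OF Y[of i], of "e / 2"] e by auto
  have "\<bar>X j\<bar> < e" if "j \<ge> N" for j using le[of j i] i N[OF that] by linarith
  then show "\<exists>N. \<forall>j\<ge>N. norm (X j - 0) < e" by auto
qed

lemma conv_defect_L1_closure:
  fixes \<phi> v :: "real \<Rightarrow> 'b::euclidean_space"
  assumes \<rho>: "approximate_identity T \<rho>"
    and \<phi>: "\<phi> \<in> borel_measurable borel" "\<And>t. norm (\<phi> t) \<le> C"
    and v: "integrable lborel v" and w: "\<And>i. integrable lborel (w i)"
    and lim: "AE t in lborel. (\<lambda>i. w i t) \<longlonglongrightarrow> v t"
    and dom: "\<And>i t. norm (w i t) \<le> g t" "integrable lborel g"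
    and conv: "\<And>i. (\<lambda>j. conv_defect T (\<rho> j) \<phi> (w i)) \<longlonglongrightarrow> 0"
  shows "(\<lambda>j. conv_defect T (\<rho> j) \<phi> v) \<longlonglongrightarrow> 0"
proof (rule tendsto_zero_approximation[OF conv])
  show "\<bar>conv_defect T (\<rho> j) \<phi> v - conv_defect T (\<rho> j) \<phi> (w i)\<bar> \<le> 2 * C * (LINT t|lborel. norm (v t - w i t))" for i j
    by (rule conv_defect_bounded_le[OF L1_suppD(1)[OF approximate_identityD(1)[OF \<rho>]]
        approximate_identityD(3)[OF \<rho>] v w \<phi>])
  have [measurable]: "v \<in> borel_measurable borel" "\<And>i. w i \<in> borel_measurable borel"
    using v w by auto
  have "(\<lambda>i. LINT t|lborel. norm (v t - w i t)) \<longlonglongrightarrow> (LINT t|(lborel :: real measure). 0)"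
  proof (rule integral_dominated_convergence)
    show "integrable lborel (\<lambda>t. norm (v t) + g t)" using v dom by auto
    show "AE t in lborel. (\<lambda>i. norm (v t - w i t)) \<longlonglongrightarrow> 0"
      using lim
    proof eventually_elim
      case (elim t)
      then show ?case using tendsto_norm_zero[OF LIM_zero[OF elim]] by (simp add: norm_minus_commute)
    qed
    show "AE t in lborel. norm (norm (v t - w i t)) \<le> norm (v t) + g t" for i
    proof (rule AE_I2)
      fix t
      show "norm (norm (v t - w i t)) \<le> norm (v t) + g t"
        using norm_triangle_ineq4[of "v t" "w i t"] dom(1)[of i t] by simp
    qed
  qed measurable
  then show "(\<lambda>i. 2 * C * (LINT t|lborel. norm (v t - w i t))) \<longlonglongrightarrow> 0"
    using tendsto_mult[OF tendsto_const[of "2 * C"]] by fastforce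
qed

text \<open>  Continuous bounded functions are treated by the previous pointwise limit and dominated convergence.
  A bounded measurable function is an almost everywhere limit of continuous functions, which can be
  truncated to satisfy the same bound. An integrable function is the \<open>L\<^sub>1\<close> limit of its truncations.\<close>

lemma conv_defect_tendsto_bounded:
  fixes \<phi> v :: "real \<Rightarrow> 'b::euclidean_space"
  assumes \<rho>: "approximate_identity T \<rho>"
    and \<phi>: "L1_supp T \<phi>" "\<And>t. norm (\<phi> t) \<le> C" and v: "L1_supp T v"
  shows "(\<lambda>j. conv_defect T (\<rho> j) \<phi> v) \<longlonglongrightarrow> 0"
proof -
  have [measurable]: "\<phi> \<in> borel_measurable borel" using L1_suppD(2)[OF \<phi>(1)] .
  have cont: "(\<lambda>j. conv_defect T (\<rho> j) \<phi> (\<lambda>t. unit_step T t *\<^sub>R g t)) \<longlonglongrightarrow> 0"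
    if g: "continuous_on UNIV g" "\<And>t. norm (g t) \<le> M" for g :: "real \<Rightarrow> 'b" and M
  proof -
    have [measurable]: "g \<in> borel_measurable borel" using g(1) by (rule borel_measurable_continuous_onI)
    let ?v = "\<lambda>t. unit_step T t *\<^sub>R g t"
    have M: "0 \<le> M" using order_trans[OF norm_ge_zero g(2)] .
    have iv: "integrable lborel ?v"
    proof (rule Bochner_Integration.integrable_bound)
      show "integrable lborel (\<lambda>t. M * unit_step T t)" using L1_suppD(1)[OF L1_supp_unit_step] by simp
      show "AE t in lborel. norm (?v t) \<le> norm (M * unit_step T t)"
        using g(2) M by (auto split: split_indicator)
    qed measurable
    note cv = L1_supp_tconv[OF L1_suppD(1)[OF approximate_identityD(1)[OF \<rho>]] iv, of T]
    have [measurable]: "tconv T (\<rho> j) ?v \<in> borel_measurable borel" for j using L1_suppD(2)[OF cv] .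
    have vb: "norm (?v t) \<le> M" for t using g(2)[of t] M by (auto split: split_indicator)
    have cb: "norm (tconv T (\<rho> j) ?v t) \<le> M" for j t
    proof -
      have [measurable]: "\<rho> j \<in> borel_measurable borel" using L1_suppD(2)[OF approximate_identityD(1)[OF \<rho>]] .
      have "norm (LINT s|lborel. \<rho> j (t - s) *\<^sub>R ?v s) \<le> (LINT s|lborel. norm (\<rho> j (t - s) *\<^sub>R ?v s))"
        by (rule integral_norm_bound)
      also have "\<dots> \<le> (LINT s|lborel. \<bar>\<rho> j (t - s)\<bar> * M)"
      proof (rule integral_mono')
        show "integrable lborel (\<lambda>s. \<bar>\<rho> j (t - s)\<bar> * M)"
          using lborel_integrable_real_affine[OF L1_suppD(1)[OF approximate_identityD(1)[OF \<rho>, of j]], of "-1" t] by simp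
        show "norm (\<rho> j (t - s) *\<^sub>R ?v s) \<le> \<bar>\<rho> j (t - s)\<bar> * M" for s
          using mult_left_mono[OF vb[of s], of "\<bar>\<rho> j (t - s)\<bar>"] by (simp only: norm_scaleR abs_ge_zero)
      qed (use M in auto)
      also have "\<dots> = (LINT s|lborel. \<bar>\<rho> j s\<bar>) * M"
        using lborel_integral_real_affine[of "-1" "\<lambda>s. \<bar>\<rho> j s\<bar>" t] by simp
      also have "\<dots> \<le> 1 * M" using approximate_identityD(3)[OF \<rho>] M by (intro mult_right_mono) auto
      finally show ?thesis using M by (auto simp: tconv_def split: split_indicator)
    qed
    have "(\<lambda>j. LINT t|lborel. \<phi> t \<bullet> tconv T (\<rho> j) ?v t) \<longlonglongrightarrow> (LINT t|lborel. \<phi> t \<bullet> ?v t)"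
    proof (rule integral_dominated_convergence)
      show "integrable lborel (\<lambda>t. norm (\<phi> t) * M)" using L1_suppD(1)[OF \<phi>(1)] by simp
      show "AE t in lborel. (\<lambda>j. \<phi> t \<bullet> tconv T (\<rho> j) ?v t) \<longlonglongrightarrow> \<phi> t \<bullet> ?v t"
      proof (rule AE_I2)
        fix t
        show "(\<lambda>j. \<phi> t \<bullet> tconv T (\<rho> j) ?v t) \<longlonglongrightarrow> \<phi> t \<bullet> ?v t"
        proof (cases "t \<in> {0<..<T}")
          case True
          from tendsto_inner[OF tendsto_const tconv_tendsto_continuous[OF \<rho> g True], of "\<phi> t"] True
          show ?thesis by simp
        qed (simp add: L1_suppD(3)[OF \<phi>(1)])
      qed
      show "AE t in lborel. norm (\<phi> t \<bullet> tconv T (\<rho> j) ?v t) \<le> norm (\<phi> t) * M" for j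
      proof (rule AE_I2)
        fix t
        show "norm (\<phi> t \<bullet> tconv T (\<rho> j) ?v t) \<le> norm (\<phi> t) * M"
          using order_trans[OF Cauchy_Schwarz_ineq2 mult_left_mono[OF cb norm_ge_zero]] by simp
      qed
    qed measurable
    then show ?thesis unfolding conv_defect_def by (simp add: LIM_zero)
  qed
  have bdd: "(\<lambda>j. conv_defect T (\<rho> j) \<phi> v) \<longlonglongrightarrow> 0"
    if v: "L1_supp T v" and b: "\<And>t. norm (v t) \<le> M" and M: "0 < M" for v :: "real \<Rightarrow> 'b" and M
  proof -
    have [measurable]: "v \<in> borel_measurable borel" using L1_suppD(2)[OF v] .
    have "v \<in> borel_measurable (lebesgue_on UNIV)"
      by (simp add: lebesgue_on_UNIV_eq measurable_completion)
    then have "v measurable_on UNIV" by (simp add: measurable_on_iff_borel_measurable)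
    then obtain N g where N: "negligible N" and g: "\<And>i::nat. continuous_on UNIV (g i)"
      and lim: "\<And>t. t \<notin> N \<Longrightarrow> (\<lambda>i. g i t) \<longlonglongrightarrow> v t"
      unfolding measurable_on_def by auto
    define G where "G i t = (M / max M (norm (g i t))) *\<^sub>R g i t" for i t
    have Gc: "continuous_on UNIV (G i)" for i
      unfolding G_def[abs_def] using M by (intro continuous_intros g) auto
    have Gb: "norm (G i t) \<le> M" for i t
      using M by (auto simp: G_def field_simps max_def)
    have [measurable]: "G i \<in> borel_measurable borel" for i using Gc by (rule borel_measurable_continuous_onI)
    have iM: "integrable lborel (\<lambda>t. M * unit_step T t)" using L1_suppD(1)[OF L1_supp_unit_step] by simp
    show ?thesis
    proof (rule conv_defect_L1_closure[OF \<rho> _ \<phi>(2) L1_suppD(1)[OF v], where w = "\<lambda>i t. unit_step T t *\<^sub>R G i t"])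
      show "norm (unit_step T t *\<^sub>R G i t) \<le> M * unit_step T t" for i t
        using Gb M by (auto split: split_indicator)
      then show "integrable lborel (\<lambda>t. unit_step T t *\<^sub>R G i t)" for i
        by (intro Bochner_Integration.integrable_bound[OF iM])
          (auto intro!: AE_I2 order_trans[OF _ abs_ge_self])
      have "N \<in> null_sets lebesgue" using N by (simp add: negligible_iff_null_sets)
      then have "AE t in lebesgue. t \<notin> N" by (rule AE_not_in)
      then have "AE t in lborel. t \<notin> N" by (simp add: AE_completion_iff)
      then show "AE t in lborel. (\<lambda>i. unit_step T t *\<^sub>R G i t) \<longlonglongrightarrow> v t"
      proof eventually_elim
        case (elim t)
        have "(\<lambda>i. G i t) \<longlonglongrightarrow> (M / max M (norm (v t))) *\<^sub>R v t"
          unfolding G_def using M lim[OF elim] by (intro tendsto_intros) auto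
        then have "(\<lambda>i. unit_step T t *\<^sub>R G i t) \<longlonglongrightarrow> unit_step T t *\<^sub>R (M / max M (norm (v t))) *\<^sub>R v t"
          by (intro tendsto_scaleR tendsto_const)
        also have "unit_step T t *\<^sub>R (M / max M (norm (v t))) *\<^sub>R v t = v t"
          using L1_suppD(3)[OF v, of t] b[of t] M by (auto simp: max_absorb1 split: split_indicator)
        finally show ?case .
      qed
      show "(\<lambda>j. conv_defect T (\<rho> j) \<phi> (\<lambda>t. unit_step T t *\<^sub>R G i t)) \<longlonglongrightarrow> 0" for i
        by (rule cont[OF Gc Gb])
    qed (use iM in auto)
  qed
  show ?thesis
  proof (rule conv_defect_L1_closure[OF \<rho> _ \<phi>(2) L1_suppD(1)[OF v],
        where w = "\<lambda>i t. indicator {t. norm (v t) \<le> real i} t *\<^sub>R v t" and g = "\<lambda>t. norm (v t)"])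
    have [measurable]: "v \<in> borel_measurable borel" using L1_suppD(2)[OF v] .
    show iw: "integrable lborel (\<lambda>t. indicator {t. norm (v t) \<le> real i} t *\<^sub>R v t)" for i
      by (intro integrable_mult_indicator L1_suppD(1)[OF v]) simp
    show "norm (indicator {t. norm (v t) \<le> real i} t *\<^sub>R v t) \<le> norm (v t)" for i t
      by (auto split: split_indicator)
    show "AE t in lborel. (\<lambda>i. indicator {t. norm (v t) \<le> real i} t *\<^sub>R v t) \<longlonglongrightarrow> v t"
    proof (rule AE_I2)
      fix t
      obtain i0 :: nat where "norm (v t) \<le> real i0" using real_arch_simple by blast
      then have "\<forall>\<^sub>F i in sequentially. indicator {t. norm (v t) \<le> real i} t *\<^sub>R v t = v t"
        unfolding eventually_sequentially by (intro exI[of _ i0]) auto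
      then show "(\<lambda>i. indicator {t. norm (v t) \<le> real i} t *\<^sub>R v t) \<longlonglongrightarrow> v t"
        by (rule tendsto_eventually)
    qed
    show "(\<lambda>j. conv_defect T (\<rho> j) \<phi> (\<lambda>t. indicator {t. norm (v t) \<le> real i} t *\<^sub>R v t)) \<longlonglongrightarrow> 0" for i
    proof (rule bdd[where M = "real i + 1"])
      show "L1_supp T (\<lambda>t. indicator {t. norm (v t) \<le> real i} t *\<^sub>R v t)"
        using iw L1_suppD(3)[OF v] unfolding L1_supp_def by simp
    qed (auto split: split_indicator)
  qed (use L1_suppD(1)[OF v] in auto)
qed

text \<open>  Here the test function is square integrable but may be unbounded. It is truncated, and the remainder
  is controlled by the bound on the pairing. That bound is a sum of squares rather than a product, so
  the two factors are first rescaled by \<open>1 / c\<close> and \<open>c\<close>.\<close>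

lemma conv_defect_tendsto:
  fixes \<phi> v :: "real \<Rightarrow> 'b::euclidean_space"
  assumes \<rho>: "approximate_identity T \<rho>" and \<phi>: "L2_supp T \<phi>" and v: "L2_supp T v"
  shows "(\<lambda>j. LINT t|lborel. \<phi> t \<bullet> tconv T (\<rho> j) v t) \<longlonglongrightarrow> (LINT t|lborel. \<phi> t \<bullet> v t)"
proof -
  have [measurable]: "\<phi> \<in> borel_measurable borel" "v \<in> borel_measurable borel"
    using L2_suppD(1)[OF \<phi>] L2_suppD(1)[OF v] .
  define \<phi>' where "\<phi>' i t = indicator {t. norm (\<phi> t) \<le> real i} t *\<^sub>R \<phi> t" for i t
  have p1: "L1_supp T (\<phi>' i)" for i
    using integrable_mult_indicator[OF _ L1_suppD(1)[OF L2_supp_imp_L1_supp[OF \<phi>]], of "{t. norm (\<phi> t) \<le> real i}"]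
      L2_suppD(3)[OF \<phi>] unfolding L1_supp_def \<phi>'_def by simp
  have pb: "norm (\<phi>' i t) \<le> real i" for i t unfolding \<phi>'_def by (auto split: split_indicator)
  have p2: "L2_supp T (\<phi>' i)" for i using L2_supp_bounded[OF p1 pb] .
  have [measurable]: "\<phi>' i \<in> borel_measurable borel" for i using L1_suppD(2)[OF p1] .
  define V where "V = (LINT t|lborel. (norm (v t))\<^sup>2)"
  define \<epsilon> where "\<epsilon> i = (LINT t|lborel. (norm (\<phi> t - \<phi>' i t))\<^sup>2)" for i
  have "\<epsilon> \<longlonglongrightarrow> (LINT t|(lborel :: real measure). 0)"
    unfolding \<epsilon>_def[abs_def]
  proof (rule integral_dominated_convergence)
    show "integrable lborel (\<lambda>t. (norm (\<phi> t))\<^sup>2)" using L2_suppD(2)[OF \<phi>] .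
    show "AE t in lborel. (\<lambda>i. (norm (\<phi> t - \<phi>' i t))\<^sup>2) \<longlonglongrightarrow> 0"
    proof (rule AE_I2)
      fix t
      obtain i0 :: nat where "norm (\<phi> t) \<le> real i0" using real_arch_simple by blast
      then have "\<forall>\<^sub>F i in sequentially. (norm (\<phi> t - \<phi>' i t))\<^sup>2 = 0"
        unfolding eventually_sequentially \<phi>'_def by (intro exI[of _ i0]) auto
      then show "(\<lambda>i. (norm (\<phi> t - \<phi>' i t))\<^sup>2) \<longlonglongrightarrow> 0" by (rule tendsto_eventually)
    qed
    show "AE t in lborel. norm ((norm (\<phi> t - \<phi>' i t))\<^sup>2) \<le> (norm (\<phi> t))\<^sup>2" for i
      unfolding \<phi>'_def by (auto split: split_indicator)
  qed measurable
  then have \<epsilon>0: "\<epsilon> \<longlonglongrightarrow> 0" by simp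
  have \<epsilon>_pos: "0 \<le> \<epsilon> i" for i unfolding \<epsilon>_def by simp
  have V_pos: "0 \<le> V" unfolding V_def by simp
  \<comment> \<open>\<open>c\<^sup>2\<close> and \<open>\<epsilon> / c\<^sup>2\<close> both tend to \<open>0\<close>; the summand \<open>1 / Suc i\<close> keeps \<open>c\<close> positive.\<close>
  define c where "c i = sqrt (sqrt (\<epsilon> i + 1 / Suc i))" for i
  have c_pos: "0 < c i" for i unfolding c_def using \<epsilon>_pos[of i] by (simp add: add_nonneg_pos)
  have c2: "(c i)\<^sup>2 = sqrt (\<epsilon> i + 1 / Suc i)" for i unfolding c_def using \<epsilon>_pos[of i] by simp
  have c20: "(\<lambda>i. (c i)\<^sup>2) \<longlonglongrightarrow> 0"
  proof -
    have "(\<lambda>i. sqrt (\<epsilon> i + 1 / Suc i)) \<longlonglongrightarrow> sqrt (0 + 0)"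
      by (intro tendsto_real_sqrt tendsto_add \<epsilon>0 LIMSEQ_Suc[OF lim_const_over_n])
    then show ?thesis unfolding c2 by simp
  qed
  have \<epsilon>c: "\<epsilon> i / (c i)\<^sup>2 \<le> (c i)\<^sup>2" for i
  proof -
    have "\<epsilon> i \<le> (c i)\<^sup>2 * (c i)\<^sup>2" unfolding c2 using \<epsilon>_pos[of i] by simp
    then show ?thesis using c_pos[of i] by (simp add: pos_divide_le_eq)
  qed
  have "(\<lambda>j. conv_defect T (\<rho> j) \<phi> v) \<longlonglongrightarrow> 0"
  proof (rule tendsto_zero_approximation)
    show "(\<lambda>j. conv_defect T (\<rho> j) (\<phi>' i) v) \<longlonglongrightarrow> 0" for i
      by (rule conv_defect_tendsto_bounded[OF \<rho> p1 pb L2_supp_imp_L1_supp[OF v]])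
    show "(\<lambda>i. (c i)\<^sup>2 * (1 + V)) \<longlonglongrightarrow> 0"
      using tendsto_mult[OF c20 tendsto_const[of "1 + V"]] by simp
    fix i j
    have \<rho>L: "integrable lborel (\<rho> j)" using L1_suppD(1)[OF approximate_identityD(1)[OF \<rho>]] .
    note i1 = tconv_pairing(2)[OF \<rho>L \<phi> v] tconv_pairing(2)[OF \<rho>L p2[of i] v]
    have sc: "L2_supp T (\<lambda>t. (1 / c i) *\<^sub>R (\<phi> t - \<phi>' i t))" "L2_supp T (\<lambda>t. c i *\<^sub>R v t)"
      by (intro L2_supp_scaleR L2_supp_diff \<phi> p2 v)+
    have n1: "(LINT t|lborel. (norm ((1 / c i) *\<^sub>R (\<phi> t - \<phi>' i t)))\<^sup>2) = \<epsilon> i / (c i)\<^sup>2"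
      unfolding \<epsilon>_def by (simp add: power_mult_distrib power_divide)
    have n2: "(LINT t|lborel. (norm (c i *\<^sub>R v t))\<^sup>2) = (c i)\<^sup>2 * V"
      unfolding V_def by (simp add: power_mult_distrib)
    have "(LINT t|lborel. \<phi> t \<bullet> tconv T (\<rho> j) v t) - (LINT t|lborel. \<phi>' i t \<bullet> tconv T (\<rho> j) v t) =
        (LINT t|lborel. ((1 / c i) *\<^sub>R (\<phi> t - \<phi>' i t)) \<bullet> tconv T (\<rho> j) (\<lambda>t. c i *\<^sub>R v t) t)"
      unfolding tconv_scaleR_right using i1 c_pos[of i] by (simp add: inner_diff_left)
    then have "\<bar>(LINT t|lborel. \<phi> t \<bullet> tconv T (\<rho> j) v t) - (LINT t|lborel. \<phi>' i t \<bullet> tconv T (\<rho> j) v t)\<bar> \<le>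
        (LINT s|lborel. \<bar>\<rho> j s\<bar>) * (\<epsilon> i / (c i)\<^sup>2 + (c i)\<^sup>2 * V) / 2"
      using tconv_pairing(5)[OF \<rho>L sc] unfolding n1 n2 by simp
    also have "\<dots> \<le> 1 * ((c i)\<^sup>2 * (1 + V)) / 2"
      using \<epsilon>c[of i] \<epsilon>_pos[of i] V_pos approximate_identityD(3)[OF \<rho>, of j]
      by (intro divide_right_mono mult_mono) (auto simp: algebra_simps)
    finally have A: "\<bar>(LINT t|lborel. \<phi> t \<bullet> tconv T (\<rho> j) v t) - (LINT t|lborel. \<phi>' i t \<bullet> tconv T (\<rho> j) v t)\<bar> \<le>
        (c i)\<^sup>2 * (1 + V) / 2" by simp
    have ip: "integrable lborel (\<lambda>t. \<psi> t \<bullet> v t)" if \<psi>: "L2_supp T \<psi>" for \<psi> :: "real \<Rightarrow> 'b"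
    proof -
      have [measurable]: "\<psi> \<in> borel_measurable borel" using L2_suppD(1)[OF \<psi>] .
      have "integrable lborel (\<lambda>t. ((norm (\<psi> t))\<^sup>2 + (norm (v t))\<^sup>2) / 2)"
        using L2_suppD(2)[OF \<psi>] L2_suppD(2)[OF v] by simp
      then show ?thesis
        by (rule Bochner_Integration.integrable_bound) (use inner_le_half_squares in auto)
    qed
    have "(LINT t|lborel. \<phi> t \<bullet> v t) - (LINT t|lborel. \<phi>' i t \<bullet> v t) =
        (LINT t|lborel. ((1 / c i) *\<^sub>R (\<phi> t - \<phi>' i t)) \<bullet> (c i *\<^sub>R v t))"
      using ip[OF \<phi>] ip[OF p2[of i]] c_pos[of i] by (simp add: inner_diff_left)
    then have "\<bar>(LINT t|lborel. \<phi> t \<bullet> v t) - (LINT t|lborel. \<phi>' i t \<bullet> v t)\<bar> \<le>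
        (LINT t|lborel. \<bar>((1 / c i) *\<^sub>R (\<phi> t - \<phi>' i t)) \<bullet> (c i *\<^sub>R v t)\<bar>)"
      using integral_abs_bound by metis
    also have "\<dots> \<le> (LINT t|lborel. ((norm ((1 / c i) *\<^sub>R (\<phi> t - \<phi>' i t)))\<^sup>2 + (norm (c i *\<^sub>R v t))\<^sup>2) / 2)"
    proof (rule integral_mono'[OF _ inner_le_half_squares])
      show "integrable lborel (\<lambda>t. ((norm ((1 / c i) *\<^sub>R (\<phi> t - \<phi>' i t)))\<^sup>2 + (norm (c i *\<^sub>R v t))\<^sup>2) / 2)"
        using L2_suppD(2)[OF sc(1)] L2_suppD(2)[OF sc(2)] by simp
    qed simp
    also have "\<dots> = (\<epsilon> i / (c i)\<^sup>2 + (c i)\<^sup>2 * V) / 2"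
      unfolding n1[symmetric] n2[symmetric] using L2_suppD(2)[OF sc(1)] L2_suppD(2)[OF sc(2)] by simp
    also have "\<dots> \<le> (c i)\<^sup>2 * (1 + V) / 2"
      using \<epsilon>c[of i] by (intro divide_right_mono) (auto simp: distrib_left)
    finally have B: "\<bar>(LINT t|lborel. \<phi> t \<bullet> v t) - (LINT t|lborel. \<phi>' i t \<bullet> v t)\<bar> \<le> (c i)\<^sup>2 * (1 + V) / 2" .
    show "\<bar>conv_defect T (\<rho> j) \<phi> v - conv_defect T (\<rho> j) (\<phi>' i) v\<bar> \<le> (c i)\<^sup>2 * (1 + V)"
      using A B unfolding conv_defect_def by linarith
  qed
  then show ?thesis unfolding conv_defect_def by (simp add: LIM_zero_iff)
qed

section \<open>Positivity of the resolvent kernels\<close>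

context monotone_kernel
begin

text \<open>  The primitive \<open>H\<close> of \<open>h\<close> is nondecreasing. Subtract the equation \<open>k * h = n (1 - H)\<close> at the times \<open>t\<close>
  and \<open>t - d\<close>: the increment \<open>W t = H t - H (t - d)\<close> is the primitive of \<open>w t = h t - h (t - d)\<close>,
  and \<open>k * w = - n W\<close> for \<open>t > d\<close>. For \<open>t \<le> d\<close> one has \<open>W = H\<close> and \<open>k * w = n (1 - W)\<close>, which
  exceeds \<open>- n W\<close>. So \<open>(k * w) min W 0 \<le> - n (min W 0)\<^sup>2\<close>, and the maximum principle makes
  \<open>min W 0\<close> vanish. Up to the factor \<open>d\<close>, \<open>W\<close> is the average of \<open>h\<close> over \<open>(t - d, t)\<close>.\<close>

lemma window_average_nonneg:
  fixes h :: "real \<Rightarrow> real"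
  assumes h: "L1_supp T h" and n: "0 < n"
    and eq: "AE t in lborel. tconv T k h t = n * (unit_step T t - tconv T (unit_step T) h t)"
    and d: "0 < d" "d \<le> T"
  shows "AE t in lborel. 0 \<le> tconv T (\<lambda>s. indicator {0<..<d} s / d) h t"
proof -
  define hd where "hd t = unit_step T t *\<^sub>R h (t - d)" for t
  define H where "H = tconv T (unit_step T) h"
  define w where "w t = h t - hd t" for t
  define W where "W = tconv T (unit_step T) w"
  have ihd: "integrable lborel (\<lambda>t. h (t - d))"
    using lborel_integrable_real_affine[OF L1_suppD(1)[OF h], of 1 "- d"] by simp
  have hd: "L1_supp T hd" unfolding hd_def[abs_def] by (rule L1_supp_truncate[OF ihd])
  have w: "L1_supp T w" unfolding w_def[abs_def] by (rule L1_supp_diff[OF h hd])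
  have [measurable]: "h \<in> borel_measurable borel" "hd \<in> borel_measurable borel"
    "w \<in> borel_measurable borel"
    using L1_suppD(2)[OF h] L1_suppD(2)[OF hd] L1_suppD(2)[OF w] .
  note HL = L1_supp_tconv[OF L1_suppD(1)[OF L1_supp_unit_step] L1_suppD(1)[OF h], of T T]
  note WL = L1_supp_tconv[OF L1_suppD(1)[OF L1_supp_unit_step] L1_suppD(1)[OF w], of T T]
  have [measurable]: "H \<in> borel_measurable borel" "W \<in> borel_measurable borel"
    using L1_suppD(2)[OF HL] L1_suppD(2)[OF WL] unfolding H_def W_def .
  have [measurable]: "tconv T k h \<in> borel_measurable borel"
    using L1_suppD(2)[OF L1_supp_tconv[OF L1_suppD(1)[OF k_L1] L1_suppD(1)[OF h]]] .
  have H0: "H t = 0" if "t \<notin> {0<..<T}" for t using L1_suppD(3)[OF HL that] unfolding H_def .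
  have W: "AE t in lborel. W t = H t - unit_step T t * H (t - d)"
    using tconv_diff_right[OF L1_suppD(1)[OF L1_supp_unit_step] L1_suppD(1)[OF h] L1_suppD(1)[OF hd], of T T]
  proof eventually_elim
    case (elim t)
    then show ?case
      using tconv_shift[OF L1_supp_unit_step h d(1), of t]
      unfolding W_def H_def w_def[abs_def] hd_def[abs_def] by simp
  qed
  have eq_shift: "AE t in lborel. tconv T k h (t - d) = n * (unit_step T (t - d) - H (t - d))"
    using AE_borel_affine[of 1 "\<lambda>t. tconv T k h t = n * (unit_step T t - H t)" "- d"] eq
    unfolding H_def[symmetric] by simp
  have kw: "AE t in lborel. tconv T k w t = tconv T k h t - unit_step T t * tconv T k h (t - d)"
    using tconv_diff_right[OF L1_suppD(1)[OF k_L1] L1_suppD(1)[OF h] L1_suppD(1)[OF hd], of T]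
  proof eventually_elim
    case (elim t)
    then show ?case
      using tconv_shift[OF k_L1 h d(1), of t] unfolding w_def[abs_def] hd_def[abs_def] by simp
  qed
  have ae: "AE t in lborel. tconv T k w t * min (W t) 0 \<le> - n * (min (W t) 0)\<^sup>2"
    using W eq[folded H_def] eq_shift kw
  proof eventually_elim
    case (elim t)
    show ?case
    proof (cases "t \<in> {0<..<T}")
      case False
      then show ?thesis using elim(1) H0 by simp
    next
      case True
      show ?thesis
      proof (cases "d < t")
        case td: True
        have W1: "W t = H t - H (t - d)" using elim(1) True by simp
        have "tconv T k w t = n * (1 - H t) - n * (1 - H (t - d))" using elim True td d by simp
        then have "tconv T k w t = - n * W t" unfolding W1 by (simp add: algebra_simps)
        then show ?thesis by (auto simp: min_def power2_eq_square)
      next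
        case False
        then have W: "W t = H t" and kw: "tconv T k w t = n * (1 - W t)"
          using elim True d H0[of "t - d"] by (auto simp: tconv_def)
        have "n * min (W t) 0 \<le> 0" using n by (simp add: mult_nonneg_nonpos)
        then show ?thesis
          unfolding kw by (auto simp: min_def power2_eq_square algebra_simps)
      qed
    qed
  qed
  have [measurable]: "W \<in> borel_measurable borel" by measurable
  have Wb: "norm (min (W t) 0) \<le> (LINT s|lborel. norm (w s))" for t
    using tconv_unit_step_bound[OF L1_suppD(1)[OF w], of T t] unfolding W_def by auto
  have mL: "L1_supp T (\<lambda>t. min (W t) 0)"
  proof -
    have "integrable lborel (\<lambda>t. min (W t) 0)"
      by (rule Bochner_Integration.integrable_bound[of lborel W]) (use L1_suppD(1)[OF WL] in \<open>auto simp: W_def\<close>)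
    then show ?thesis using L1_suppD(3)[OF WL] unfolding L1_supp_def W_def by simp
  qed
  have i2: "integrable lborel (\<lambda>t. (min (W t) 0)\<^sup>2)"
    using L2_suppD(2)[OF L2_supp_bounded[OF mL Wb]] by simp
  have "0 \<le> (LINT t|lborel. tconv T k w t * min (W t) 0)"
    using negative_part_energy(2)[OF w] unfolding W_def .
  also have "\<dots> \<le> (LINT t|lborel. - n * (min (W t) 0)\<^sup>2)"
    using negative_part_energy(1)[OF w] i2 ae unfolding W_def by (intro integral_mono_AE) auto
  finally have "(LINT t|lborel. (min (W t) 0)\<^sup>2) \<le> 0"
    using n by (simp add: mult_le_0_iff zero_le_mult_iff)
  then have "(LINT t|lborel. (min (W t) 0)\<^sup>2) = 0" by (simp add: order_antisym)
  then have "AE t in lborel. (min (W t) 0)\<^sup>2 = 0"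
    using integral_nonneg_eq_0_iff_AE[OF i2] by simp
  with W show ?thesis
  proof eventually_elim
    case (elim t)
    then have W0: "0 \<le> W t" by (auto simp: min_def split: if_splits)
    show ?case
    proof (cases "t \<in> {0<..<T}")
      case True
      have "W t = (LINT s|lborel. unit_step T (t - s) * h s) - (LINT s|lborel. unit_step T (t - d - s) * h s)"
      proof -
        have "H (t - d) = (LINT s|lborel. unit_step T (t - d - s) * h s)"
        proof (cases "t - d > 0")
          case False
          then have "unit_step T (t - d - s) * h s = 0" for s
            using L1_suppD(3)[OF h, of s] by (cases "s > 0") auto
          then have "(LINT s|lborel. unit_step T (t - d - s) * h s) = (LINT s|(lborel::real measure). 0)"
            by (intro Bochner_Integration.integral_cong refl)
          then show ?thesis using False H0[of "t - d"] by simp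
        qed (use True d in \<open>simp add: H_def tconv_def\<close>)
        then show ?thesis using elim(1) True by (simp add: H_def tconv_def)
      qed
      also have "\<dots> = (LINT s|lborel. unit_step T (t - s) * h s - unit_step T (t - d - s) * h s)"
      proof -
        have "integrable lborel (\<lambda>s. unit_step T (c - s) * h s)" for c
          by (rule Bochner_Integration.integrable_bound[OF L1_suppD(1)[OF h]]) (auto split: split_indicator)
        then show ?thesis by simp
      qed
      also have "\<dots> = (LINT s|lborel. indicator {0<..<d} (t - s) * h s)"
      proof (rule integral_cong_AE)
        show "AE s in lborel. unit_step T (t - s) * h s - unit_step T (t - d - s) * h s = indicator {0<..<d} (t - s) * h s"
          using AE_lborel_singleton[of "t - d"]
        proof eventually_elim
          case (elim s)
          then show ?case
            using L1_suppD(3)[OF h, of s] True d by (cases "s > 0") (auto split: split_indicator)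
        qed
      qed measurable
      also have "\<dots> = d * tconv T (\<lambda>s. indicator {0<..<d} s / d) h t"
        using True d by (simp add: tconv_def)
      finally show ?thesis using W0 d by (simp add: zero_le_mult_iff)
    qed (simp add: tconv_def)
  qed
qed

text \<open>  The averages of \<open>h\<close> over short windows are nonnegative and converge weakly to \<open>h\<close>. It suffices to
  test with the indicator of the set where \<open>h\<close> is negative.\<close>

lemma resolvent_kernel_nonneg:
  fixes h :: "real \<Rightarrow> real"
  assumes h: "L1_supp T h" and n: "0 < n"
    and eq: "AE t in lborel. tconv T k h t = n * (unit_step T t - tconv T (unit_step T) h t)"
  shows "AE t in lborel. 0 \<le> h t"
proof -
  define \<phi> where "\<phi> t = unit_step T t * indicator {t. h t < 0} t" for t
  define \<rho> where "\<rho> j s = indicator {0<..<T / Suc j} s / (T / Suc j)" for j :: nat and s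
  have [measurable]: "h \<in> borel_measurable borel" using L1_suppD(2)[OF h] .
  have [measurable]: "\<phi> \<in> borel_measurable borel" unfolding \<phi>_def[abs_def] by measurable
  have \<phi>b: "norm (\<phi> t) \<le> 1" for t unfolding \<phi>_def by (auto split: split_indicator)
  have \<phi>: "L1_supp T \<phi>"
  proof -
    have "integrable lborel \<phi>"
      by (rule Bochner_Integration.integrable_bound[OF L1_suppD(1)[OF L1_supp_unit_step, of T]])
        (auto simp: \<phi>_def split: split_indicator)
    then show ?thesis unfolding L1_supp_def \<phi>_def by auto
  qed
  have \<rho>: "approximate_identity T \<rho>" unfolding \<rho>_def[abs_def] by (rule approximate_identity_box[OF T_pos])
  have "(\<lambda>j. LINT t|lborel. \<phi> t \<bullet> tconv T (\<rho> j) h t) \<longlonglongrightarrow> (LINT t|lborel. \<phi> t \<bullet> h t)"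
    using conv_defect_tendsto_bounded[OF \<rho> \<phi> \<phi>b h] unfolding conv_defect_def by (simp add: LIM_zero_iff)
  moreover have "0 \<le> (LINT t|lborel. \<phi> t \<bullet> tconv T (\<rho> j) h t)" for j
  proof (rule integral_nonneg_AE)
    have "T / Suc j \<le> T" using T_pos by (simp add: field_simps)
    then show "AE t in lborel. 0 \<le> \<phi> t \<bullet> tconv T (\<rho> j) h t"
      using window_average_nonneg[OF h n eq, of "T / Suc j"] T_pos
      unfolding \<rho>_def[abs_def] \<phi>_def by auto
  qed
  ultimately have ge: "0 \<le> (LINT t|lborel. \<phi> t * h t)"
    by (auto intro: LIMSEQ_le_const)
  have i: "integrable lborel (\<lambda>t. - (\<phi> t * h t))"
    using integrable_inner_bounded(1)[OF L1_suppD(1)[OF h] _ \<phi>b] by simp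
  have "AE t in lborel. 0 \<le> - (\<phi> t * h t)"
    unfolding \<phi>_def by (auto split: split_indicator)
  from integral_nonneg_eq_0_iff_AE[OF i this] integral_nonneg_AE[OF this] ge
  have "AE t in lborel. - (\<phi> t * h t) = 0" by simp
  then show ?thesis
  proof eventually_elim
    case (elim t)
    then show ?case using L1_suppD(3)[OF h, of t]
      by (cases "t \<in> {0<..<T}") (auto simp: \<phi>_def split: split_indicator_asm)
  qed
qed

text \<open>  Since \<open>k * h \<ge> 0\<close>, the equation shows that the primitive of \<open>h\<close> is at most \<open>1\<close> almost everywhere in
  \<open>(0,T)\<close>; let the time tend to \<open>T\<close>.\<close>

lemma resolvent_kernel_mass:
  fixes h :: "real \<Rightarrow> real"
  assumes h: "L1_supp T h" and n: "0 < n" and h0: "\<And>t. 0 \<le> h t"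
    and eq: "AE t in lborel. tconv T k h t = n * (unit_step T t - tconv T (unit_step T) h t)"
  shows "(LINT t|lborel. h t) \<le> 1"
proof (rule ccontr)
  assume "\<not> ?thesis"
  then have gt: "1 < (LINT t|lborel. h t)" by simp
  have [measurable]: "h \<in> borel_measurable borel" using L1_suppD(2)[OF h] .
  define t where "t j = T - T / Suc (Suc j)" for j
  have t: "t j \<in> {0<..<T}" for j using T_pos by (auto simp: t_def field_simps add_pos_nonneg)
  have tl: "t \<longlonglongrightarrow> T - 0"
    unfolding t_def by (intro tendsto_diff tendsto_const LIMSEQ_Suc lim_const_over_n)
  have "(\<lambda>j. LINT s|lborel. indicator {0<..<t j} s * h s) \<longlonglongrightarrow> (LINT s|lborel. h s)"
  proof (rule integral_dominated_convergence)
    show "integrable lborel h" using L1_suppD(1)[OF h] .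
    show "AE s in lborel. (\<lambda>j. indicator {0<..<t j} s * h s) \<longlonglongrightarrow> h s"
    proof (rule AE_I2)
      fix s
      show "(\<lambda>j. indicator {0<..<t j} s * h s) \<longlonglongrightarrow> h s"
      proof (cases "s \<in> {0<..<T}")
        case True
        then have "\<forall>\<^sub>F j in sequentially. s < t j" using order_tendstoD(1)[OF tl, of s] by simp
        then have "\<forall>\<^sub>F j in sequentially. indicator {0<..<t j} s * h s = h s"
          by eventually_elim (use True in auto)
        then show ?thesis by (rule tendsto_eventually)
      qed (simp add: L1_suppD(3)[OF h])
    qed
  qed (use h0 in \<open>auto split: split_indicator\<close>)
  then have "\<forall>\<^sub>F j in sequentially. 1 < (LINT s|lborel. indicator {0<..<t j} s * h s)"
    using gt by (rule order_tendstoD(1))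
  then obtain j where j: "1 < (LINT s|lborel. indicator {0<..<t j} s * h s)"
    by (auto simp: eventually_sequentially)
  have "AE s in lborel. s \<notin> {t j<..<T}"
    using eq
  proof eventually_elim
    case (elim s)
    show ?case
    proof
      assume s: "s \<in> {t j<..<T}"
      then have sT: "s \<in> {0<..<T}" using t[of j] by auto
      have "(LINT r|lborel. indicator {0<..<t j} r * h r) \<le> (LINT r|lborel. indicator {0<..<s} r * h r)"
        using s h0 integrable_mult_indicator[OF _ L1_suppD(1)[OF h], of "{0<..<t j}"]
          integrable_mult_indicator[OF _ L1_suppD(1)[OF h], of "{0<..<s}"]
        by (intro integral_mono) (auto split: split_indicator)
      then have "1 < tconv T (unit_step T) h s" using j tconv_unit_step_eq[OF h sT] by simp
      then have "tconv T k h s < 0"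
        unfolding elim using sT n by (simp add: mult_pos_neg)
      moreover have "0 \<le> tconv T k h s"
        unfolding tconv_def using k_nonneg h0 by (auto intro!: integral_nonneg_AE mult_nonneg_nonneg)
      ultimately show False by simp
    qed
  qed
  then have "emeasure lborel {t j<..<T} = 0"
    by (subst (asm) AE_iff_measurable[of "{t j<..<T}"]) auto
  then show False using t[of j] by simp
qed

end

text \<open>  Since \<open>l = h / n + h * l\<close> and \<open>h \<ge> 0\<close>, the negative part \<open>m\<close> of \<open>l\<close> satisfies \<open>m \<le> h * m\<close>. In the
  weighted space with weight \<open>exp (- j t)\<close> the kernel \<open>h\<close> has norm less than \<open>1\<close> for large \<open>j\<close>, so
  \<open>m = 0\<close>.\<close>

lemma kernel_nonneg_of_resolvent:
  fixes l h :: "real \<Rightarrow> real"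
  assumes l: "L1_supp T l" and h: "L1_supp T h" and h0: "\<And>t. 0 \<le> h t" and n: "0 < n"
    and res: "AE t in lborel. h t + n * tconv T h l t = n * l t"
  shows "AE t in lborel. 0 \<le> l t"
proof -
  define m where "m t = max (- l t) 0" for t
  have [measurable]: "l \<in> borel_measurable borel" "h \<in> borel_measurable borel"
    using L1_suppD(2)[OF l] L1_suppD(2)[OF h] .
  have m0: "0 \<le> m t" for t unfolding m_def by simp
  have im: "integrable lborel m"
    unfolding m_def[abs_def] using L1_suppD(1)[OF l] by (intro integrable_max) auto
  have m: "L1_supp T m" using im L1_suppD(3)[OF l] unfolding L1_supp_def m_def by auto
  have [measurable]: "m \<in> borel_measurable borel" using im by auto
  have le: "AE t in lborel. m t \<le> tconv T h m t"
    using res AE_integrable_conv[OF L1_suppD(1)[OF h] L1_suppD(1)[OF l]]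
      AE_integrable_conv[OF L1_suppD(1)[OF h] im]
  proof eventually_elim
    case (elim t)
    have "0 \<le> tconv T h m t"
      unfolding tconv_def using h0 m0 by (auto intro!: integral_nonneg_AE mult_nonneg_nonneg)
    moreover have "- tconv T h m t \<le> tconv T h l t"
    proof -
      have "(LINT s|lborel. - (h (t - s) * m s)) \<le> (LINT s|lborel. h (t - s) * l s)"
      proof (rule integral_mono)
        show "- (h (t - s) * m s) \<le> h (t - s) * l s" for s
          using mult_left_mono[OF _ h0[of "t - s"], of "- m s" "l s"] by (simp add: m_def)
      qed (use elim in auto)
      then show ?thesis by (auto simp: tconv_def split: split_indicator)
    qed
    moreover have "tconv T h l t \<le> l t"
    proof -
      have "n * tconv T h l t \<le> n * l t" using elim(1) h0[of t] by linarith
      then show ?thesis using n by simp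
    qed
    ultimately show ?case unfolding m_def by simp
  qed
  \<comment> \<open>The weight is multiplicative in time, hence compatible with convolution.\<close>
  define p where "p j t = exp (- real j * t) * h t" for j :: nat and t
  have pb: "norm (p j t) \<le> h t" for j t
    using L1_suppD(3)[OF h, of t] h0[of t]
    by (cases "t > 0") (auto simp: p_def intro!: mult_left_le_one_le)
  have [measurable]: "p j \<in> borel_measurable borel" for j unfolding p_def[abs_def] by measurable
  have ip: "integrable lborel (p j)" for j
    by (rule Bochner_Integration.integrable_bound[OF L1_suppD(1)[OF h]]) (use pb h0 in auto)
  have "(\<lambda>j. LINT t|lborel. p j t) \<longlonglongrightarrow> (LINT t|(lborel :: real measure). 0)"
  proof (rule integral_dominated_convergence)
    show "AE t in lborel. (\<lambda>j. p j t) \<longlonglongrightarrow> 0"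
    proof (rule AE_I2)
      fix t
      show "(\<lambda>j. p j t) \<longlonglongrightarrow> 0"
      proof (cases "t > 0")
        case True
        have "p j t = exp (- t) ^ j * h t" for j
          unfolding p_def by (simp add: exp_of_nat_mult[symmetric])
        moreover have "(\<lambda>j. exp (- t) ^ j * h t) \<longlonglongrightarrow> 0 * h t"
          using True by (intro tendsto_mult LIMSEQ_realpow_zero tendsto_const) auto
        ultimately show ?thesis by simp
      qed (simp add: p_def L1_suppD(3)[OF h])
    qed
  qed (use L1_suppD(1)[OF h] pb in auto)
  then have "\<forall>\<^sub>F j in sequentially. (LINT t|lborel. p j t) < 1"
    by (intro order_tendstoD(2)[of _ 0]) auto
  then obtain j where j: "(LINT t|lborel. p j t) < 1" by (auto simp: eventually_sequentially)
  define g where "g t = exp (- real j * t) * m t" for t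
  have g0: "0 \<le> g t" for t unfolding g_def using m0 by simp
  have [measurable]: "g \<in> borel_measurable borel" unfolding g_def[abs_def] by measurable
  have gb: "norm (g t) \<le> norm (m t)" for t
    using L1_suppD(3)[OF m, of t] m0[of t]
    by (cases "t > 0") (auto simp: g_def intro!: mult_left_le_one_le)
  have ig: "integrable lborel g"
    by (rule Bochner_Integration.integrable_bound[OF im])
      (use gb in auto)
  have gle: "AE t in lborel. g t \<le> tconv T (p j) g t"
    using le
  proof eventually_elim
    case (elim t)
    have "p j (t - s) * g s = exp (- real j * t) * (h (t - s) * m s)" for s
    proof -
      have "exp (- real j * t) = exp (- real j * (t - s)) * exp (- real j * s)"
        by (simp add: algebra_simps flip: exp_add)
      then show ?thesis unfolding p_def g_def by simp
    qed
    then have "tconv T (p j) g t = exp (- real j * t) * tconv T h m t"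
      unfolding tconv_def by simp
    then show ?case using elim unfolding g_def by simp
  qed
  have "(LINT t|lborel. g t) \<le> (LINT t|lborel. norm (tconv T (p j) g t))"
    using gle ig L1_suppD(1)[OF L1_supp_tconv[OF ip ig]] by (intro integral_mono_AE) auto
  also have "\<dots> \<le> (LINT t|lborel. \<bar>p j t\<bar>) * (LINT t|lborel. norm (g t))"
    by (rule tconv_L1_norm_le[OF ip ig])
  also have "\<dots> = (LINT t|lborel. p j t) * (LINT t|lborel. g t)"
    using g0 h0 by (simp add: p_def)
  finally have "(1 - (LINT t|lborel. p j t)) * (LINT t|lborel. g t) \<le> 0" by (simp add: algebra_simps)
  moreover have "0 \<le> (LINT t|lborel. g t)" using g0 by simp
  ultimately have "(LINT t|lborel. g t) = 0" using j by (simp add: mult_le_0_iff)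
  then have "AE t in lborel. g t = 0" using integral_nonneg_eq_0_iff_AE[OF ig] g0 by simp
  then show ?thesis by eventually_elim (auto simp: g_def m_def)
qed

text \<open>  Convolve the resolvent equation with \<open>k\<close> and use \<open>k * l = 1\<close>. In other words, the kernel
  \<open>k\<^sub>n = k * h\<^sub>n\<close> equals \<open>n (1 - 1 * h\<^sub>n)\<close>, whose derivative is \<open>- n h\<^sub>n\<close>.\<close>

lemma (in monotone_kernel) conv_kernel_resolvent:
  fixes l h :: "real \<Rightarrow> real"
  assumes l: "L1_supp T l" and kl: "AE t in lborel. tconv T k l t = unit_step T t"
    and h: "L1_supp T h" and res: "AE t in lborel. h t + n * tconv T h l t = n * l t"
  shows "AE t in lborel. tconv T k h t = n * (unit_step T t - tconv T (unit_step T) h t)"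
proof -
  have [measurable]: "l \<in> borel_measurable borel" "h \<in> borel_measurable borel"
    using L1_suppD(2)[OF l] L1_suppD(2)[OF h] .
  note hl = L1_supp_tconv[OF L1_suppD(1)[OF h] L1_suppD(1)[OF l], of T]
  note kl1 = L1_supp_tconv[OF L1_suppD(1)[OF k_L1] L1_suppD(1)[OF l], of T]
  have [measurable]: "tconv T h l \<in> borel_measurable borel" "tconv T k l \<in> borel_measurable borel"
    using L1_suppD(2)[OF hl] L1_suppD(2)[OF kl1] .
  have 1: "tconv T k h t = tconv T k (\<lambda>t. n * l t - n * tconv T h l t) t" for t
    by (rule tconv_cong_AE) (use res in \<open>auto elim!: AE_mp\<close>)
  have 2: "AE t in lborel. tconv T k (\<lambda>t. n * l t - n * tconv T h l t) t =
      tconv T k (\<lambda>t. n * l t) t - tconv T k (\<lambda>t. n * tconv T h l t) t"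
    by (intro tconv_diff_right) (use L1_suppD(1)[OF k_L1] L1_suppD(1)[OF l] L1_suppD(1)[OF hl] in auto)
  have comm: "tconv T h l = tconv T l h" by (rule ext) (rule tconv_commute)
  have 3: "AE t in lborel. tconv T k (tconv T l h) t = tconv T (tconv T k l) h t"
    by (rule tconv_assoc[OF k_L1 l h])
  have 4: "tconv T (tconv T k l) h t = tconv T (unit_step T) h t" for t
    by (rule tconv_cong_AE) (use kl in auto)
  have n: "tconv T k (\<lambda>t. n * l t) t = n * tconv T k l t" 
    "tconv T k (\<lambda>t. n * tconv T h l t) t = n * tconv T k (tconv T l h) t" for t
    using tconv_scaleR_right[of T k n l t] tconv_scaleR_right[of T k n "tconv T h l" t] by (simp_all add: comm)
  show ?thesis
    using 2 3 kl
  proof eventually_elim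
    case (elim t)
    then show ?case unfolding 1 n 4 by (simp add: algebra_simps)
  qed
qed

section \<open>Regularized kernels and the energy inequality\<close>

text \<open>  The kernel with index \<open>j\<close> belongs to \<open>n = Suc j\<close>, which is positive. The sign
  conditions hold at every time, because nonnegative representatives are chosen.\<close>

locale regularized_kernel = monotone_kernel +
  fixes l :: "real \<Rightarrow> real" and h :: "nat \<Rightarrow> real \<Rightarrow> real"
  assumes l_L1: "L1_supp T l" and l_nonneg: "0 \<le> l t"
    and conv_kl: "AE t in lborel. tconv T k l t = unit_step T t"
    and h_L1: "L1_supp T (h j)" and h_nonneg: "0 \<le> h j t"
    and resolvent: "AE t in lborel. h j t + Suc j * tconv T (h j) l t = Suc j * l t"
begin

definition primitive :: "nat \<Rightarrow> real \<Rightarrow> real" where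
  "primitive j = tconv T (unit_step T) (h j)"

lemma h_integrable [simp]: "integrable lborel (h j)"
  using L1_suppD(1)[OF h_L1] .

lemma h_measurable [measurable]: "h j \<in> borel_measurable borel"
  using L1_suppD(2)[OF h_L1] .

lemma l_measurable [measurable]: "l \<in> borel_measurable borel"
  using L1_suppD(2)[OF l_L1] .

lemma l_integrable [simp]: "integrable lborel l"
  using L1_suppD(1)[OF l_L1] .

lemma k_integrable [simp]: "integrable lborel k"
  using L1_suppD(1)[OF k_L1] .

lemma primitive_L1: "L1_supp T (primitive j)"
  unfolding primitive_def by (intro L1_supp_tconv L1_suppD(1)[OF L1_supp_unit_step]) simp

lemma primitive_measurable [measurable]: "primitive j \<in> borel_measurable borel"
  using L1_suppD(2)[OF primitive_L1] .

lemma conv_kh: "AE t in lborel. tconv T k (h j) t = Suc j * (unit_step T t - primitive j t)"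
  using conv_kernel_resolvent[OF l_L1 conv_kl h_L1 resolvent] unfolding primitive_def .

lemma h_integral_le_1: "(LINT t|lborel. h j t) \<le> 1"
  by (rule resolvent_kernel_mass[OF h_L1 _ h_nonneg conv_kh[unfolded primitive_def]]) simp

lemma h_norm: "(LINT t|lborel. \<bar>h j t\<bar>) \<le> 1"
  using h_integral_le_1 h_nonneg by simp

lemma integrable_indicator_h: "integrable lborel (\<lambda>s. indicator {0<..<t} s * h j s)"
  using integrable_mult_indicator[OF _ h_integrable, of "{0<..<t}" j] by simp

lemma primitive_nonneg: "0 \<le> primitive j t"
  unfolding primitive_def tconv_def using h_nonneg by (auto intro!: integral_nonneg_AE mult_nonneg_nonneg)

lemma primitive_le_1: "primitive j t \<le> 1"
proof (cases "t \<in> {0<..<T}")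
  case True
  have "primitive j t \<le> (LINT t|lborel. h j t)"
    unfolding primitive_def tconv_unit_step_eq[OF h_L1 True] using h_nonneg
    by (intro integral_mono integrable_mult_indicator) (auto split: split_indicator)
  with h_integral_le_1 show ?thesis by (rule order_trans[rotated])
qed (simp add: L1_suppD(3)[OF primitive_L1])

lemma primitive_mono:
  assumes "0 < s" "s \<le> t" "t < T"
  shows "primitive j s \<le> primitive j t"
proof -
  have "s \<in> {0<..<T}" "t \<in> {0<..<T}" using assms by auto
  then show ?thesis
    unfolding primitive_def using assms h_nonneg
    by (simp add: tconv_unit_step_eq[OF h_L1])
      (intro integral_mono integrable_indicator_h, auto split: split_indicator)
qed

lemma integrable_indicator_kh: "integrable lborel (\<lambda>s. indicator {a<..<b} s * tconv T k (h j) s)"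
  using integrable_mult_indicator[OF _ L1_suppD(1)[OF L1_supp_tconv[OF k_integrable h_integrable]],
    of "{a<..<b}" T j] by simp

text \<open>  The function \<open>k * h j\<close> agrees almost everywhere with the nonincreasing function
  \<open>Suc j * (1 - primitive j)\<close>, so its integral over a window is bounded by the values at the end points.\<close>

lemma kh_window_le:
  assumes "0 \<le> a" "a < b" "b < T"
  shows "(b - a) * (Suc j * (1 - primitive j b)) \<le> (LINT s|lborel. indicator {a<..<b} s * tconv T k (h j) s)"
    and "0 < a \<Longrightarrow> (LINT s|lborel. indicator {a<..<b} s * tconv T k (h j) s) \<le> (b - a) * (Suc j * (1 - primitive j a))"
proof -
  have c: "integrable lborel (\<lambda>s. indicator {a<..<b} s * c)"
    "(LINT s|lborel. indicator {a<..<b} s * c) = (b - a) * c" for c :: real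
    using assms by (auto intro!: integrable_real_indicator)
  have "(LINT s|lborel. indicator {a<..<b} s * (Suc j * (1 - primitive j b))) \<le>
      (LINT s|lborel. indicator {a<..<b} s * tconv T k (h j) s)"
  proof (rule integral_mono_AE[OF c(1) integrable_indicator_kh])
    show "AE s in lborel. indicator {a<..<b} s * (Suc j * (1 - primitive j b)) \<le> indicator {a<..<b} s * tconv T k (h j) s"
      using conv_kh[of j]
    proof eventually_elim
      case (elim s)
      show ?case
        using primitive_mono[of s b j] assms unfolding elim by (auto split: split_indicator)
    qed
  qed
  then show "(b - a) * (Suc j * (1 - primitive j b)) \<le> (LINT s|lborel. indicator {a<..<b} s * tconv T k (h j) s)"
    unfolding c .
  assume "0 < a"
  have "(LINT s|lborel. indicator {a<..<b} s * tconv T k (h j) s) \<le>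
      (LINT s|lborel. indicator {a<..<b} s * (Suc j * (1 - primitive j a)))"
  proof (rule integral_mono_AE[OF integrable_indicator_kh c(1)])
    show "AE s in lborel. indicator {a<..<b} s * tconv T k (h j) s \<le> indicator {a<..<b} s * (Suc j * (1 - primitive j a))"
      using conv_kh[of j]
    proof eventually_elim
      case (elim s)
      show ?case
        using primitive_mono[of a s j] assms \<open>0 < a\<close> unfolding elim by (auto split: split_indicator)
    qed
  qed
  then show "(LINT s|lborel. indicator {a<..<b} s * tconv T k (h j) s) \<le> (b - a) * (Suc j * (1 - primitive j a))"
    unfolding c .
qed

text \<open>  By monotonicity \<open>t (k * h j) t \<le> \<integral>\<^sub>0\<^sup>t k * h j \<le> \<integral> k\<close>, hence \<open>1 - primitive j t\<close> is of order \<open>1 / j\<close>.\<close>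

lemma primitive_tendsto:
  assumes t: "t \<in> {0<..<T}"
  shows "(\<lambda>j. primitive j t) \<longlonglongrightarrow> 1"
proof (rule tendsto_sandwich)
  define C where "C = (LINT t|lborel. \<bar>k t\<bar>) / t"
  have "1 - C / Suc j \<le> primitive j t" for j
  proof -
    note ikh = L1_suppD(1)[OF L1_supp_tconv[OF k_integrable h_integrable[of j], of T]]
    have "t * (Suc j * (1 - primitive j t)) \<le> (LINT s|lborel. indicator {0<..<t} s * tconv T k (h j) s)"
      using kh_window_le(1)[of 0 t j] t by simp
    also have "\<dots> \<le> (LINT s|lborel. norm (tconv T k (h j) s))"
      using integrable_indicator_kh ikh by (intro integral_mono) (auto split: split_indicator)
    also have "\<dots> \<le> (LINT t|lborel. \<bar>k t\<bar>) * (LINT t|lborel. norm (h j t))"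
      by (rule tconv_L1_norm_le) auto
    also have "\<dots> \<le> (LINT t|lborel. \<bar>k t\<bar>) * 1"
      using h_norm[of j] by (intro mult_left_mono) auto
    finally have "Suc j * (1 - primitive j t) \<le> C" using t by (simp add: C_def field_simps)
    then show ?thesis by (simp add: field_simps)
  qed
  then show "\<forall>\<^sub>F j in sequentially. 1 - C / Suc j \<le> primitive j t" by simp
  have "(\<lambda>j. 1 - C / Suc j) \<longlonglongrightarrow> 1 - 0"
    by (intro tendsto_diff tendsto_const LIMSEQ_Suc[OF lim_const_over_n])
  then show "(\<lambda>j. 1 - C / Suc j) \<longlonglongrightarrow> 1" by simp
qed (use primitive_le_1 in auto)

lemma approximate_identity_h: "approximate_identity T h"
  unfolding approximate_identity_def using h_L1 h_nonneg h_integral_le_1 primitive_tendsto unfolding primitive_def by auto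

lemma integral_kh_tendsto:
  assumes s: "s \<in> {0<..<T}"
  shows "(\<lambda>j. LINT r|lborel. indicator {0<..<s} r * tconv T k (h j) r) \<longlonglongrightarrow>
    (LINT r|lborel. indicator {0<..<s} r * k r)"
proof -
  have eq: "(LINT r|lborel. indicator {0<..<s} r * tconv T k (h j) r) = (LINT r|lborel. primitive j (s - r) * k r)" for j
  proof -
    have "(LINT r|lborel. indicator {0<..<s} r * tconv T k (h j) r) = tconv T (unit_step T) (tconv T k (h j)) s"
      using tconv_unit_step_eq[OF L1_supp_tconv[OF k_integrable h_integrable] s] by simp
    also have "\<dots> = tconv T (primitive j) k s"
      unfolding primitive_def ext[of "tconv T k (h j)" "tconv T (h j) k", OF tconv_commute] by (rule tconv_assoc_bounded[OF L1_supp_unit_step h_L1 k_L1, of 1]) simp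
    finally show ?thesis using s by (simp add: tconv_def[of T "primitive j"])
  qed
  show ?thesis unfolding eq
  proof (rule integral_dominated_convergence)
    show "AE r in lborel. (\<lambda>j. primitive j (s - r) * k r) \<longlonglongrightarrow> indicator {0<..<s} r * k r"
    proof (rule AE_I2)
      fix r
      show "(\<lambda>j. primitive j (s - r) * k r) \<longlonglongrightarrow> indicator {0<..<s} r * k r"
      proof (cases "r \<in> {0<..<s}")
        case True
        have "(\<lambda>j. primitive j (s - r) * k r) \<longlonglongrightarrow> 1 * k r"
          by (intro tendsto_mult tendsto_const primitive_tendsto) (use True s in auto)
        then show ?thesis using True by simp
      next
        case False
        then have "primitive j (s - r) * k r = 0" for j
          using L1_suppD(3)[OF k_L1, of r] L1_suppD(3)[OF primitive_L1, of "s - r"] by (cases "r > 0") auto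
        then have "(\<lambda>j. primitive j (s - r) * k r) = (\<lambda>j. 0)" by (intro ext)
        then show ?thesis using False by simp
      qed
    qed
    show "AE r in lborel. norm (primitive j (s - r) * k r) \<le> k r" for j
      using primitive_le_1 primitive_nonneg k_nonneg by (auto simp: abs_mult intro!: mult_left_le_one_le)
  qed auto
qed

text \<open>  Pointwise lower bound for the limit of the kernels \<open>k\<^sub>n\<close>. Their integrals converge to those of \<open>k\<close>,
  and by monotonicity \<open>k\<^sub>n t\<close> is at least the average of \<open>k\<^sub>n\<close> over \<open>(t, t + d)\<close>, which in the limit is
  at least \<open>k (t + d)\<close>.\<close>

lemma eventually_regularized_ge:
  assumes t: "t \<in> {0<..<T}" and cont: "isCont k t" and e: "0 < e"
  shows "\<forall>\<^sub>F j in sequentially. k t - e \<le> Suc j * (1 - primitive j t)"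
proof -
  obtain d0 where d0: "0 < d0" "\<And>s. dist s t < d0 \<Longrightarrow> dist (k s) (k t) < e"
    using cont e unfolding continuous_at_eps_delta by metis
  define d where "d = min d0 (T - t) / 2"
  have d: "0 < d" "d < d0" "t + d < T" using d0 t unfolding d_def by (auto simp: min_def field_simps)
  have ke: "k t - e < k (t + d)" using d0(2)[of "t + d"] d by (simp add: dist_norm) 
  have t2: "t + d \<in> {0<..<T}" using t d by auto
  have split: "(LINT r|lborel. indicator {0<..<t + d} r * f r) - (LINT r|lborel. indicator {0<..<t} r * f r) =
      (LINT r|lborel. indicator {t<..<t + d} r * f r)" if f: "integrable lborel f" for f :: "real \<Rightarrow> real"
  proof -
    have i: "integrable lborel (\<lambda>r. indicator {a<..<b} r * f r)" for a b
      using integrable_mult_indicator[OF _ f, of "{a<..<b}"] by simp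
    have [measurable]: "f \<in> borel_measurable borel" using f by auto
    have "(LINT r|lborel. indicator {0<..<t + d} r * f r) - (LINT r|lborel. indicator {0<..<t} r * f r) =
      (LINT r|lborel. indicator {0<..<t + d} r * f r - indicator {0<..<t} r * f r)"
      using i by simp
    also have "\<dots> = (LINT r|lborel. indicator {t<..<t + d} r * f r)"
    proof (rule integral_cong_AE)
      show "AE r in lborel. indicator {0<..<t + d} r * f r - indicator {0<..<t} r * f r = indicator {t<..<t + d} r * f r"
        using AE_lborel_singleton[of t]
        by eventually_elim (use t d in \<open>auto split: split_indicator\<close>)
    qed measurable
    finally show ?thesis .
  qed
  have "(\<lambda>j. LINT r|lborel. indicator {t<..<t + d} r * tconv T k (h j) r) \<longlonglongrightarrow>
      (LINT r|lborel. indicator {t<..<t + d} r * k r)"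
    using tendsto_diff[OF integral_kh_tendsto[OF t2] integral_kh_tendsto[OF t]]
      L1_suppD(1)[OF L1_supp_tconv[OF k_integrable h_integrable]]
    by (simp add: split)
  moreover have "d * (k t - e) < (LINT r|lborel. indicator {t<..<t + d} r * k r)"
  proof -
    have "d * (k t - e) < d * k (t + d)" using ke d by simp
    also have "\<dots> \<le> (LINT r|lborel. indicator {t<..<t + d} r * k r)"
      using integral_window_bounds(1)[of t "t + d"] t d by simp
    finally show ?thesis .
  qed
  ultimately have "\<forall>\<^sub>F j in sequentially. d * (k t - e) < (LINT r|lborel. indicator {t<..<t + d} r * tconv T k (h j) r)"
    by (rule order_tendstoD(1))
  then show ?thesis
  proof eventually_elim
    case (elim j)
    also have "(LINT r|lborel. indicator {t<..<t + d} r * tconv T k (h j) r) \<le> d * (Suc j * (1 - primitive j t))"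
      using kh_window_le(2)[of t "t + d" j] t d by simp
    finally show ?case using d by simp
  qed
qed

lemma conv_hl: "AE t in lborel. tconv T (h j) l t = l t - h j t / Suc j"
  using resolvent[of j] by eventually_elim (simp add: field_simps)

lemma conv_h_conv_l:
  fixes g :: "real \<Rightarrow> 'b::euclidean_space"
  assumes g: "L1_supp T g"
  shows "AE t in lborel. tconv T (h j) (tconv T l g) t = tconv T l g t - (1 / Suc j) *\<^sub>R tconv T (h j) g t"
proof -
  have ih: "integrable lborel (\<lambda>t. (1 / Suc j) * h j t)" by simp
  have [measurable]: "g \<in> borel_measurable borel" "tconv T (h j) l \<in> borel_measurable borel"
    using L1_suppD(2)[OF g] L1_suppD(2)[OF L1_supp_tconv[OF h_integrable l_integrable]] .
  have cong: "tconv T (tconv T (h j) l) g t = tconv T (\<lambda>t. l t - (1 / Suc j) * h j t) g t" for t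
    by (rule tconv_cong_AE) (use conv_hl[of j] in auto)
  show ?thesis
    using tconv_assoc[OF h_L1 l_L1 g, of j] tconv_diff_left[OF l_integrable ih L1_suppD(1)[OF g], of T]
    by eventually_elim (simp only: cong tconv_scaleR_left)
qed

lemma conv_l_conv_h:
  fixes g :: "real \<Rightarrow> 'b::euclidean_space"
  assumes g: "L1_supp T g"
  shows "AE t in lborel. tconv T l (tconv T (h j) g) t = tconv T l g t - (1 / Suc j) *\<^sub>R tconv T (h j) g t"
proof -
  have ih: "integrable lborel (\<lambda>t. (1 / Suc j) * h j t)" by simp
  have [measurable]: "g \<in> borel_measurable borel" "tconv T l (h j) \<in> borel_measurable borel"
    using L1_suppD(2)[OF g] L1_suppD(2)[OF L1_supp_tconv[OF l_integrable h_integrable]] .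
  have cong: "tconv T (tconv T l (h j)) g t = tconv T (\<lambda>t. l t - (1 / Suc j) * h j t) g t" for t
    by (rule tconv_cong_AE) (use conv_hl[of j] in \<open>auto simp: tconv_commute[of T l]\<close>)
  show ?thesis
    using tconv_assoc[OF l_L1 h_L1 g, of j] tconv_diff_left[OF l_integrable ih L1_suppD(1)[OF g], of T]
    by eventually_elim (simp only: cong tconv_scaleR_left)
qed

text \<open>  Formally \<open>y = l * g\<close> solves \<open>(k * y)' = g\<close>, and the dissipation inequality for \<open>k\<close> is the claim. For
  the kernels \<open>k\<^sub>n\<close> this is rigorous: \<open>n (y - h\<^sub>n * y) = h\<^sub>n * g\<close> by the resolvent equation. In the limit
  the right-hand side converges because \<open>h\<^sub>n * g\<close> tends weakly to \<open>g\<close>, and the left-hand side is treated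
  by Fatou's lemma, for which the lower bound on \<open>k\<^sub>n\<close> suffices.\<close>

theorem kernel_energy_inequality:
  fixes g :: "real \<Rightarrow> 'b::euclidean_space"
  assumes g: "L2_supp T g"
  shows "integrable lborel (\<lambda>t. (k (T - t) + k t) * (norm (tconv T l g t))\<^sup>2)"
    and "(LINT t|lborel. (k (T - t) + k t) * (norm (tconv T l g t))\<^sup>2) / 2 \<le>
      (LINT t|lborel. tconv T l g t \<bullet> g t)"
proof -
  define y where "y = tconv T l g"
  have y: "L2_supp T y" unfolding y_def by (rule tconv_L2(1)[OF l_integrable g])
  have [measurable]: "y \<in> borel_measurable borel" using L2_suppD(1)[OF y] .
  define a where "a j t = Suc j * (1 - primitive j t)" for j t
  have a0: "0 \<le> a j t" for j t unfolding a_def using primitive_le_1[of j t] by simp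
  have [measurable]: "a j \<in> borel_measurable borel" for j unfolding a_def[abs_def] by measurable
  have L1: "L1_supp T (\<lambda>t. Suc j * h j t)" for j by (rule L1_supp_mult[OF h_L1])
  have aeq: "a j t = Suc j - tconv T (unit_step T) (\<lambda>t. Suc j * h j t) t" for j t
    using tconv_scaleR_right[of T "unit_step T" "Suc j" "h j" t] unfolding a_def primitive_def
    by (simp add: algebra_simps)
  have pos: "0 \<le> Suc j * h j t" for j t using h_nonneg[of j t] by simp
  note diss = dissipation_inequality[OF L1 pos y aeq]
  define I where "I j = (LINT t|lborel. y t \<bullet> tconv T (h j) g t)" for j
  define I0 where "I0 = (LINT t|lborel. y t \<bullet> g t)"
  have I: "I \<longlonglongrightarrow> I0"
    unfolding I_def[abs_def] I0_def by (rule conv_defect_tendsto[OF approximate_identity_h y g])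
  have le: "(LINT t|lborel. (a j t + a j (T - t)) * (norm (y t))\<^sup>2) \<le> 2 * I j" for j
  proof -
    have "(LINT t|lborel. y t \<bullet> (real (Suc j) *\<^sub>R y t - tconv T (\<lambda>t. Suc j * h j t) y t)) = I j"
      unfolding I_def
    proof (rule integral_cong_AE)
      have [measurable]: "tconv T (h j) g \<in> borel_measurable borel" "tconv T (\<lambda>t. Suc j * h j t) y \<in> borel_measurable borel"
        using L2_suppD(1)[OF tconv_L2(1)[OF h_integrable g]]
          L2_suppD(1)[OF tconv_L2(1)[OF L1_suppD(1)[OF L1] y]] .
      show "(\<lambda>t. y t \<bullet> (real (Suc j) *\<^sub>R y t - tconv T (\<lambda>t. Suc j * h j t) y t)) \<in> borel_measurable lborel"
        "(\<lambda>t. y t \<bullet> tconv T (h j) g t) \<in> borel_measurable lborel" by measurable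
      show "AE t in lborel. y t \<bullet> (real (Suc j) *\<^sub>R y t - tconv T (\<lambda>t. Suc j * h j t) y t) = y t \<bullet> tconv T (h j) g t"
        using conv_h_conv_l[OF L2_supp_imp_L1_supp[OF g], of j]
      proof eventually_elim
        case (elim t)
        have "real (Suc j) *\<^sub>R y t - tconv T (\<lambda>t. Suc j * h j t) y t = real (Suc j) *\<^sub>R (y t - tconv T (h j) y t)"
          unfolding tconv_scaleR_left by (simp add: scaleR_right_diff_distrib)
        also have "\<dots> = tconv T (h j) g t" using elim unfolding y_def by simp
        finally show ?case by simp
      qed
    qed
    then show ?thesis using diss(2)[of j] by simp
  qed
  have fatou: "(\<integral>\<^sup>+t. ennreal ((k (T - t) + k t) * (norm (y t))\<^sup>2) \<partial>lborel) \<le> ennreal (2 * I0)"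
  proof -
    have "(\<integral>\<^sup>+t. ennreal ((k (T - t) + k t) * (norm (y t))\<^sup>2) \<partial>lborel) \<le>
        (\<integral>\<^sup>+t. liminf (\<lambda>j. ennreal ((a j t + a j (T - t)) * (norm (y t))\<^sup>2)) \<partial>lborel)"
    proof (rule nn_integral_mono_AE)
      show "AE t in lborel. ennreal ((k (T - t) + k t) * (norm (y t))\<^sup>2) \<le>
          liminf (\<lambda>j. ennreal ((a j t + a j (T - t)) * (norm (y t))\<^sup>2))"
        using k_continuous_AE k_continuous_reflected_AE
      proof eventually_elim
        case (elim t)
        show ?case
        proof (cases "t \<in> {0<..<T} \<and> y t \<noteq> 0")
          case False
          then have "y t = 0" using L2_suppD(3)[OF y] by auto
          then show ?thesis by simp
        next
          case True
          then have t: "t \<in> {0<..<T}" "T - t \<in> {0<..<T}" and y: "0 < (norm (y t))\<^sup>2" by auto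
          have c: "isCont k t" "isCont k (T - t)" using elim t by auto
          show ?thesis
          proof (rule ennreal_le_epsilon)
            fix e :: real assume e: "0 < e"
            define e' where "e' = e / (2 * (norm (y t))\<^sup>2)"
            have e': "0 < e'" using e y unfolding e'_def by simp
            have "\<forall>\<^sub>F j in sequentially. ennreal ((k (T - t) + k t) * (norm (y t))\<^sup>2 - e) \<le>
                ennreal ((a j t + a j (T - t)) * (norm (y t))\<^sup>2)"
              using eventually_regularized_ge[OF t(1) c(1) e'] eventually_regularized_ge[OF t(2) c(2) e']
            proof eventually_elim
              case (elim j)
              have "(k (T - t) + k t - 2 * e') * (norm (y t))\<^sup>2 \<le> (a j t + a j (T - t)) * (norm (y t))\<^sup>2"
                using elim unfolding a_def by (intro mult_right_mono) auto
              moreover have "2 * e' * (norm (y t))\<^sup>2 = e" using y unfolding e'_def by simp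
              ultimately show ?case by (intro ennreal_leI) (simp add: left_diff_distrib)
            qed
            then have "ennreal ((k (T - t) + k t) * (norm (y t))\<^sup>2 - e) \<le>
                liminf (\<lambda>j. ennreal ((a j t + a j (T - t)) * (norm (y t))\<^sup>2))"
              by (rule Liminf_bounded)
            then have "ennreal ((k (T - t) + k t) * (norm (y t))\<^sup>2 - e) + ennreal e \<le>
                liminf (\<lambda>j. ennreal ((a j t + a j (T - t)) * (norm (y t))\<^sup>2)) + ennreal e"
              by (rule add_right_mono)
            moreover have "ennreal ((k (T - t) + k t) * (norm (y t))\<^sup>2) \<le>
                ennreal ((k (T - t) + k t) * (norm (y t))\<^sup>2 - e) + ennreal e"
              using e by (cases "(k (T - t) + k t) * (norm (y t))\<^sup>2 \<le> e")
                (auto simp: ennreal_neg ennreal_leI simp flip: ennreal_plus)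
            ultimately show "ennreal ((k (T - t) + k t) * (norm (y t))\<^sup>2) \<le>
                liminf (\<lambda>j. ennreal ((a j t + a j (T - t)) * (norm (y t))\<^sup>2)) + ennreal e"
              by (rule order_trans[rotated])
          qed
        qed
      qed
    qed
    also have "\<dots> \<le> liminf (\<lambda>j. \<integral>\<^sup>+t. ennreal ((a j t + a j (T - t)) * (norm (y t))\<^sup>2) \<partial>lborel)"
      by (rule nn_integral_liminf) measurable
    also have "\<dots> \<le> liminf (\<lambda>j. ennreal (2 * I j))"
    proof (rule Liminf_mono, rule always_eventually, rule allI)
      fix j
      have "(\<integral>\<^sup>+t. ennreal ((a j t + a j (T - t)) * (norm (y t))\<^sup>2) \<partial>lborel) =
          ennreal (LINT t|lborel. (a j t + a j (T - t)) * (norm (y t))\<^sup>2)"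
        using diss(1)[of j] a0 by (intro nn_integral_eq_integral) auto
      also have "\<dots> \<le> ennreal (2 * I j)" by (rule ennreal_leI[OF le])
      finally show "(\<integral>\<^sup>+t. ennreal ((a j t + a j (T - t)) * (norm (y t))\<^sup>2) \<partial>lborel) \<le> ennreal (2 * I j)" .
    qed
    also have "liminf (\<lambda>j. ennreal (2 * I j)) = ennreal (2 * I0)"
      by (intro lim_imp_Liminf tendsto_ennrealI tendsto_mult tendsto_const I) simp
    finally show ?thesis .
  qed
  have I0: "0 \<le> I0"
  proof (rule LIMSEQ_le_const[OF I], intro exI allI impI)
    fix j
    have "0 \<le> (LINT t|lborel. (a j t + a j (T - t)) * (norm (y t))\<^sup>2)" using a0 by simp
    then show "0 \<le> I j" using le[of j] by linarith
  qed
  show int: "integrable lborel (\<lambda>t. (k (T - t) + k t) * (norm (tconv T l g t))\<^sup>2)"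
    using fatou k_nonneg unfolding y_def[symmetric]
    by (intro integrableI_nonneg) (auto simp: less_top[symmetric] top_unique)
  have "ennreal (LINT t|lborel. (k (T - t) + k t) * (norm (y t))\<^sup>2) \<le> ennreal (2 * I0)"
    using fatou nn_integral_eq_integral[OF int] k_nonneg unfolding y_def by simp
  then show "(LINT t|lborel. (k (T - t) + k t) * (norm (tconv T l g t))\<^sup>2) / 2 \<le>
      (LINT t|lborel. tconv T l g t \<bullet> g t)"
    using I0 unfolding y_def I0_def by simp
qed

end

text \<open>  Reflection of time at \<open>T / 2\<close> turns integrals over \<open>(t,T)\<close> into ordinary convolutions.\<close>

definition reflect :: "real \<Rightarrow> (real \<Rightarrow> 'b) \<Rightarrow> real \<Rightarrow> 'b" where
  "reflect T g t = g (T - t)"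

definition tbconv :: "real \<Rightarrow> (real \<Rightarrow> real) \<Rightarrow> (real \<Rightarrow> 'b::euclidean_space) \<Rightarrow> real \<Rightarrow> 'b" where
  "tbconv T p g t = indicator {0<..<T} t *\<^sub>R (LINT s|lborel. p (s - t) *\<^sub>R g s)"

lemma tbconv_eq_reflect: "tbconv T p g t = tconv T p (reflect T g) (T - t)"
proof -
  have "(LINT s|lborel. p (s - t) *\<^sub>R g s) = (LINT s|lborel. p (T - t - s) *\<^sub>R g (T - s))"
    using lborel_integral_real_affine[of "-1" "\<lambda>s. p (s - t) *\<^sub>R g s" T] by (simp add: algebra_simps)
  then show ?thesis by (auto simp: tbconv_def tconv_def reflect_def split: split_indicator)
qed

lemma L2_supp_reflect:
  assumes g: "L2_supp T g"
  shows "L2_supp T (reflect T g)"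
proof -
  have [measurable]: "g \<in> borel_measurable borel" using L2_suppD(1)[OF g] .
  have "integrable lborel (\<lambda>t. (norm (reflect T g t))\<^sup>2)"
    using lborel_integrable_real_affine[OF L2_suppD(2)[OF g], of "-1" T] unfolding reflect_def by simp
  then show ?thesis using L2_suppD(3)[OF g] unfolding L2_supp_def reflect_def by auto
qed

context regularized_kernel
begin

text \<open>  The energy inequality for the reflected function. Both the weight \<open>k (T - t) + k t\<close> and the quadratic
  form \<open>\<integral> g \<bullet> (l * g)\<close> are invariant under the reflection.\<close>

theorem backward_energy_inequality:
  fixes g :: "real \<Rightarrow> 'b::euclidean_space"
  assumes g: "L2_supp T g"
  shows "integrable lborel (\<lambda>t. (k (T - t) + k t) * (norm (tbconv T l g t))\<^sup>2)"
    and "(LINT t|lborel. (k (T - t) + k t) * (norm (tbconv T l g t))\<^sup>2) / 2 \<le>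
      (LINT t|lborel. g t \<bullet> tconv T l g t)"
proof -
  note g' = L2_supp_reflect[OF g]
  let ?E = "\<lambda>t. (k (T - t) + k t) * (norm (tconv T l (reflect T g) t))\<^sup>2"
  have eq: "(k (T - t) + k t) * (norm (tbconv T l g t))\<^sup>2 = ?E (T - t)" for t
    unfolding tbconv_eq_reflect by (simp add: add.commute)
  show "integrable lborel (\<lambda>t. (k (T - t) + k t) * (norm (tbconv T l g t))\<^sup>2)"
    unfolding eq using lborel_integrable_real_affine[OF kernel_energy_inequality(1)[OF g'], of "-1" T] by simp
  have E: "(LINT t|lborel. (k (T - t) + k t) * (norm (tbconv T l g t))\<^sup>2) = (LINT t|lborel. ?E t)"
    unfolding eq using lborel_integral_real_affine[of "-1" ?E T] by simp
  note i = tconv_pairing(1)[OF l_integrable g g]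
  have "(LINT t|lborel. reflect T g t \<bullet> tconv T l (reflect T g) t) =
      (LINT t|lborel. LINT s|lborel. l (t - s) * (g (T - t) \<bullet> g (T - s)))"
    unfolding tconv_pairing(3)[OF l_integrable g' g'] by (simp add: reflect_def)
  also have "\<dots> = (LINT t|lborel. LINT s|lborel. l (T - t - s) * (g t \<bullet> g (T - s)))"
    using lborel_integral_real_affine[of "-1" "\<lambda>t. LINT s|lborel. l (t - s) * (g (T - t) \<bullet> g (T - s))" T] by simp
  also have "\<dots> = (LINT t|lborel. LINT s|lborel. l (s - t) * (g t \<bullet> g s))"
  proof (rule Bochner_Integration.integral_cong[OF refl])
    fix t
    show "(LINT s|lborel. l (T - t - s) * (g t \<bullet> g (T - s))) = (LINT s|lborel. l (s - t) * (g t \<bullet> g s))"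
      using lborel_integral_real_affine[of "-1" "\<lambda>s. l (s - t) * (g t \<bullet> g s)" T] by (simp add: algebra_simps)
  qed
  also have "\<dots> = (LINT s|lborel. LINT t|lborel. l (s - t) * (g s \<bullet> g t))"
    using lborel_pair.Fubini_integral[OF i] by (simp add: inner_commute)
  also have "\<dots> = (LINT t|lborel. g t \<bullet> tconv T l g t)"
    unfolding tconv_pairing(3)[OF l_integrable g g] ..
  finally show "(LINT t|lborel. (k (T - t) + k t) * (norm (tbconv T l g t))\<^sup>2) / 2 \<le>
      (LINT t|lborel. g t \<bullet> tconv T l g t)"
    using kernel_energy_inequality(2)[OF g'] unfolding E by (simp add: inner_commute)
qed

end

section \<open>Functions on the space-time cylinder\<close>

definition L2_cyl :: "real \<Rightarrow> (real \<Rightarrow> 'a::euclidean_space \<Rightarrow> 'b::euclidean_space) \<Rightarrow> bool" where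
  "L2_cyl T F \<longleftrightarrow> (\<lambda>(t, x). F t x) \<in> borel_measurable borel \<and>
     integrable lborel (\<lambda>(t, x). (norm (F t x))\<^sup>2) \<and> (\<forall>t x. t \<notin> {0<..<T} \<longrightarrow> F t x = 0)"

lemma L2_cyl_measurable:
  fixes F :: "real \<Rightarrow> 'a::euclidean_space \<Rightarrow> 'b::euclidean_space"
  assumes "L2_cyl T F"
  shows "(\<lambda>(t, x). F t x) \<in> borel_measurable (borel \<Otimes>\<^sub>M borel)"
    and "(\<lambda>(x, t). F t x) \<in> borel_measurable (borel \<Otimes>\<^sub>M borel)"
proof -
  show m [measurable]: "(\<lambda>(t, x). F t x) \<in> borel_measurable (borel \<Otimes>\<^sub>M borel)"
    using assms unfolding L2_cyl_def by (simp add: borel_prod)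
  have "(\<lambda>z. (\<lambda>(t, x). F t x) (snd z, fst z)) \<in> borel_measurable ((borel :: 'a measure) \<Otimes>\<^sub>M (borel :: real measure))"
    by measurable
  then show "(\<lambda>(x, t). F t x) \<in> borel_measurable (borel \<Otimes>\<^sub>M borel)"
    by (simp add: case_prod_unfold)
qed

lemma L2_cyl_zero: "L2_cyl T F \<Longrightarrow> t \<notin> {0<..<T} \<Longrightarrow> F t x = 0"
  unfolding L2_cyl_def by auto

lemma L2_cyl_integrable:
  assumes "L2_cyl T F"
  shows "integrable (lborel \<Otimes>\<^sub>M lborel) (\<lambda>(t, x). (norm (F t x))\<^sup>2)"
  using assms unfolding L2_cyl_def by (simp add: lborel_prod)

lemma L2_cyl_slice:
  fixes F :: "real \<Rightarrow> 'a::euclidean_space \<Rightarrow> 'b::euclidean_space"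
  assumes F: "L2_cyl T F"
  shows "AE x in lborel. L2_supp T (\<lambda>t. F t x)"
    and "integrable lborel (\<lambda>x. LINT t|lborel. (norm (F t x))\<^sup>2)"
    and "AE t in lborel. integrable lborel (\<lambda>x. (norm (F t x))\<^sup>2)"
    and "(\<lambda>t. F t x) \<in> borel_measurable borel" "(\<lambda>x. F t x) \<in> borel_measurable borel"
proof -
  note [measurable] = L2_cyl_measurable[OF F]
  show m: "(\<lambda>t. F t x) \<in> borel_measurable borel" for x by measurable
  show "(\<lambda>x. F t x) \<in> borel_measurable borel" for t by measurable
  show "AE x in lborel. L2_supp T (\<lambda>t. F t x)"
    using lborel_pair.AE_integrable_snd[OF L2_cyl_integrable[OF F]]
    by eventually_elim (use m L2_cyl_zero[OF F] in \<open>auto simp: L2_supp_def\<close>)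
  show "integrable lborel (\<lambda>x. LINT t|lborel. (norm (F t x))\<^sup>2)"
    using lborel_pair.integrable_snd[OF L2_cyl_integrable[OF F]] .
  show "AE t in lborel. integrable lborel (\<lambda>x. (norm (F t x))\<^sup>2)"
    using lborel_pair.AE_integrable_fst[OF L2_cyl_integrable[OF F]] .
qed

lemma integrable_inner_of_squares:
  fixes f g :: "'c \<Rightarrow> 'b::euclidean_space"
  assumes [measurable]: "f \<in> borel_measurable M" "g \<in> borel_measurable M"
    and "integrable M (\<lambda>x. (norm (f x))\<^sup>2)" "integrable M (\<lambda>x. (norm (g x))\<^sup>2)"
  shows "integrable M (\<lambda>x. f x \<bullet> g x)"
proof -
  have "integrable M (\<lambda>x. ((norm (f x))\<^sup>2 + (norm (g x))\<^sup>2) / 2)" using assms by simp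
  then show ?thesis
    by (rule Bochner_Integration.integrable_bound) (use inner_le_half_squares in auto)
qed

lemma L2_cyl_inner:
  fixes F G :: "real \<Rightarrow> 'a::euclidean_space \<Rightarrow> 'b::euclidean_space"
  assumes F: "L2_cyl T F" and G: "L2_cyl T G"
  shows "integrable (lborel \<Otimes>\<^sub>M lborel) (\<lambda>(t, x). F t x \<bullet> G t x)"
proof -
  note [measurable] = L2_cyl_measurable[OF F] L2_cyl_measurable[OF G]
  show ?thesis
    using integrable_inner_of_squares[of "\<lambda>(t, x). F t x" "lborel \<Otimes>\<^sub>M lborel" "\<lambda>(t, x). G t x"]
      L2_cyl_integrable[OF F] L2_cyl_integrable[OF G] by (simp add: case_prod_unfold)
qed

lemma L2_cylI:
  fixes F :: "real \<Rightarrow> 'a::euclidean_space \<Rightarrow> 'b::euclidean_space"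
  assumes "(\<lambda>(t, x). F t x) \<in> borel_measurable (borel \<Otimes>\<^sub>M borel)"
    and "integrable (lborel \<Otimes>\<^sub>M lborel) (\<lambda>(t, x). (norm (F t x))\<^sup>2)"
    and "\<And>t x. t \<notin> {0<..<T} \<Longrightarrow> F t x = 0"
  shows "L2_cyl T F"
  using assms unfolding L2_cyl_def by (simp add: borel_prod lborel_prod)

lemma L2_cyl_scaleR:
  fixes F :: "real \<Rightarrow> 'a::euclidean_space \<Rightarrow> 'b::euclidean_space"
  assumes F: "L2_cyl T F" shows "L2_cyl T (\<lambda>t x. c *\<^sub>R F t x)"
proof (rule L2_cylI)
  note [measurable] = L2_cyl_measurable[OF F]
  show "(\<lambda>(t, x). c *\<^sub>R F t x) \<in> borel_measurable (borel \<Otimes>\<^sub>M borel)" by measurable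
  have "integrable (lborel \<Otimes>\<^sub>M lborel) (\<lambda>z. c\<^sup>2 * (case z of (t, x) \<Rightarrow> (norm (F t x))\<^sup>2))"
    using L2_cyl_integrable[OF F] by simp
  then show "integrable (lborel \<Otimes>\<^sub>M lborel) (\<lambda>(t, x). (norm (c *\<^sub>R F t x))\<^sup>2)"
    by (simp add: case_prod_unfold power_mult_distrib)
qed (simp add: L2_cyl_zero[OF F])

lemma L2_cyl_add:
  fixes F G :: "real \<Rightarrow> 'a::euclidean_space \<Rightarrow> 'b::euclidean_space"
  assumes F: "L2_cyl T F" and G: "L2_cyl T G"
  shows "L2_cyl T (\<lambda>t x. F t x + G t x)"
proof (rule L2_cylI)
  note [measurable] = L2_cyl_measurable[OF F] L2_cyl_measurable[OF G]
  show "(\<lambda>(t, x). F t x + G t x) \<in> borel_measurable (borel \<Otimes>\<^sub>M borel)" by measurable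
  have "integrable (lborel \<Otimes>\<^sub>M lborel) (\<lambda>z. (case z of (t, x) \<Rightarrow> (norm (F t x))\<^sup>2) +
      (case z of (t, x) \<Rightarrow> (norm (G t x))\<^sup>2) + 2 * (case z of (t, x) \<Rightarrow> F t x \<bullet> G t x))"
    using L2_cyl_integrable[OF F] L2_cyl_integrable[OF G] L2_cyl_inner[OF F G] by simp
  then show "integrable (lborel \<Otimes>\<^sub>M lborel) (\<lambda>(t, x). (norm (F t x + G t x))\<^sup>2)"
    by (simp add: case_prod_unfold power2_norm_eq_inner inner_add_left inner_add_right inner_commute algebra_simps)
qed (simp add: L2_cyl_zero[OF F] L2_cyl_zero[OF G])

lemma L2_cyl_diff:
  fixes F G :: "real \<Rightarrow> 'a::euclidean_space \<Rightarrow> 'b::euclidean_space"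
  assumes F: "L2_cyl T F" and G: "L2_cyl T G"
  shows "L2_cyl T (\<lambda>t x. F t x - G t x)"
  using L2_cyl_add[OF F L2_cyl_scaleR[OF G, of "-1"]] by simp

lemma L2_cyl_tconv:
  fixes F :: "real \<Rightarrow> 'a::euclidean_space \<Rightarrow> 'b::euclidean_space"
  assumes p: "integrable lborel p" and F: "L2_cyl T F"
  shows "L2_cyl T (\<lambda>t x. tconv T p (\<lambda>s. F s x) t)"
proof (rule L2_cylI)
  note [measurable] = L2_cyl_measurable[OF F]
  have [measurable]: "p \<in> borel_measurable borel" using p by auto
  have "(\<lambda>z. unit_step T (fst z) *\<^sub>R (LINT s|lborel. p (fst z - s) *\<^sub>R F s (snd z)))
      \<in> borel_measurable ((borel :: real measure) \<Otimes>\<^sub>M (borel :: 'a measure))"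
    by measurable
  then show m: "(\<lambda>(t, x). tconv T p (\<lambda>s. F s x) t) \<in> borel_measurable (borel \<Otimes>\<^sub>M borel)"
    by (simp add: tconv_def case_prod_unfold)
  note [measurable] = m
  have [measurable]: "(\<lambda>(x, t). tconv T p (\<lambda>s. F s x) t) \<in> borel_measurable ((borel :: 'a measure) \<Otimes>\<^sub>M (borel :: real measure))"
  proof -
    have "(\<lambda>z. (\<lambda>(t, x). tconv T p (\<lambda>s. F s x) t) (snd z, fst z)) \<in> borel_measurable ((borel :: 'a measure) \<Otimes>\<^sub>M (borel :: real measure))"
      by measurable
    then show ?thesis by (simp add: case_prod_unfold)
  qed
  have "integrable (lborel \<Otimes>\<^sub>M lborel) (\<lambda>(x, t). (norm (tconv T p (\<lambda>s. F s x) t))\<^sup>2)"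
  proof (rule lborel_pair.Fubini_integrable)
    show "(\<lambda>(x, t). (norm (tconv T p (\<lambda>s. F s x) t))\<^sup>2) \<in> borel_measurable ((lborel :: 'a measure) \<Otimes>\<^sub>M (lborel :: real measure))"
      by measurable
    show "AE x in lborel. integrable lborel (\<lambda>t. case (x, t) of (x, t) \<Rightarrow> (norm (tconv T p (\<lambda>s. F s x) t))\<^sup>2)"
      using L2_cyl_slice(1)[OF F] by eventually_elim (use L2_suppD(2)[OF tconv_L2(1)[OF p]] in auto)
    show "integrable lborel (\<lambda>x. LINT t|lborel. norm (case (x, t) of (x, t) \<Rightarrow> (norm (tconv T p (\<lambda>s. F s x) t))\<^sup>2))"
    proof (rule Bochner_Integration.integrable_bound)
      show "integrable lborel (\<lambda>x. ((LINT s|lborel. \<bar>p s\<bar>) + 1) * (LINT s|lborel. \<bar>p s\<bar>) * (LINT t|lborel. (norm (F t x))\<^sup>2))"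
        using L2_cyl_slice(2)[OF F] by simp
      show "AE x in lborel. norm (LINT t|lborel. norm (case (x, t) of (x, t) \<Rightarrow> (norm (tconv T p (\<lambda>s. F s x) t))\<^sup>2))
          \<le> norm (((LINT s|lborel. \<bar>p s\<bar>) + 1) * (LINT s|lborel. \<bar>p s\<bar>) * (LINT t|lborel. (norm (F t x))\<^sup>2))"
        using L2_cyl_slice(1)[OF F]
      proof eventually_elim
        case (elim x)
        show ?case using order_trans[OF tconv_L2(2)[OF p elim] abs_ge_self] by simp
      qed
    qed measurable
  qed
  from lborel_pair.integrable_product_swap[OF this]
  show "integrable (lborel \<Otimes>\<^sub>M lborel) (\<lambda>(t, x). (norm (tconv T p (\<lambda>s. F s x) t))\<^sup>2)"
    by (simp add: case_prod_unfold)
qed (simp add: tconv_def)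

text \<open>  The triple integral over two times and the space variable converges absolutely, by the bound on the
  pairing for almost every \<open>x\<close>. So the space integral can be moved inside or outside.\<close>

lemma L2_cyl_pairing:
  fixes F G :: "real \<Rightarrow> 'a::euclidean_space \<Rightarrow> 'b::euclidean_space"
  assumes p: "integrable lborel p" and F: "L2_cyl T F" and G: "L2_cyl T G"
  shows "integrable (lborel \<Otimes>\<^sub>M lborel) (\<lambda>(s, t). p (s - t) * (LINT x|lborel. F s x \<bullet> G t x))"
    and "integrable lborel (\<lambda>x. LINT s|lborel. F s x \<bullet> tconv T p (\<lambda>t. G t x) s)"
    and "(LINT s|lborel. LINT t|lborel. p (s - t) * (LINT x|lborel. F s x \<bullet> G t x)) =
      (LINT x|lborel. LINT s|lborel. F s x \<bullet> tconv T p (\<lambda>t. G t x) s)"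
proof -
  note [measurable] = L2_cyl_measurable[OF F] L2_cyl_measurable[OF G]
  have [measurable]: "p \<in> borel_measurable borel" using p by auto
  let ?f = "\<lambda>x z. p (fst z - snd z) * (F (fst z) x \<bullet> G (snd z) x)"
  have [measurable]: "(\<lambda>(x, z). ?f x z) \<in> borel_measurable (lborel \<Otimes>\<^sub>M (lborel \<Otimes>\<^sub>M lborel))"
    by measurable
  have zz: "(lborel \<Otimes>\<^sub>M lborel :: (real \<times> real) measure) = lborel" by (rule lborel_prod)
  have slice: "AE x in lborel. integrable lborel (?f x) \<and>
      (LINT z|lborel. ?f x z) = (LINT s|lborel. F s x \<bullet> tconv T p (\<lambda>t. G t x) s) \<and>
      (LINT z|lborel. norm (?f x z)) \<le> (LINT s|lborel. \<bar>p s\<bar>) *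
        ((LINT s|lborel. (norm (F s x))\<^sup>2) + (LINT s|lborel. (norm (G s x))\<^sup>2)) / 2"
    using L2_cyl_slice(1)[OF F] L2_cyl_slice(1)[OF G]
  proof eventually_elim
    case (elim x)
    note P = tconv_pairing[OF p elim]
    have i: "integrable (lborel \<Otimes>\<^sub>M lborel) (?f x)" using P(1) by (simp add: case_prod_unfold)
    have i': "integrable (lborel \<Otimes>\<^sub>M lborel) (\<lambda>(t, s). \<bar>p (t - s) * (F t x \<bullet> G s x)\<bar>)"
      using integrable_norm[OF P(1)] by (simp add: case_prod_unfold)
    have "(LINT z|(lborel \<Otimes>\<^sub>M lborel). ?f x z) = (LINT s|lborel. F s x \<bullet> tconv T p (\<lambda>t. G t x) s)"
      using lborel_pair.integral_fst[OF P(1)] P(3) by (simp add: case_prod_unfold)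
    moreover have "(LINT z|(lborel \<Otimes>\<^sub>M lborel). norm (?f x z)) \<le> (LINT s|lborel. \<bar>p s\<bar>) *
        ((LINT s|lborel. (norm (F s x))\<^sup>2) + (LINT s|lborel. (norm (G s x))\<^sup>2)) / 2"
      using lborel_pair.integral_fst[OF i'] P(4) by (simp add: case_prod_unfold)
    ultimately show ?case using i unfolding zz by simp
  qed
  have int: "integrable (lborel \<Otimes>\<^sub>M lborel) (\<lambda>(x, z). ?f x z)"
  proof (rule lborel_pair.Fubini_integrable)
    show "(\<lambda>(x, z). ?f x z) \<in> borel_measurable (lborel \<Otimes>\<^sub>M lborel)" unfolding zz[symmetric] by measurable
    have [measurable]: "(\<lambda>(x, z). ?f x z) \<in> borel_measurable (borel \<Otimes>\<^sub>M borel)"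
      using \<open>(\<lambda>(x, z). ?f x z) \<in> borel_measurable (lborel \<Otimes>\<^sub>M lborel)\<close> by simp
    show "AE x in lborel. integrable lborel (\<lambda>z. case (x, z) of (x, z) \<Rightarrow> ?f x z)"
      using slice by eventually_elim simp
    show "integrable lborel (\<lambda>x. LINT z|lborel. norm (case (x, z) of (x, z) \<Rightarrow> ?f x z))"
    proof (rule Bochner_Integration.integrable_bound)
      show "integrable lborel (\<lambda>x. (LINT s|lborel. \<bar>p s\<bar>) *
        ((LINT s|lborel. (norm (F s x))\<^sup>2) + (LINT s|lborel. (norm (G s x))\<^sup>2)) / 2)"
        using L2_cyl_slice(2)[OF F] L2_cyl_slice(2)[OF G] by simp
      show "AE x in lborel. norm (LINT z|lborel. norm (case (x, z) of (x, z) \<Rightarrow> ?f x z)) \<le>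
          norm ((LINT s|lborel. \<bar>p s\<bar>) *
        ((LINT s|lborel. (norm (F s x))\<^sup>2) + (LINT s|lborel. (norm (G s x))\<^sup>2)) / 2)"
        using slice by eventually_elim (use order_trans[OF _ abs_ge_self] in simp)
    qed measurable
  qed
  have eq: "(LINT x|lborel. ?f x z) = p (fst z - snd z) * (LINT x|lborel. F (fst z) x \<bullet> G (snd z) x)" for z
    by simp
  have "integrable lborel (\<lambda>z. p (fst z - snd z) * (LINT x|lborel. F (fst z) x \<bullet> G (snd z) x))"
    using lborel_pair.integrable_snd[OF int] unfolding eq .
  then show i2: "integrable (lborel \<Otimes>\<^sub>M lborel) (\<lambda>(s, t). p (s - t) * (LINT x|lborel. F s x \<bullet> G t x))"
    unfolding zz by (simp add: case_prod_unfold)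
  have m: "(\<lambda>x. LINT s|lborel. F s x \<bullet> tconv T p (\<lambda>t. G t x) s) \<in> borel_measurable lborel"
    "(\<lambda>x. LINT z|lborel. ?f x z) \<in> borel_measurable lborel"
    using lborel_pair.integrable_fst[OF int] L2_cyl_measurable(2)[OF L2_cyl_tconv[OF p G]] by measurable
  show "integrable lborel (\<lambda>x. LINT s|lborel. F s x \<bullet> tconv T p (\<lambda>t. G t x) s)"
    by (rule integrable_cong_AE_imp[OF lborel_pair.integrable_fst[OF int] m(1)])
      (use slice in eventually_elim, simp)
  have "(LINT x|lborel. LINT s|lborel. F s x \<bullet> tconv T p (\<lambda>t. G t x) s) = (LINT x|lborel. LINT z|lborel. ?f x z)"
    by (rule integral_cong_AE[OF m]) (use slice in eventually_elim, simp)
  also have "\<dots> = (LINT z|lborel. LINT x|lborel. ?f x z)"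
    by (rule lborel_pair.Fubini_integral[OF int, symmetric])
  also have "\<dots> = (LINT z|(lborel \<Otimes>\<^sub>M lborel). (case z of (s, t) \<Rightarrow> p (s - t) * (LINT x|lborel. F s x \<bullet> G t x)))"
    unfolding eq zz by (simp add: case_prod_unfold)
  also have "\<dots> = (LINT s|lborel. LINT t|lborel. p (s - t) * (LINT x|lborel. F s x \<bullet> G t x))"
    by (rule lborel_pair.integral_fst[OF i2, symmetric])
  finally show "(LINT s|lborel. LINT t|lborel. p (s - t) * (LINT x|lborel. F s x \<bullet> G t x)) =
      (LINT x|lborel. LINT s|lborel. F s x \<bullet> tconv T p (\<lambda>t. G t x) s)" ..
qed

lemma L2_cyl_pairing_bound:
  fixes F G :: "real \<Rightarrow> 'a::euclidean_space \<Rightarrow> 'b::euclidean_space"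
  assumes p: "integrable lborel p" and p1: "(LINT s|lborel. \<bar>p s\<bar>) \<le> 1"
    and F: "L2_cyl T F" and G: "L2_cyl T G"
  shows "AE x in lborel. \<bar>LINT s|lborel. F s x \<bullet> tconv T p (\<lambda>t. G t x) s\<bar> \<le>
      ((LINT s|lborel. (norm (F s x))\<^sup>2) + (LINT s|lborel. (norm (G s x))\<^sup>2)) / 2"
    and "\<bar>LINT x|lborel. LINT s|lborel. F s x \<bullet> tconv T p (\<lambda>t. G t x) s\<bar> \<le>
      (LINT x|lborel. ((LINT s|lborel. (norm (F s x))\<^sup>2) + (LINT s|lborel. (norm (G s x))\<^sup>2)) / 2)"
proof -
  show ae: "AE x in lborel. \<bar>LINT s|lborel. F s x \<bullet> tconv T p (\<lambda>t. G t x) s\<bar> \<le>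
      ((LINT s|lborel. (norm (F s x))\<^sup>2) + (LINT s|lborel. (norm (G s x))\<^sup>2)) / 2"
    using L2_cyl_slice(1)[OF F] L2_cyl_slice(1)[OF G]
  proof eventually_elim
    case (elim x)
    let ?N = "(LINT s|lborel. (norm (F s x))\<^sup>2) + (LINT s|lborel. (norm (G s x))\<^sup>2)"
    have "0 \<le> ?N" by simp
    then have "(LINT s|lborel. \<bar>p s\<bar>) * ?N / 2 \<le> 1 * ?N / 2"
      using p1 by (intro divide_right_mono mult_right_mono) auto
    with tconv_pairing(5)[OF p elim] show ?case by simp
  qed
  have "\<bar>LINT x|lborel. LINT s|lborel. F s x \<bullet> tconv T p (\<lambda>t. G t x) s\<bar> \<le>
      (LINT x|lborel. \<bar>LINT s|lborel. F s x \<bullet> tconv T p (\<lambda>t. G t x) s\<bar>)"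
    by (rule integral_abs_bound)
  also have "\<dots> \<le> (LINT x|lborel. ((LINT s|lborel. (norm (F s x))\<^sup>2) + (LINT s|lborel. (norm (G s x))\<^sup>2)) / 2)"
    using L2_cyl_pairing(2)[OF p F G] L2_cyl_slice(2)[OF F] L2_cyl_slice(2)[OF G] ae
    by (intro integral_mono_AE) auto
  finally show "\<bar>LINT x|lborel. LINT s|lborel. F s x \<bullet> tconv T p (\<lambda>t. G t x) s\<bar> \<le>
      (LINT x|lborel. ((LINT s|lborel. (norm (F s x))\<^sup>2) + (LINT s|lborel. (norm (G s x))\<^sup>2)) / 2)" .
qed

section \<open>Testing with the solution itself\<close>

context regularized_kernel
begin

text \<open>  The time derivative of \<open>k\<^sub>n * v\<close>: since \<open>k\<^sub>n = n (1 - 1 * h\<^sub>n)\<close>, it is \<open>n (v - h\<^sub>n * v)\<close>.\<close>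

definition regularized_derivative :: "nat \<Rightarrow> (real \<Rightarrow> 'a \<Rightarrow> real) \<Rightarrow> real \<Rightarrow> 'a \<Rightarrow> real" where
  "regularized_derivative j v t x = Suc j * (v t x - tconv T (h j) (\<lambda>s. v s x) t)"

lemma regularized_derivative_L2_cyl:
  fixes v :: "real \<Rightarrow> 'a::euclidean_space \<Rightarrow> real"
  assumes v: "L2_cyl T v"
  shows "L2_cyl T (regularized_derivative j v)"
  using L2_cyl_scaleR[OF L2_cyl_diff[OF v L2_cyl_tconv[OF h_integrable v, of j]], of "Suc j"]
  unfolding regularized_derivative_def[abs_def] by simp

text \<open>  Convolution with \<open>l\<close> inverts the operator \<open>v \<mapsto> \<partial>\<^sub>t (k * v)\<close>, hence it maps the derivative of
  \<open>k\<^sub>n * v = h\<^sub>n * k * v\<close> to \<open>h\<^sub>n * v\<close>.\<close>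

lemma conv_l_regularized_derivative:
  fixes v :: "real \<Rightarrow> real"
  assumes v: "L2_supp T v"
  shows "AE t in lborel. tconv T l (\<lambda>t. Suc j * (v t - tconv T (h j) v t)) t = tconv T (h j) v t"
proof -
  note v1 = L2_supp_imp_L1_supp[OF v]
  have hv: "L1_supp T (tconv T (h j) v)" using L1_supp_tconv[OF h_integrable L1_suppD(1)[OF v1]] .
  show ?thesis
    using conv_l_conv_h[OF v1, of j] tconv_diff_right[OF l_integrable L1_suppD(1)[OF v1] L1_suppD(1)[OF hv], of T]
  proof eventually_elim
    case (elim t)
    then show ?case
      using tconv_scaleR_right[of T l "Suc j" "\<lambda>t. v t - tconv T (h j) v t" t] by simp
  qed
qed

text \<open>  The test function is \<open>w s\<close> for a fixed time \<open>s\<close>, so the inequality holds for almost every other time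
  \<open>t\<close>. Multiplication by \<open>l (s - t) \<ge> 0\<close> and integration over \<open>t\<close> and \<open>s\<close> produce convolutions with \<open>l\<close>.
  By the resolvent equation \<open>l * h j = l - h j / Suc j\<close>, so regularization changes the terms with \<open>W\<close>
  and \<open>f\<close> only by \<open>O (1 / j)\<close>.\<close>

lemma tested_inequality:
  fixes v w f :: "real \<Rightarrow> 'a::euclidean_space \<Rightarrow> real" and W :: "real \<Rightarrow> 'a \<Rightarrow> 'b::euclidean_space"
  assumes v: "L2_cyl T v" and w: "L2_cyl T w" and f: "L2_cyl T f" and W: "L2_cyl T W"
    and ineq: "AE s in lborel. s \<in> {0<..<T} \<longrightarrow> (AE t in lborel. t \<in> {0<..<T} \<longrightarrow>
      (LINT x|lborel. w s x * regularized_derivative j v t x + tconv T (h j) (\<lambda>r. W r x) t \<bullet> W s x) \<le>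
      (LINT x|lborel. tconv T (h j) (\<lambda>r. f r x) t * w s x))"
  shows "(LINT x|lborel. LINT s|lborel. w s x * tconv T (h j) (\<lambda>t. v t x) s) +
      ((LINT x|lborel. LINT s|lborel. W s x \<bullet> tconv T l (\<lambda>t. W t x) s) -
        (LINT x|lborel. LINT s|lborel. W s x \<bullet> tconv T (h j) (\<lambda>t. W t x) s) / Suc j) \<le>
      (LINT x|lborel. LINT s|lborel. w s x * tconv T l (\<lambda>t. f t x) s) -
        (LINT x|lborel. LINT s|lborel. w s x * tconv T (h j) (\<lambda>t. f t x) s) / Suc j"
proof -
  let ?Wh = "\<lambda>t x. tconv T (h j) (\<lambda>r. W r x) t" and ?fh = "\<lambda>t x. tconv T (h j) (\<lambda>r. f r x) t"
  note D = regularized_derivative_L2_cyl[OF v, of j]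
  have Wh: "L2_cyl T ?Wh" and fh: "L2_cyl T ?fh"
    using L2_cyl_tconv[OF h_integrable W] L2_cyl_tconv[OF h_integrable f] .
  define \<Phi>1 where "\<Phi>1 s t = (LINT x|lborel. w s x * regularized_derivative j v t x)" for s t
  define \<Phi>2 where "\<Phi>2 s t = (LINT x|lborel. W s x \<bullet> ?Wh t x)" for s t
  define \<Phi>3 where "\<Phi>3 s t = (LINT x|lborel. w s x * ?fh t x)" for s t
  note P1 = L2_cyl_pairing[OF l_integrable w D, unfolded inner_real_def, folded \<Phi>1_def]
  note P2 = L2_cyl_pairing[OF l_integrable W Wh, folded \<Phi>2_def]
  note P3 = L2_cyl_pairing[OF l_integrable w fh, unfolded inner_real_def, folded \<Phi>3_def]
  have le: "AE s in lborel. AE t in lborel. l (s - t) * \<Phi>1 s t + l (s - t) * \<Phi>2 s t \<le> l (s - t) * \<Phi>3 s t"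
    using ineq L2_cyl_slice(3)[OF w] L2_cyl_slice(3)[OF W]
  proof eventually_elim
    case (elim s)
    show ?case
    proof (cases "s \<in> {0<..<T}")
      case False
      then show ?thesis
        unfolding \<Phi>1_def \<Phi>2_def \<Phi>3_def by (simp add: L2_cyl_zero[OF w] L2_cyl_zero[OF W])
    next
      case True
      with elim have "AE t in lborel. t \<in> {0<..<T} \<longrightarrow>
          (LINT x|lborel. w s x * regularized_derivative j v t x + ?Wh t x \<bullet> W s x) \<le> (LINT x|lborel. ?fh t x * w s x)" by simp
      with L2_cyl_slice(3)[OF D] L2_cyl_slice(3)[OF Wh] show ?thesis
      proof eventually_elim
        case el: (elim t)
        show ?case
        proof (cases "t \<in> {0<..<T}")
          case False
          then show ?thesis
            unfolding \<Phi>1_def \<Phi>2_def \<Phi>3_def by (simp add: L2_cyl_zero[OF D] tconv_def)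
        next
          case True
          have i1: "integrable lborel (\<lambda>x. w s x * regularized_derivative j v t x)"
            using integrable_inner_of_squares[of "w s" lborel "regularized_derivative j v t"] L2_cyl_slice(5)[OF w] L2_cyl_slice(5)[OF D]
              elim(2) el(1) by simp
          have i2: "integrable lborel (\<lambda>x. W s x \<bullet> ?Wh t x)"
            using integrable_inner_of_squares[of "W s" lborel "?Wh t"] L2_cyl_slice(5)[OF W] L2_cyl_slice(5)[OF Wh]
              elim(3) el(2) by simp
          have "\<Phi>1 s t + \<Phi>2 s t \<le> \<Phi>3 s t"
            using el(3) True i1 i2 unfolding \<Phi>1_def \<Phi>2_def \<Phi>3_def
            by (simp add: inner_commute mult.commute)
          from mult_left_mono[OF this l_nonneg[of "s - t"]] show ?thesis by (simp add: distrib_left)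
        qed
      qed
    qed
  qed
  note i12 = Bochner_Integration.integrable_add[OF P1(1) P2(1)]
  have i12': "integrable (lborel \<Otimes>\<^sub>M lborel) (\<lambda>(s, t). l (s - t) * \<Phi>1 s t + l (s - t) * \<Phi>2 s t)"
    using i12 by (simp add: case_prod_unfold)
  have "(LINT s|lborel. LINT t|lborel. l (s - t) * \<Phi>1 s t + l (s - t) * \<Phi>2 s t) \<le>
      (LINT s|lborel. LINT t|lborel. l (s - t) * \<Phi>3 s t)"
  proof (rule integral_mono_AE)
    show "integrable lborel (\<lambda>s. LINT t|lborel. l (s - t) * \<Phi>1 s t + l (s - t) * \<Phi>2 s t)"
      using lborel_pair.integrable_fst[OF i12'] .
    show "integrable lborel (\<lambda>s. LINT t|lborel. l (s - t) * \<Phi>3 s t)"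
      using lborel_pair.integrable_fst[OF P3(1)] .
    show "AE s in lborel. (LINT t|lborel. l (s - t) * \<Phi>1 s t + l (s - t) * \<Phi>2 s t) \<le> (LINT t|lborel. l (s - t) * \<Phi>3 s t)"
      using le lborel_pair.AE_integrable_fst[OF i12'] lborel_pair.AE_integrable_fst[OF P3(1)]
      by eventually_elim (rule integral_mono_AE)
  qed
  also have "(LINT s|lborel. LINT t|lborel. l (s - t) * \<Phi>1 s t + l (s - t) * \<Phi>2 s t) =
      (LINT s|lborel. LINT t|lborel. l (s - t) * \<Phi>1 s t) + (LINT s|lborel. LINT t|lborel. l (s - t) * \<Phi>2 s t)"
    unfolding lborel_pair.integral_fst[OF i12'] lborel_pair.integral_fst[OF P1(1)] lborel_pair.integral_fst[OF P2(1)]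
    using Bochner_Integration.integral_add[OF P1(1) P2(1)] by (simp add: case_prod_unfold)
  finally have main: "(LINT x|lborel. LINT s|lborel. w s x * tconv T l (\<lambda>t. regularized_derivative j v t x) s) +
      (LINT x|lborel. LINT s|lborel. W s x \<bullet> tconv T l (\<lambda>t. ?Wh t x) s) \<le>
      (LINT x|lborel. LINT s|lborel. w s x * tconv T l (\<lambda>t. ?fh t x) s)"
    unfolding P1(3) P2(3) P3(3) .
  note Q1 = L2_cyl_pairing(2)[OF h_integrable w v, unfolded inner_real_def]
  have e1: "(LINT x|lborel. LINT s|lborel. w s x * tconv T l (\<lambda>t. regularized_derivative j v t x) s) =
      (LINT x|lborel. LINT s|lborel. w s x * tconv T (h j) (\<lambda>t. v t x) s)"
  proof (rule integral_cong_AE)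
    show "AE x in lborel. (LINT s|lborel. w s x * tconv T l (\<lambda>t. regularized_derivative j v t x) s) =
        (LINT s|lborel. w s x * tconv T (h j) (\<lambda>t. v t x) s)"
      using L2_cyl_slice(1)[OF v]
    proof eventually_elim
      case (elim x)
      have [measurable]: "(\<lambda>s. w s x) \<in> borel_measurable borel" "tconv T l (\<lambda>t. regularized_derivative j v t x) \<in> borel_measurable borel"
        "tconv T (h j) (\<lambda>t. v t x) \<in> borel_measurable borel"
        using L2_cyl_slice(4)[OF w] L2_cyl_slice(4)[OF L2_cyl_tconv[OF l_integrable D]]
          L2_cyl_slice(4)[OF L2_cyl_tconv[OF h_integrable v]] by auto
      have "AE t in lborel. tconv T l (\<lambda>t. regularized_derivative j v t x) t = tconv T (h j) (\<lambda>t. v t x) t"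
        using conv_l_regularized_derivative[OF elim, of j] unfolding regularized_derivative_def .
      then show ?case
        by (intro integral_cong_AE) auto
    qed
  qed (use P1(2) Q1 in auto)
  note Q2 = L2_cyl_pairing(2)[OF l_integrable W W] L2_cyl_pairing(2)[OF h_integrable W W, of j]
  have split: "AE x in lborel. (LINT s|lborel. F s x \<bullet> tconv T l (\<lambda>t. tconv T (h j) (\<lambda>r. G r x) t) s) =
      (LINT s|lborel. F s x \<bullet> tconv T l (\<lambda>t. G t x) s) - (LINT s|lborel. F s x \<bullet> tconv T (h j) (\<lambda>t. G t x) s) / Suc j"
    if F: "L2_cyl T F" and G: "L2_cyl T G" for F G :: "real \<Rightarrow> 'a \<Rightarrow> 'c::euclidean_space"
    using L2_cyl_slice(1)[OF F] L2_cyl_slice(1)[OF G]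
  proof eventually_elim
    case (elim x)
    have [measurable]: "(\<lambda>s. F s x) \<in> borel_measurable borel" "tconv T l (\<lambda>t. G t x) \<in> borel_measurable borel"
        "tconv T (h j) (\<lambda>t. G t x) \<in> borel_measurable borel"
        "tconv T l (tconv T (h j) (\<lambda>t. G t x)) \<in> borel_measurable borel"
      using L2_cyl_slice(4)[OF F] L2_cyl_slice(4)[OF L2_cyl_tconv[OF l_integrable G]]
        L2_cyl_slice(4)[OF L2_cyl_tconv[OF h_integrable G]]
        L2_cyl_slice(4)[OF L2_cyl_tconv[OF l_integrable L2_cyl_tconv[OF h_integrable G]]] by auto
    have "(LINT s|lborel. F s x \<bullet> tconv T l (tconv T (h j) (\<lambda>r. G r x)) s) =
        (LINT s|lborel. F s x \<bullet> tconv T l (\<lambda>t. G t x) s - (F s x \<bullet> tconv T (h j) (\<lambda>t. G t x) s) / Suc j)"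
      by (rule integral_cong_AE)
        (use conv_l_conv_h[OF L2_supp_imp_L1_supp[OF elim(2)], of j] in \<open>auto simp: inner_diff_right elim!: AE_mp\<close>)
    then show ?case
      using tconv_pairing(2)[OF l_integrable elim] tconv_pairing(2)[OF h_integrable elim] by simp
  qed
  have e2: "(LINT x|lborel. LINT s|lborel. W s x \<bullet> tconv T l (\<lambda>t. ?Wh t x) s) =
      (LINT x|lborel. LINT s|lborel. W s x \<bullet> tconv T l (\<lambda>t. W t x) s) -
        (LINT x|lborel. LINT s|lborel. W s x \<bullet> tconv T (h j) (\<lambda>t. W t x) s) / Suc j"
  proof -
    have "(LINT x|lborel. LINT s|lborel. W s x \<bullet> tconv T l (\<lambda>t. ?Wh t x) s) =
      (LINT x|lborel. (LINT s|lborel. W s x \<bullet> tconv T l (\<lambda>t. W t x) s) -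
        (LINT s|lborel. W s x \<bullet> tconv T (h j) (\<lambda>t. W t x) s) / Suc j)"
      by (rule integral_cong_AE) (use split[OF W W] P2(2) Q2 in auto)
    then show ?thesis using Q2 by simp
  qed
  note Q3 = L2_cyl_pairing(2)[OF l_integrable w f] L2_cyl_pairing(2)[OF h_integrable w f, of j]
  have e3: "(LINT x|lborel. LINT s|lborel. w s x * tconv T l (\<lambda>t. ?fh t x) s) =
      (LINT x|lborel. LINT s|lborel. w s x * tconv T l (\<lambda>t. f t x) s) -
        (LINT x|lborel. LINT s|lborel. w s x * tconv T (h j) (\<lambda>t. f t x) s) / Suc j"
  proof -
    have "(LINT x|lborel. LINT s|lborel. w s x * tconv T l (\<lambda>t. ?fh t x) s) =
      (LINT x|lborel. (LINT s|lborel. w s x * tconv T l (\<lambda>t. f t x) s) -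
        (LINT s|lborel. w s x * tconv T (h j) (\<lambda>t. f t x) s) / Suc j)"
      by (rule integral_cong_AE) (use split[OF w f] P3(2) Q3 in auto)
    then show ?thesis using Q3 by simp
  qed
  show ?thesis using main unfolding e1 e2 e3 .
qed

text \<open>  Only the first term needs the weak convergence of \<open>h j * v\<close>; it is applied for almost every \<open>x\<close> and
  integrated by dominated convergence.\<close>

lemma limit_inequality:
  fixes v w f :: "real \<Rightarrow> 'a::euclidean_space \<Rightarrow> real" and W :: "real \<Rightarrow> 'a \<Rightarrow> 'b::euclidean_space"
  assumes v: "L2_cyl T v" and w: "L2_cyl T w" and f: "L2_cyl T f" and W: "L2_cyl T W"
    and ineq: "\<And>j. AE s in lborel. s \<in> {0<..<T} \<longrightarrow> (AE t in lborel. t \<in> {0<..<T} \<longrightarrow>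
      (LINT x|lborel. w s x * regularized_derivative j v t x + tconv T (h j) (\<lambda>r. W r x) t \<bullet> W s x) \<le>
      (LINT x|lborel. tconv T (h j) (\<lambda>r. f r x) t * w s x))"
  shows "(LINT x|lborel. LINT s|lborel. w s x * v s x) +
      (LINT x|lborel. LINT s|lborel. W s x \<bullet> tconv T l (\<lambda>t. W t x) s) \<le>
      (LINT x|lborel. LINT s|lborel. w s x * tconv T l (\<lambda>t. f t x) s)"
proof -
  define P where "P j = (LINT x|lborel. LINT s|lborel. w s x * tconv T (h j) (\<lambda>t. v t x) s)" for j
  define A where "A = (LINT x|lborel. LINT s|lborel. W s x \<bullet> tconv T l (\<lambda>t. W t x) s)"
  define B where "B = (LINT x|lborel. LINT s|lborel. w s x * tconv T l (\<lambda>t. f t x) s)"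
  define E where "E j = (LINT x|lborel. LINT s|lborel. W s x \<bullet> tconv T (h j) (\<lambda>t. W t x) s)" for j
  define F where "F j = (LINT x|lborel. LINT s|lborel. w s x * tconv T (h j) (\<lambda>t. f t x) s)" for j
  have P: "P \<longlonglongrightarrow> (LINT x|lborel. LINT s|lborel. w s x * v s x)"
    unfolding P_def[abs_def]
  proof (rule integral_dominated_convergence)
    note pair = L2_cyl_pairing(2)[OF h_integrable w v, unfolded inner_real_def]
    show "(\<lambda>x. LINT s|lborel. w s x * tconv T (h j) (\<lambda>t. v t x) s) \<in> borel_measurable lborel" for j
      using pair[of j] by auto
    show "(\<lambda>x. LINT s|lborel. w s x * v s x) \<in> borel_measurable lborel"
      using lborel_pair.integrable_snd[OF L2_cyl_inner[OF w v]] by auto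
    show "integrable lborel (\<lambda>x. ((LINT s|lborel. (norm (w s x))\<^sup>2) + (LINT s|lborel. (norm (v s x))\<^sup>2)) / 2)"
      using L2_cyl_slice(2)[OF w] L2_cyl_slice(2)[OF v] by simp
    show "AE x in lborel. norm (LINT s|lborel. w s x * tconv T (h j) (\<lambda>t. v t x) s) \<le>
        ((LINT s|lborel. (norm (w s x))\<^sup>2) + (LINT s|lborel. (norm (v s x))\<^sup>2)) / 2" for j
      using L2_cyl_pairing_bound(1)[OF h_integrable h_norm w v, of j] by simp
    show "AE x in lborel. (\<lambda>j. LINT s|lborel. w s x * tconv T (h j) (\<lambda>t. v t x) s) \<longlonglongrightarrow> (LINT s|lborel. w s x * v s x)"
      using L2_cyl_slice(1)[OF w] L2_cyl_slice(1)[OF v]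
    proof eventually_elim
      case (elim x)
      then show ?case using conv_defect_tendsto[OF approximate_identity_h elim] by simp
    qed
  qed
  have null: "(\<lambda>j. X j / Suc j) \<longlonglongrightarrow> 0" if X: "\<And>j. \<bar>X j\<bar> \<le> C" for X :: "nat \<Rightarrow> real" and C
  proof (rule Lim_null_comparison)
    show "\<forall>\<^sub>F j in sequentially. norm (X j / Suc j) \<le> C / Suc j"
      using X by (auto intro!: always_eventually divide_right_mono)
    show "(\<lambda>j. C / Suc j) \<longlonglongrightarrow> 0" by (rule LIMSEQ_Suc[OF lim_const_over_n])
  qed
  have E: "(\<lambda>j. E j / Suc j) \<longlonglongrightarrow> 0"
    unfolding E_def by (rule null[OF L2_cyl_pairing_bound(2)[OF h_integrable h_norm W W]])
  have F: "(\<lambda>j. F j / Suc j) \<longlonglongrightarrow> 0"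
    using null[OF L2_cyl_pairing_bound(2)[OF h_integrable h_norm w f]] unfolding F_def by simp
  have "(LINT x|lborel. LINT s|lborel. w s x * v s x) + (A - 0) \<le> B - 0"
  proof (rule LIMSEQ_le)
    show "(\<lambda>j. P j + (A - E j / Suc j)) \<longlonglongrightarrow> (LINT x|lborel. LINT s|lborel. w s x * v s x) + (A - 0)"
      by (intro tendsto_add tendsto_diff P E tendsto_const)
    show "(\<lambda>j. B - F j / Suc j) \<longlonglongrightarrow> B - 0" by (intro tendsto_diff F tendsto_const)
    show "\<exists>N. \<forall>j\<ge>N. P j + (A - E j / Suc j) \<le> B - F j / Suc j"
      using tested_inequality[OF v w f W ineq] unfolding P_def A_def B_def E_def F_def by blast
  qed
  then show ?thesis unfolding A_def B_def by simp
qed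

lemma gradient_energy:
  fixes W :: "real \<Rightarrow> 'a::euclidean_space \<Rightarrow> 'b::euclidean_space"
  assumes W: "L2_cyl T W"
  shows "integrable (lborel \<Otimes>\<^sub>M lborel) (\<lambda>(t, x). (k (T - t) + k t) * (norm (tbconv T l (\<lambda>s. W s x) t))\<^sup>2)"
    and "(LINT t|lborel. LINT x|lborel. (k (T - t) + k t) * (norm (tbconv T l (\<lambda>s. W s x) t))\<^sup>2) / 2 \<le>
      (LINT x|lborel. LINT s|lborel. W s x \<bullet> tconv T l (\<lambda>t. W t x) s)"
proof -
  note [measurable] = L2_cyl_measurable[OF W]
  let ?e = "\<lambda>t x. (k (T - t) + k t) * (norm (tbconv T l (\<lambda>s. W s x) t))\<^sup>2"
  let ?p = "\<lambda>x. LINT s|lborel. W s x \<bullet> tconv T l (\<lambda>t. W t x) s"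
  have m: "(\<lambda>(x, t). ?e t x) \<in> borel_measurable ((lborel :: 'a measure) \<Otimes>\<^sub>M (lborel :: real measure))"
  proof -
    have "(\<lambda>z. unit_step T (snd z) *\<^sub>R (LINT s|lborel. l (s - snd z) *\<^sub>R W s (fst z)))
        \<in> borel_measurable ((borel :: 'a measure) \<Otimes>\<^sub>M (borel :: real measure))"
      by measurable
    then have [measurable]: "(\<lambda>z. tbconv T l (\<lambda>s. W s (fst z)) (snd z)) \<in> borel_measurable ((borel :: 'a measure) \<Otimes>\<^sub>M (borel :: real measure))"
      by (simp add: tbconv_def)
    have "(\<lambda>z. ?e (snd z) (fst z)) \<in> borel_measurable ((borel :: 'a measure) \<Otimes>\<^sub>M (borel :: real measure))"
      by measurable
    then show ?thesis by (simp add: case_prod_unfold)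
  qed
  have e0: "0 \<le> ?e t x" for t x using k_nonneg[of "T - t"] k_nonneg[of t] by simp
  have ip: "integrable lborel ?p" using L2_cyl_pairing(2)[OF l_integrable W W] .
  have le: "AE x in lborel. integrable lborel (\<lambda>t. ?e t x) \<and> (LINT t|lborel. ?e t x) \<le> 2 * ?p x"
    using L2_cyl_slice(1)[OF W]
  proof eventually_elim
    case (elim x)
    show ?case using backward_energy_inequality[OF elim] by simp
  qed
  have i: "integrable (lborel \<Otimes>\<^sub>M lborel) (\<lambda>(x, t). ?e t x)"
  proof (rule lborel_pair.Fubini_integrable[OF m])
    show "AE x in lborel. integrable lborel (\<lambda>t. case (x, t) of (x, t) \<Rightarrow> ?e t x)"
      using le by eventually_elim simp
    have [measurable]: "(\<lambda>x. LINT t|lborel. ?e t x) \<in> borel_measurable lborel"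
      using lborel.borel_measurable_lebesgue_integral[OF m] by simp
    have "integrable lborel (\<lambda>x. LINT t|lborel. ?e t x)"
    proof (rule Bochner_Integration.integrable_bound)
      show "integrable lborel (\<lambda>x. 2 * ?p x)" using ip by simp
      show "AE x in lborel. norm (LINT t|lborel. ?e t x) \<le> norm (2 * ?p x)"
        using le
      proof eventually_elim
        case (elim x)
        have "0 \<le> (LINT t|lborel. ?e t x)" using e0 by simp
        then show ?case using elim by simp
      qed
    qed measurable
    then show "integrable lborel (\<lambda>x. LINT t|lborel. norm (case (x, t) of (x, t) \<Rightarrow> ?e t x))"
      using k_nonneg by (simp add: abs_mult add_nonneg_nonneg)
  qed
  from lborel_pair.integrable_product_swap[OF this]
  show "integrable (lborel \<Otimes>\<^sub>M lborel) (\<lambda>(t, x). ?e t x)" by (simp add: case_prod_unfold)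
  have "(LINT t|lborel. LINT x|lborel. ?e t x) = (LINT x|lborel. LINT t|lborel. ?e t x)"
    using lborel_pair.Fubini_integral[OF i] .
  also have "\<dots> \<le> (LINT x|lborel. 2 * ?p x)"
    using lborel_pair.integrable_fst[OF i] ip le by (intro integral_mono_AE) auto
  finally show "(LINT t|lborel. LINT x|lborel. ?e t x) / 2 \<le> (LINT x|lborel. ?p x)" by simp
qed

end

section \<open>The weak time derivative of the regularized convolution\<close>

lemma conv_eq_tconv:
  fixes v :: "real \<Rightarrow> 'b::euclidean_space"
  assumes "t \<in> {0<..<T}"
  shows "conv p v t = tconv T (\<lambda>s. unit_step T s * p s) (\<lambda>s. unit_step T s *\<^sub>R v s) t"
proof -
  have "(LINT s|lborel. indicator {0<..<t} s *\<^sub>R p (t - s) *\<^sub>R v s) =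
      (LINT s|lborel. (unit_step T (t - s) * p (t - s)) *\<^sub>R unit_step T s *\<^sub>R v s)"
    using assms by (intro Bochner_Integration.integral_cong refl) (auto split: split_indicator)
  then show ?thesis using assms by (simp add: conv_def tconv_def set_lebesgue_integral_def)
qed

lemma bconv_eq_tbconv:
  fixes v :: "real \<Rightarrow> 'b::euclidean_space"
  assumes "t \<in> {0<..<T}"
  shows "bconv T p v t = tbconv T (\<lambda>s. unit_step T s * p s) (\<lambda>s. unit_step T s *\<^sub>R v s) t"
proof -
  have "(LINT s|lborel. indicator {t<..<T} s *\<^sub>R p (s - t) *\<^sub>R v s) =
      (LINT s|lborel. (unit_step T (s - t) * p (s - t)) *\<^sub>R unit_step T s *\<^sub>R v s)"
    using assms by (intro Bochner_Integration.integral_cong refl) (auto split: split_indicator)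
  then show ?thesis using assms by (simp add: bconv_def tbconv_def set_lebesgue_integral_def)
qed

lemma tbconv_cong_AE:
  assumes "AE t in lborel. p t = p' t"
    and "p \<in> borel_measurable borel" "p' \<in> borel_measurable borel" "v \<in> borel_measurable borel"
  shows "tbconv T p v t = tbconv T p' v t"
proof -
  have [measurable]: "v \<in> borel_measurable borel" by fact
  have "reflect T v \<in> borel_measurable borel" unfolding reflect_def[abs_def] by measurable
  then show ?thesis
    unfolding tbconv_eq_reflect using assms by (intro tconv_cong_AE) auto
qed

lemma L1_loc_imp_L1_supp:
  assumes "L1_loc p" "0 < T"
  shows "L1_supp T (\<lambda>s. unit_step T s * p s)"
proof -
  have "set_integrable lborel {0..T} p" using assms unfolding L1_loc_def by auto
  then have "set_integrable lborel {0<..<T} p" by (rule set_integrable_subset) auto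
  then show ?thesis unfolding L1_supp_def set_integrable_def by auto
qed

lemma L2_on_imp_L2_cyl:
  fixes F :: "real \<Rightarrow> 'a::euclidean_space \<Rightarrow> 'b::euclidean_space"
  assumes "L2_on ({0<..<T} \<times> \<Omega>) (\<lambda>(t, x). F t x)"
  shows "L2_cyl T (\<lambda>t x. indicator ({0<..<T} \<times> \<Omega>) (t, x) *\<^sub>R F t x)"
proof -
  let ?S = "{0<..<T} \<times> \<Omega>"
  have m: "(\<lambda>z. indicator ?S z *\<^sub>R (case z of (t, x) \<Rightarrow> F t x)) \<in> borel_measurable borel"
    and i: "integrable lborel (\<lambda>z. indicator ?S z *\<^sub>R (norm (case z of (t, x) \<Rightarrow> F t x))\<^sup>2)"
    using assms unfolding L2_on_def set_borel_measurable_def set_integrable_def by auto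
  have 1: "(\<lambda>z. indicator ?S z *\<^sub>R (case z of (t, x) \<Rightarrow> F t x)) = (\<lambda>(t, x). indicator ?S (t, x) *\<^sub>R F t x)"
    by auto
  have 2: "(\<lambda>z. indicator ?S z *\<^sub>R (norm (case z of (t, x) \<Rightarrow> F t x))\<^sup>2) =
      (\<lambda>(t, x). (norm (indicator ?S (t, x) *\<^sub>R F t x))\<^sup>2)"
    by (auto split: split_indicator)
  show ?thesis using m i unfolding L2_cyl_def 1 2 by (auto split: split_indicator)
qed

lemma L2_cyl_imp_L2_on:
  fixes F :: "real \<Rightarrow> 'a::euclidean_space \<Rightarrow> 'b::euclidean_space"
  assumes F: "L2_cyl T F" and S [measurable]: "{0<..<T} \<times> \<Omega> \<in> sets borel"
  shows "L2_on ({0<..<T} \<times> \<Omega>) (\<lambda>(t, x). F t x)"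
proof -
  have [measurable]: "(\<lambda>(t, x). F t x) \<in> borel_measurable borel" and i: "integrable lborel (\<lambda>(t, x). (norm (F t x))\<^sup>2)"
    using F unfolding L2_cyl_def by auto
  have "(\<lambda>z. indicator ({0<..<T} \<times> \<Omega>) z *\<^sub>R (case z of (t, x) \<Rightarrow> F t x)) \<in> borel_measurable borel"
    by measurable
  then show ?thesis
    unfolding L2_on_def set_borel_measurable_def set_integrable_def
    using integrable_mult_indicator[OF _ i, of "{0<..<T} \<times> \<Omega>"] by (simp add: case_prod_unfold)
qed

lemma L2_cyl_constant:
  fixes u0 :: "'a::euclidean_space \<Rightarrow> real"
  assumes "L2_on \<Omega> u0"
  shows "L2_cyl T (\<lambda>t x. unit_step T t * (indicator \<Omega> x * u0 x))"
proof -
  let ?u = "\<lambda>x. indicator \<Omega> x * u0 x"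
  have m [measurable]: "?u \<in> borel_measurable borel"
    and i: "integrable lborel (\<lambda>x. (?u x)\<^sup>2)"
  proof -
    show "?u \<in> borel_measurable borel" using assms unfolding L2_on_def set_borel_measurable_def by simp
    have "(\<lambda>x. indicator \<Omega> x *\<^sub>R (norm (u0 x))\<^sup>2) = (\<lambda>x. (?u x)\<^sup>2)" by (auto split: split_indicator)
    then show "integrable lborel (\<lambda>x. (?u x)\<^sup>2)" using assms unfolding L2_on_def set_integrable_def by simp
  qed
  have eq: "(\<lambda>(t, x). (norm (unit_step T t * ?u x))\<^sup>2) = (\<lambda>(t, x). unit_step T t * (?u x)\<^sup>2)"
    by (auto split: split_indicator)
  show ?thesis
  proof (rule L2_cylI)
    show "(\<lambda>(t, x). unit_step T t * ?u x) \<in> borel_measurable (borel \<Otimes>\<^sub>M borel)" by measurable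
    show "integrable (lborel \<Otimes>\<^sub>M lborel) (\<lambda>(t, x). (norm (unit_step T t * ?u x))\<^sup>2)"
      unfolding eq
    proof (rule lborel_pair.Fubini_integrable)
      show "(\<lambda>(t, x). unit_step T t * (?u x)\<^sup>2) \<in> borel_measurable (lborel \<Otimes>\<^sub>M lborel)" by measurable
      show "integrable lborel (\<lambda>t. LINT x|lborel. norm (case (t, x) of (t, x) \<Rightarrow> unit_step T t * (?u x)\<^sup>2))"
        using L1_suppD(1)[OF L1_supp_unit_step[of T]] by (simp add: abs_mult)
      show "AE t in lborel. integrable lborel (\<lambda>x. case (t, x) of (t, x) \<Rightarrow> unit_step T t * (?u x)\<^sup>2)"
        using i by simp
    qed
  qed simp
qed

lemma test_function_real:
  fixes \<eta> :: "real \<Rightarrow> real"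
  assumes "test_function A \<eta>"
  shows "(\<eta> has_real_derivative deriv \<eta> x) (at x)" "continuous_on UNIV (deriv \<eta>)"
    "x \<notin> A \<Longrightarrow> \<eta> x = 0"
proof -
  have "C_k 1 \<eta>" and sub: "closure {x. \<eta> x \<noteq> 0} \<subseteq> A" using assms unfolding test_function_def by auto
  then have diff: "\<And>x. \<eta> differentiable at x"
    and cont: "continuous_on UNIV (\<lambda>x. frechet_derivative \<eta> (at x) 1)" by auto
  show d: "(\<eta> has_real_derivative deriv \<eta> x) (at x)" for x
    using diff[of x] DERIV_deriv_iff_real_differentiable by blast
  have "frechet_derivative \<eta> (at x) = (*) (deriv \<eta> x)" for x
    using frechet_derivative_at[OF d[of x, unfolded has_field_derivative_def]] by simp
  then show "continuous_on UNIV (deriv \<eta>)" using cont by simp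
  show "x \<notin> A \<Longrightarrow> \<eta> x = 0" using sub closure_subset[of "{x. \<eta> x \<noteq> 0}"] by auto
qed

text \<open>  Fubini and the fundamental theorem of calculus for \<open>\<eta>\<close>, which vanishes at \<open>T\<close>.\<close>

lemma integration_by_parts_primitive:
  fixes d \<eta> :: "real \<Rightarrow> real"
  assumes T: "0 < T" and \<eta>: "test_function {0<..<T} \<eta>" and d: "L2_supp T d"
  shows "(LINT t|lborel. unit_step T t * (deriv \<eta> t * tconv T (unit_step T) d t)) =
    - (LINT t|lborel. \<eta> t * d t)"
proof -
  note \<eta>' = test_function_real[OF \<eta>]
  have [measurable]: "deriv \<eta> \<in> borel_measurable borel"
    using \<eta>'(2) by (rule borel_measurable_continuous_onI)
  define \<phi> where "\<phi> t = unit_step T t * deriv \<eta> t" for t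
  have "bounded (deriv \<eta> ` {0..T})"
    by (intro compact_imp_bounded compact_continuous_image continuous_on_subset[OF \<eta>'(2)]) auto
  then obtain M where "\<forall>y\<in>deriv \<eta> ` {0..T}. norm y \<le> M"
    unfolding bounded_iff by blast
  then have M: "norm (deriv \<eta> t) \<le> M" if "t \<in> {0..T}" for t using that by blast
  have M0: "0 \<le> M" using order_trans[OF norm_ge_zero M[of 0]] T by simp
  have \<phi>b: "norm (\<phi> t) \<le> M" for t using M[of t] M0 unfolding \<phi>_def by (auto split: split_indicator)
  have "integrable lborel \<phi>"
  proof (rule Bochner_Integration.integrable_bound)
    show "integrable lborel (\<lambda>t. M * unit_step T t)" using L1_suppD(1)[OF L1_supp_unit_step] by simp
    show "AE t in lborel. norm (\<phi> t) \<le> norm (M * unit_step T t)"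
    proof (rule AE_I2)
      fix t
      show "norm (\<phi> t) \<le> norm (M * unit_step T t)"
        using \<phi>b[of t] M0 by (cases "t \<in> {0<..<T}") (auto simp: \<phi>_def)
    qed
  qed (simp add: \<phi>_def[abs_def])
  then have "L1_supp T \<phi>" unfolding L1_supp_def \<phi>_def by auto
  then have \<phi>: "L2_supp T \<phi>" using \<phi>b by (rule L2_supp_bounded)
  note P = tconv_pairing[OF L1_suppD(1)[OF L1_supp_unit_step] \<phi> d, of T]
  have inner: "(LINT t|lborel. unit_step T (t - s) * (\<phi> t \<bullet> d s)) = - (\<eta> s * d s)" for s
  proof (cases "s \<in> {0<..<T}")
    case True
    have "(LINT t|lborel. unit_step T (t - s) * (\<phi> t \<bullet> d s)) = (LINT t|lborel. unit_step T (t - s) * \<phi> t) * d s"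
      by (simp add: mult.assoc flip: integral_mult_left_zero)
    also have "(LINT t|lborel. unit_step T (t - s) * \<phi> t) = (LINT t|lborel. indicator {s..T} t *\<^sub>R deriv \<eta> t)"
    proof (rule integral_cong_AE)
      show "AE t in lborel. unit_step T (t - s) * \<phi> t = indicator {s..T} t *\<^sub>R deriv \<eta> t"
        using AE_lborel_singleton[of s] AE_lborel_singleton[of T]
        by eventually_elim (use True in \<open>auto simp: \<phi>_def split: split_indicator\<close>)
    qed (simp_all add: \<phi>_def[abs_def])
    also have "\<dots> = \<eta> T - \<eta> s"
    proof (rule integral_FTC_atLeastAtMost)
      show "s \<le> T" using True by simp
      show "continuous_on {s..T} (deriv \<eta>)" using \<eta>'(2) by (rule continuous_on_subset) simp
      show "(\<eta> has_vector_derivative deriv \<eta> x) (at x within {s..T})" for x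
        using has_field_derivative_at_within[OF \<eta>'(1)[of x]]
        by (simp add: has_real_derivative_iff_has_vector_derivative)
    qed
    also have "\<eta> T = 0" by (rule \<eta>'(3)) simp
    finally show ?thesis by simp
  qed (simp add: L2_suppD(3)[OF d])
  have "(LINT t|lborel. unit_step T t * (deriv \<eta> t * tconv T (unit_step T) d t)) =
      (LINT t|lborel. \<phi> t \<bullet> tconv T (unit_step T) d t)"
    by (simp add: \<phi>_def mult.assoc)
  also have "\<dots> = (LINT t|lborel. LINT s|lborel. unit_step T (t - s) * (\<phi> t \<bullet> d s))" by (rule P(3))
  also have "\<dots> = (LINT s|lborel. LINT t|lborel. unit_step T (t - s) * (\<phi> t \<bullet> d s))"
    by (rule lborel_pair.Fubini_integral[OF P(1), symmetric])
  also have "\<dots> = - (LINT t|lborel. \<eta> t * d t)" unfolding inner by simp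
  finally show ?thesis .
qed

context regularized_kernel
begin

lemma regularized_kernel_conv:
  fixes v :: "real \<Rightarrow> real"
  assumes v: "L2_supp T v"
  shows "AE t in lborel. tconv T (tconv T k (h j)) v t =
    tconv T (unit_step T) (\<lambda>t. Suc j * (v t - tconv T (h j) v t)) t"
proof -
  note v1 = L2_supp_imp_L1_supp[OF v]
  have [measurable]: "v \<in> borel_measurable borel" "tconv T k (h j) \<in> borel_measurable borel"
    using L1_suppD(2)[OF v1] L1_suppD(2)[OF L1_supp_tconv[OF k_integrable h_integrable]] .
  have hv: "integrable lborel (tconv T (h j) v)"
    using L1_suppD(1)[OF L1_supp_tconv[OF h_integrable L1_suppD(1)[OF v1]]] .
  note one = L1_suppD(1)[OF L1_supp_unit_step[of T]]
  have 1: "tconv T (tconv T k (h j)) v t = Suc j * tconv T (\<lambda>t. unit_step T t - primitive j t) v t" for t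
    unfolding real_scaleR_def[symmetric] tconv_scaleR_left[symmetric]
    by (rule tconv_cong_AE) (use conv_kh[of j] in auto)
  have 2: "tconv T (unit_step T) (\<lambda>t. Suc j * (v t - tconv T (h j) v t)) t =
      Suc j * tconv T (unit_step T) (\<lambda>t. v t - tconv T (h j) v t) t" for t
    using tconv_scaleR_right[of T "unit_step T" "Suc j" "\<lambda>t. v t - tconv T (h j) v t" t] by simp
  have 3: "tconv T (unit_step T) (tconv T (h j) v) t = tconv T (primitive j) v t" for t
    unfolding primitive_def by (rule tconv_assoc_bounded[OF L1_supp_unit_step h_L1 v1, of 1]) simp
  show ?thesis
    using tconv_diff_left[OF one L1_suppD(1)[OF primitive_L1] L1_suppD(1)[OF v1], of T j]
      tconv_diff_right[OF one L1_suppD(1)[OF v1] hv, of T]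
    by eventually_elim (simp only: 1 2 3)
qed

lemma weak_derivative_regularized:
  fixes v \<eta> :: "real \<Rightarrow> real"
  assumes \<eta>: "test_function {0<..<T} \<eta>" and v: "L2_supp T v"
  shows "(LINT t|lborel. unit_step T t * (deriv \<eta> t * tconv T (tconv T k (h j)) v t)) =
    - (LINT t|lborel. unit_step T t * (\<eta> t * (Suc j * (v t - tconv T (h j) v t))))"
proof -
  let ?d = "\<lambda>t. Suc j * (v t - tconv T (h j) v t)"
  have d: "L2_supp T ?d"
    using L2_supp_scaleR[OF L2_supp_diff[OF v tconv_L2(1)[OF h_integrable v]], of "Suc j" j] by simp
  have [measurable]: "deriv \<eta> \<in> borel_measurable borel"
    using test_function_real(2)[OF \<eta>] by (rule borel_measurable_continuous_onI)
  have [measurable]: "tconv T (tconv T k (h j)) v \<in> borel_measurable borel"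
    "tconv T (unit_step T) ?d \<in> borel_measurable borel"
    using L1_suppD(2)[OF L1_supp_tconv[OF L1_suppD(1)[OF L1_supp_tconv[OF k_integrable h_integrable]] L1_suppD(1)[OF L2_supp_imp_L1_supp[OF v]]]]
      L1_suppD(2)[OF L1_supp_tconv[OF L1_suppD(1)[OF L1_supp_unit_step] L1_suppD(1)[OF L2_supp_imp_L1_supp[OF d]]]] .
  have "(LINT t|lborel. unit_step T t * (deriv \<eta> t * tconv T (tconv T k (h j)) v t)) =
      (LINT t|lborel. unit_step T t * (deriv \<eta> t * tconv T (unit_step T) ?d t))"
  proof (rule integral_cong_AE)
    show "AE t in lborel. unit_step T t * (deriv \<eta> t * tconv T (tconv T k (h j)) v t) =
        unit_step T t * (deriv \<eta> t * tconv T (unit_step T) ?d t)"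
      using regularized_kernel_conv[OF v, of j] by eventually_elim simp
  qed measurable
  also have "\<dots> = - (LINT t|lborel. \<eta> t * ?d t)"
    by (rule integration_by_parts_primitive[OF T_pos \<eta> d])
  also have "(LINT t|lborel. \<eta> t * ?d t) = (LINT t|lborel. unit_step T t * (\<eta> t * ?d t))"
    using test_function_real(3)[OF \<eta>]
    by (intro Bochner_Integration.integral_cong refl) (auto split: split_indicator)
  finally show ?thesis .
qed

end

section \<open>The energy estimate\<close>

text \<open>  The sign of \<open>h\<close> follows from the monotonicity of \<open>k\<close>, and then the sign of \<open>l\<close> from the
  resolvent equation for one \<open>n\<close>. Both hold almost everywhere, so positive parts provide
  nonnegative representatives.\<close>

lemma regularized_kernel_of_PC:
  assumes T: "0 < T" and PC: "PC k l" and h: "\<And>n. n \<ge> 1 \<Longrightarrow> resolvent_kernel l n (h n)"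
  obtains l' h' where
    "regularized_kernel T (\<lambda>t. unit_step T t * k t) l' h'"
    "AE t in lborel. l' t = unit_step T t * l t"
    "\<And>j. AE t in lborel. h' j t = unit_step T t * h (Suc j) t"
proof -
  define kT where "kT t = unit_step T t * k t" for t
  define l0 where "l0 t = unit_step T t * l t" for t
  define h0 where "h0 j t = unit_step T t * h (Suc j) t" for j t
  define h' where "h' j t = max 0 (h0 j t)" for j t
  define l' where "l' t = max 0 (l0 t)" for t
  have kT: "L1_supp T kT" and l0: "L1_supp T l0"
    using PC L1_loc_imp_L1_supp[OF _ T] unfolding PC_def kT_def[abs_def] l0_def[abs_def] by auto
  have h0: "L1_supp T (h0 j)" for j
    using h[of "Suc j"] L1_loc_imp_L1_supp[OF _ T] unfolding resolvent_kernel_def h0_def[abs_def] by auto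
  have [measurable]: "kT \<in> borel_measurable borel" "l0 \<in> borel_measurable borel" "h0 j \<in> borel_measurable borel" for j
    using L1_suppD(2)[OF kT] L1_suppD(2)[OF l0] L1_suppD(2)[OF h0] .
  have max_L1: "L1_supp T (\<lambda>t. max 0 (p t))" if p: "L1_supp T p" for p :: "real \<Rightarrow> real"
    using L1_suppD(1)[OF p] L1_suppD(3)[OF p] unfolding L1_supp_def by (auto intro!: integrable_max)
  have h'L: "L1_supp T (h' j)" for j unfolding h'_def[abs_def] by (rule max_L1[OF h0])
  have l'L: "L1_supp T l'" unfolding l'_def[abs_def] by (rule max_L1[OF l0])
  have [measurable]: "h' j \<in> borel_measurable borel" "l' \<in> borel_measurable borel" for j
    using L1_suppD(2)[OF h'L] L1_suppD(2)[OF l'L] .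
  have k_nonneg: "0 \<le> k t" if "0 < t" for t using PC that unfolding PC_def by auto
  have k_anti: "k t \<le> k s" if "0 < s" "s \<le> t" for s t
    using PC that unfolding PC_def monotone_on_def by auto
  interpret K: monotone_kernel T kT
  proof
    show "0 \<le> kT t" for t using k_nonneg by (auto simp: kT_def split: split_indicator)
    show "kT t \<le> kT s" if "0 < s" "s \<le> t" for s t
      using k_anti[OF that] k_nonneg[of s] that by (auto simp: kT_def split: split_indicator)
  qed (fact T kT)+
  have kl: "AE t in lborel. tconv T kT l0 t = unit_step T t"
  proof -
    have "AE t in lborel. 0 < t \<longrightarrow> conv k l t = 1" using PC unfolding PC_def by auto
    then show ?thesis
    proof eventually_elim
      case (elim t)
      then show ?case
        using conv_eq_tconv[of t T k l] unfolding kT_def[abs_def] l0_def[abs_def]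
        by (cases "t \<in> {0<..<T}") (auto simp: tconv_def)
    qed
  qed
  have res: "AE t in lborel. h0 j t + Suc j * tconv T (h0 j) l0 t = Suc j * l0 t" for j
  proof -
    have "AE t in lborel. 0 < t \<longrightarrow> h (Suc j) t + real (Suc j) * conv (h (Suc j)) l t = real (Suc j) * l t"
      using h[of "Suc j"] unfolding resolvent_kernel_def by auto
    then show ?thesis
    proof eventually_elim
      case (elim t)
      then show ?case
        using conv_eq_tconv[of t T "h (Suc j)" l] unfolding h0_def[abs_def] l0_def[abs_def]
        by (cases "t \<in> {0<..<T}") (auto simp: tconv_def)
    qed
  qed
  have h0_nonneg: "AE t in lborel. 0 \<le> h0 j t" for j
    by (rule K.resolvent_kernel_nonneg[OF h0 _ K.conv_kernel_resolvent[OF l0 kl h0 res]]) simp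
  have hh: "AE t in lborel. h' j t = h0 j t" for j
    using h0_nonneg[of j] by eventually_elim (simp add: h'_def)
  have "AE t in lborel. 0 \<le> l0 t"
  proof (rule kernel_nonneg_of_resolvent[OF l0 h'L[of 0]])
    have "tconv T (h' 0) l0 t = tconv T (h0 0) l0 t" for t
      by (rule tconv_cong_AE) (use hh[of 0] in auto)
    then show "AE t in lborel. h' 0 t + 1 * tconv T (h' 0) l0 t = 1 * l0 t"
      using res[of 0] hh[of 0] by (auto elim!: AE_mp)
  qed (simp_all add: h'_def)
  then have ll: "AE t in lborel. l' t = l0 t" by (auto simp: l'_def elim!: AE_mp)
  have "regularized_kernel T kT l' h'"
  proof
    show "AE t in lborel. tconv T kT l' t = unit_step T t"
    proof -
      have "tconv T kT l' t = tconv T kT l0 t" for t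
        by (rule tconv_cong_AE) (use ll in auto)
      then show ?thesis using kl by simp
    qed
    show "AE t in lborel. h' j t + real (Suc j) * tconv T (h' j) l' t = real (Suc j) * l' t" for j
    proof -
      have "tconv T (h' j) l' t = tconv T (h0 j) l0 t" for t
        by (rule tconv_cong_AE) (use ll hh in auto)
      then show ?thesis using res[of j] hh[of j] ll by (auto elim!: AE_mp)
    qed
    show "L1_supp T l'" "L1_supp T (h' j)" for j by (rule l'L h'L)+
  qed (auto simp: l'_def h'_def)
  then show thesis
    using that[of l' h'] ll hh unfolding kT_def[abs_def] l0_def h0_def by blast
qed

theorem corollary3p1:
  fixes T :: real and \<Omega> :: "'a::euclidean_space set"
    and k l :: "real \<Rightarrow> real" and h :: "nat \<Rightarrow> real \<Rightarrow> real"
    and u0 :: "'a \<Rightarrow> real" and f u w :: "real \<Rightarrow> 'a \<Rightarrow> real" and Dw :: "real \<Rightarrow> 'a \<Rightarrow> 'a"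
  assumes "0 < T"
    and "open \<Omega>" "connected \<Omega>" "\<Omega> \<noteq> {}" "bounded \<Omega>" "lipschitz_boundary \<Omega>"
    and "PC k l"
    and "\<And>n. n \<ge> 1 \<Longrightarrow> resolvent_kernel l n (h n)"
    and "L2_on \<Omega> u0"
    and "L2_on ({0<..<T} \<times> \<Omega>) (\<lambda>(t, x). f t x)"
    and "L2_on ({0<..<T} \<times> \<Omega>) (\<lambda>(t, x). u t x)"
    and "\<exists>c. continuous_L2_rep T \<Omega> (\<lambda>t x. conv k (\<lambda>s. u s x) t) c \<and>
           (AE x in lborel. x \<in> \<Omega> \<longrightarrow> c 0 x = 0)"
    and "AE (t, x) in lborel. (t, x) \<in> {0<..<T} \<times> \<Omega> \<longrightarrow> 0 \<le> w t x"
    and "L2_Sobolev T \<Omega> (H10 \<Omega>) w Dw \<and> regularized_ineq T \<Omega> (H10 \<Omega>) k h u u0 Dw f \<or>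
         L2_Sobolev T \<Omega> (H1 \<Omega>) w Dw \<and> regularized_ineq T \<Omega> (H1 \<Omega>) k h u u0 Dw f"
  shows "set_integrable lborel ({0<..<T} \<times> \<Omega>)
           (\<lambda>(t, x). (k (T - t) + k t) * (norm (bconv T l (\<lambda>s. Dw s x) t))\<^sup>2) \<and>
         (LINT t:{0<..<T}|lborel. LINT x:\<Omega>|lborel. w t x * u t x) +
         1 / 2 * (LINT t:{0<..<T}|lborel. LINT x:\<Omega>|lborel.
           (k (T - t) + k t) * (norm (bconv T l (\<lambda>s. Dw s x) t))\<^sup>2)
         \<le> (LINT t:{0<..<T}|lborel. LINT x:\<Omega>|lborel.
           (u0 x + conv l (\<lambda>s. f s x) t) * w t x)"
proof -
  note T = \<open>0 < T\<close> and PC = \<open>PC k l\<close>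
  obtain V where V: "L2_Sobolev T \<Omega> V w Dw" "regularized_ineq T \<Omega> V k h u u0 Dw f"
    using assms(14) by blast
  obtain l' h' where "regularized_kernel T (\<lambda>t. unit_step T t * k t) l' h'"
    and l': "AE t in lborel. l' t = unit_step T t * l t"
    and h': "\<And>j. AE t in lborel. h' j t = unit_step T t * h (Suc j) t"
    using regularized_kernel_of_PC[OF T PC assms(8)] by blast
  then interpret R: regularized_kernel T "\<lambda>t. unit_step T t * k t" l' h' by simp
  let ?kT = "\<lambda>t. unit_step T t * k t"
  let ?S = "{0<..<T} \<times> \<Omega>"
  have S [measurable]: "?S \<in> sets borel" using \<open>open \<Omega>\<close> by (auto intro!: borel_open open_Times)
  define uT where "uT t x = indicator ?S (t, x) * u t x" for t x
  define wT where "wT t x = indicator ?S (t, x) * w t x" for t x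
  define fT where "fT t x = indicator ?S (t, x) * f t x" for t x
  define DT where "DT t x = indicator ?S (t, x) *\<^sub>R Dw t x" for t x
  define cT where "cT t x = unit_step T t * (indicator \<Omega> x * u0 x)" for t x
  define v where "v t x = uT t x - cT t x" for t x
  have u: "L2_cyl T uT" and f: "L2_cyl T fT"
    using L2_on_imp_L2_cyl[OF assms(11)] L2_on_imp_L2_cyl[OF assms(10)]
    unfolding uT_def[abs_def] fT_def[abs_def] by auto
  have w: "L2_cyl T wT" and W: "L2_cyl T DT"
    using V(1) L2_on_imp_L2_cyl[of T \<Omega> w] L2_on_imp_L2_cyl[of T \<Omega> Dw]
    unfolding L2_Sobolev_def wT_def[abs_def] DT_def[abs_def] by auto
  have c: "L2_cyl T cT" unfolding cT_def[abs_def] by (rule L2_cyl_constant[OF assms(9)])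
  have v: "L2_cyl T v" unfolding v_def[abs_def] by (rule L2_cyl_diff[OF u c])
  have PCk: "L1_loc k" "L1_loc l" using PC unfolding PC_def by auto
  have h1: "L1_loc (h (Suc j))" for j using assms(8)[of "Suc j"] unfolding resolvent_kernel_def by auto
  have [measurable]: "?kT \<in> borel_measurable borel" "(\<lambda>t. unit_step T t * l t) \<in> borel_measurable borel"
    "(\<lambda>t. unit_step T t * h (Suc j) t) \<in> borel_measurable borel" for j
    using L1_suppD(2)[OF L1_loc_imp_L1_supp[OF _ T]] PCk h1 by auto
  have conv_h: "conv (h (Suc j)) (\<lambda>s. F s x) t = tconv T (h' j) (\<lambda>s. indicator ?S (s, x) *\<^sub>R F s x) t"
    if "t \<in> {0<..<T}" "x \<in> \<Omega>" "L2_cyl T (\<lambda>t x. indicator ?S (t, x) *\<^sub>R F t x)"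
    for F :: "real \<Rightarrow> 'a \<Rightarrow> 'b::euclidean_space" and t x j
  proof -
    have eq: "(\<lambda>s. unit_step T s *\<^sub>R F s x) = (\<lambda>s. indicator ?S (s, x) *\<^sub>R F s x)"
      using that by (auto split: split_indicator)
    show ?thesis
      unfolding conv_eq_tconv[OF that(1)] eq
      by (rule tconv_cong_AE) (use h'[of j] L2_cyl_slice(4)[OF that(3)] in auto)
  qed
  have conv_l: "conv l (\<lambda>s. f s x) t = tconv T l' (\<lambda>s. fT s x) t" if "t \<in> {0<..<T}" "x \<in> \<Omega>" for t x
  proof -
    have eq: "(\<lambda>s. unit_step T s *\<^sub>R f s x) = (\<lambda>s. fT s x)"
      using that by (auto simp: fT_def split: split_indicator)
    show ?thesis
      unfolding conv_eq_tconv[OF that(1)] eq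
      by (rule tconv_cong_AE) (use l' L2_cyl_slice(4)[OF f] in auto)
  qed
  have bconv_l: "bconv T l (\<lambda>s. Dw s x) t = tbconv T l' (\<lambda>s. DT s x) t" if "t \<in> {0<..<T}" "x \<in> \<Omega>" for t x
  proof -
    have eq: "(\<lambda>s. unit_step T s *\<^sub>R Dw s x) = (\<lambda>s. DT s x)"
      using that by (auto simp: DT_def split: split_indicator)
    show ?thesis
      unfolding bconv_eq_tbconv[OF that(1)] eq
      by (rule tbconv_cong_AE) (use l' L2_cyl_slice(4)[OF W] in auto)
  qed
  have conv_kh: "conv (conv k (h (Suc j))) (\<lambda>s. u s x - u0 x) t = tconv T (tconv T ?kT (h' j)) (\<lambda>s. v s x) t"
    if t: "t \<in> {0<..<T}" and x: "x \<in> \<Omega>" for t x j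
  proof -
    have eq: "(\<lambda>s. unit_step T s *\<^sub>R (u s x - u0 x)) = (\<lambda>s. v s x)"
      using x by (auto simp: v_def uT_def cT_def split: split_indicator)
    have "unit_step T s * conv k (h (Suc j)) s = tconv T ?kT (h' j) s" for s
    proof (cases "s \<in> {0<..<T}")
      case True
      have "conv k (h (Suc j)) s = tconv T ?kT (\<lambda>s. unit_step T s * h (Suc j) s) s"
        using conv_eq_tconv[OF True, of k "h (Suc j)"] by simp
      also have "\<dots> = tconv T ?kT (h' j) s"
        by (rule tconv_cong_AE) (use h'[of j] in auto)
      finally show ?thesis using True by simp
    qed (simp add: tconv_def)
    then show ?thesis unfolding conv_eq_tconv[OF t] eq by simp
  qed
  have ineq: "AE s in lborel. s \<in> {0<..<T} \<longrightarrow> (AE t in lborel. t \<in> {0<..<T} \<longrightarrow>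
      (LINT x|lborel. wT s x * R.regularized_derivative j v t x + tconv T (h' j) (\<lambda>r. DT r x) t \<bullet> DT s x) \<le>
      (LINT x|lborel. tconv T (h' j) (\<lambda>r. fT r x) t * wT s x))" for j
  proof -
    \<comment> \<open>\<open>D\<close> may be any representative of the derivative; the explicit one is chosen.\<close>
    have wtd: "weak_time_derivative T \<Omega> (\<lambda>t x. conv (conv k (h (Suc j))) (\<lambda>s. u s x - u0 x) t) (R.regularized_derivative j v)"
      unfolding weak_time_derivative_def
    proof (intro conjI allI impI)
      show "L2_on ({0<..<T} \<times> \<Omega>) (\<lambda>(t, x). R.regularized_derivative j v t x)"
        by (rule L2_cyl_imp_L2_on[OF R.regularized_derivative_L2_cyl[OF v] S])
      fix \<eta> :: "real \<Rightarrow> real" assume \<eta>: "test_function {0<..<T} \<eta>"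
      show "AE x in lborel. x \<in> \<Omega> \<longrightarrow>
          (LINT t:{0<..<T}|lborel. deriv \<eta> t * conv (conv k (h (Suc j))) (\<lambda>s. u s x - u0 x) t) =
          - (LINT t:{0<..<T}|lborel. \<eta> t * R.regularized_derivative j v t x)"
        using L2_cyl_slice(1)[OF v]
      proof (eventually_elim, intro impI)
        case (elim x)
        assume x: "x \<in> \<Omega>"
        have "(LINT t:{0<..<T}|lborel. deriv \<eta> t * conv (conv k (h (Suc j))) (\<lambda>s. u s x - u0 x) t) =
            (LINT t|lborel. unit_step T t * (deriv \<eta> t * tconv T (tconv T ?kT (h' j)) (\<lambda>s. v s x) t))"
          unfolding set_lebesgue_integral_def using conv_kh[OF _ x]
          by (intro Bochner_Integration.integral_cong refl) (auto split: split_indicator)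
        then show "(LINT t:{0<..<T}|lborel. deriv \<eta> t * conv (conv k (h (Suc j))) (\<lambda>s. u s x - u0 x) t) =
            - (LINT t:{0<..<T}|lborel. \<eta> t * R.regularized_derivative j v t x)"
          using R.weak_derivative_regularized[OF \<eta> elim, of j]
          by (simp add: set_lebesgue_integral_def R.regularized_derivative_def)
      qed
    qed
    \<comment> \<open>For almost every \<open>s\<close> the function \<open>w s\<close> is an admissible test function.\<close>
    have w_nonneg: "AE t in lborel. AE x in lborel. (t, x) \<in> ?S \<longrightarrow> 0 \<le> w t x"
    proof -
      have "AE z in lborel \<Otimes>\<^sub>M lborel. z \<in> ?S \<longrightarrow> 0 \<le> w (fst z) (snd z)"
        using assms(13) unfolding lborel_prod by (simp add: case_prod_unfold mem_Times_iff conj_assoc)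
      from lborel_pair.AE_pair[OF this] show ?thesis by simp
    qed
    have w_V: "AE t in lborel. t \<in> {0<..<T} \<longrightarrow> w t \<in> V \<and> weak_gradient \<Omega> (w t) (Dw t)"
      using V(1) unfolding L2_Sobolev_def by auto
    show ?thesis
      using w_nonneg w_V
    proof (eventually_elim, intro impI)
      case (elim s)
      assume s: "s \<in> {0<..<T}"
      have nn: "AE x in lborel. x \<in> \<Omega> \<longrightarrow> 0 \<le> w s x" using elim(1) s by (auto elim!: AE_mp)
      have "AE t in lborel. t \<in> {0<..<T} \<longrightarrow>
          (LINT x:\<Omega>|lborel. w s x * R.regularized_derivative j v t x + conv (h (Suc j)) (\<lambda>r. Dw r x) t \<bullet> Dw s x)
          \<le> (LINT x:\<Omega>|lborel. conv (h (Suc j)) (\<lambda>r. f r x) t * w s x)"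
        using V(2) elim(2) s nn wtd unfolding regularized_ineq_def by simp
      then show "AE t in lborel. t \<in> {0<..<T} \<longrightarrow>
          (LINT x|lborel. wT s x * R.regularized_derivative j v t x + tconv T (h' j) (\<lambda>r. DT r x) t \<bullet> DT s x) \<le>
          (LINT x|lborel. tconv T (h' j) (\<lambda>r. fT r x) t * wT s x)"
      proof (eventually_elim, intro impI)
        case (elim t)
        assume t: "t \<in> {0<..<T}"
        have "(LINT x:\<Omega>|lborel. w s x * R.regularized_derivative j v t x + conv (h (Suc j)) (\<lambda>r. Dw r x) t \<bullet> Dw s x) =
            (LINT x|lborel. wT s x * R.regularized_derivative j v t x + tconv T (h' j) (\<lambda>r. DT r x) t \<bullet> DT s x)"
          unfolding set_lebesgue_integral_def
          using s conv_h[OF t _ W[unfolded DT_def[abs_def]], of _ j]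
          by (intro Bochner_Integration.integral_cong refl)
            (auto simp: wT_def DT_def split: split_indicator)
        moreover have "(LINT x:\<Omega>|lborel. conv (h (Suc j)) (\<lambda>r. f r x) t * w s x) =
            (LINT x|lborel. tconv T (h' j) (\<lambda>r. fT r x) t * wT s x)"
          unfolding set_lebesgue_integral_def
          using s conv_h[OF t, of _ f j] f unfolding fT_def[abs_def]
          by (intro Bochner_Integration.integral_cong refl)
            (auto simp: wT_def split: split_indicator)
        ultimately show "(LINT x|lborel. wT s x * R.regularized_derivative j v t x + tconv T (h' j) (\<lambda>r. DT r x) t \<bullet> DT s x) \<le>
          (LINT x|lborel. tconv T (h' j) (\<lambda>r. fT r x) t * wT s x)" using elim t by simp
      qed
    qed
  qed
  note limit = R.limit_inequality[OF v w f W ineq]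
  note energy = R.gradient_energy[OF W]
  have slab: "(LINT t:{0<..<T}|lborel. LINT x:\<Omega>|lborel. F t x) = (LINT t|lborel. LINT x|lborel. G t x)"
    if "\<And>t x. indicator ?S (t, x) * F t x = G t x" for F G :: "real \<Rightarrow> 'a \<Rightarrow> real"
  proof -
    have "indicator {0<..<T} t *\<^sub>R (LINT x:\<Omega>|lborel. F t x) = (LINT x|lborel. G t x)" for t
      unfolding set_lebesgue_integral_def integral_scaleR_right[symmetric] that[symmetric]
      by (intro Bochner_Integration.integral_cong refl) (auto split: split_indicator)
    then show ?thesis unfolding set_lebesgue_integral_def[of _ "{0<..<T}"] by simp
  qed
  let ?e = "\<lambda>t x. (?kT (T - t) + ?kT t) * (norm (tbconv T l' (\<lambda>s. DT s x) t))\<^sup>2"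
  have e: "indicator ?S (t, x) * ((k (T - t) + k t) * (norm (bconv T l (\<lambda>s. Dw s x) t))\<^sup>2) = ?e t x" for t x
  proof (cases "(t, x) \<in> ?S")
    case True
    then show ?thesis using bconv_l[of t x] by simp
  next
    case False
    then have "tbconv T l' (\<lambda>s. DT s x) t = 0"
      by (cases "t \<in> {0<..<T}") (auto simp: tbconv_def DT_def)
    then show ?thesis using False by simp
  qed
  have int: "set_integrable lborel ?S (\<lambda>(t, x). (k (T - t) + k t) * (norm (bconv T l (\<lambda>s. Dw s x) t))\<^sup>2)"
  proof -
    have "(\<lambda>z. indicator ?S z *\<^sub>R (case z of (t, x) \<Rightarrow> (k (T - t) + k t) * (norm (bconv T l (\<lambda>s. Dw s x) t))\<^sup>2)) =
        (\<lambda>(t, x). ?e t x)"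
      using e by auto
    then show ?thesis using energy(1) unfolding set_integrable_def by (simp add: lborel_prod)
  qed
  have lf: "L2_cyl T (\<lambda>t x. tconv T l' (\<lambda>s. fT s x) t)" by (rule L2_cyl_tconv[OF R.l_integrable f])
  note iu = L2_cyl_inner[OF w u, unfolded inner_real_def] and ic = L2_cyl_inner[OF w c, unfolded inner_real_def]
    and il = L2_cyl_inner[OF w lf, unfolded inner_real_def] and iv = L2_cyl_inner[OF w v, unfolded inner_real_def]
  let ?I = "\<lambda>F. LINT z|(lborel \<Otimes>\<^sub>M lborel). (case z of (t, x) \<Rightarrow> wT t x * F t x)"
  have lhs: "(LINT t:{0<..<T}|lborel. LINT x:\<Omega>|lborel. w t x * u t x) = ?I uT"
    unfolding lborel_pair.integral_fst[OF iu, symmetric]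
    by (rule slab) (auto simp: wT_def uT_def split: split_indicator)
  have rhs: "(LINT t:{0<..<T}|lborel. LINT x:\<Omega>|lborel. (u0 x + conv l (\<lambda>s. f s x) t) * w t x) =
      ?I cT + ?I (\<lambda>t x. tconv T l' (\<lambda>s. fT s x) t)"
  proof -
    have i: "integrable (lborel \<Otimes>\<^sub>M lborel) (\<lambda>(t, x). wT t x * cT t x + wT t x * tconv T l' (\<lambda>s. fT s x) t)"
      using Bochner_Integration.integrable_add[OF ic il] by (simp add: case_prod_unfold)
    have "(LINT t:{0<..<T}|lborel. LINT x:\<Omega>|lborel. (u0 x + conv l (\<lambda>s. f s x) t) * w t x) =
        (LINT t|lborel. LINT x|lborel. wT t x * cT t x + wT t x * tconv T l' (\<lambda>s. fT s x) t)"
    proof (rule slab)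
      fix t x
      show "indicator ?S (t, x) * ((u0 x + conv l (\<lambda>s. f s x) t) * w t x) =
          wT t x * cT t x + wT t x * tconv T l' (\<lambda>s. fT s x) t"
        using conv_l[of t x] by (auto simp: wT_def cT_def algebra_simps split: split_indicator)
    qed
    also have "\<dots> = (LINT z|(lborel \<Otimes>\<^sub>M lborel). (case z of (t, x) \<Rightarrow> wT t x * cT t x + wT t x * tconv T l' (\<lambda>s. fT s x) t))"
      by (rule lborel_pair.integral_fst[OF i])
    also have "\<dots> = ?I cT + ?I (\<lambda>t x. tconv T l' (\<lambda>s. fT s x) t)"
      using Bochner_Integration.integral_add[OF ic il] by (simp add: case_prod_unfold)
    finally show ?thesis .
  qed
  have iV: "?I v = ?I uT - ?I cT"
    using Bochner_Integration.integral_diff[OF iu ic] by (simp add: case_prod_unfold v_def right_diff_distrib)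
  have "?I v + (LINT x|lborel. LINT s|lborel. DT s x \<bullet> tconv T l' (\<lambda>t. DT t x) s) \<le>
      ?I (\<lambda>t x. tconv T l' (\<lambda>s. fT s x) t)"
    using limit unfolding lborel_pair.integral_snd[OF iv, symmetric] lborel_pair.integral_snd[OF il, symmetric] .
  moreover have "(LINT t:{0<..<T}|lborel. LINT x:\<Omega>|lborel.
      (k (T - t) + k t) * (norm (bconv T l (\<lambda>s. Dw s x) t))\<^sup>2) = (LINT t|lborel. LINT x|lborel. ?e t x)"
    by (rule slab[OF e])
  ultimately show ?thesis using int energy(2) unfolding lhs rhs iV by simp
qed

end
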